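(* For every integer $n\geq1$, one has $2^{n+1}F_n=D(R_{n+1})$, where $F_n$, $R_{n+1}$ and $D$ are as defined in the context.
   Context: All maps are rooted (a distinguished corner, whose vertex is the root vertex). A unicellular map is a map (connected graph with rotation system / embedded in a closed oriented surface with disk complement) with exactly one face. A bipartite map is endowed with its unique proper black/white vertex coloring in which the root vertex is black; for an edge $e$, $b_e$ and $w_e$ denote its black and white endpoints. Let $p_1,p_2,\dots$ and $q_1,q_2,\dots$ be commuting indeterminates. For a bipartite map $M$ with vertex set $V_M$, black vertices $V_M^\bullet$ and white vertices $V_M^\circ$, and a function $\phi:V_M\to\{1,2,3,\dots\}$, say $\phi$ satisfies the order condition if $\phi(b_e)\geq\phi(w_e)$ for every edge $e$; define the weight $\mathrm{wt}(M,\phi)=\prod_{v\in V_M^\circ}p_{\phi(v)}\prod_{v\in V_M^\bullet}q_{\phi(v)}$. Let $F_n=\sum_{(M,\phi)}\mathrm{wt}(M,\phi)$, summed over all rooted bipartite unicellular maps $M$ (of any genus) with $n$ edges and all $\phi$ satisfying the order condition, and let $R_{n+1}=\sum_{(T,\phi)}\mathrm{wt}(T,\phi)$, summed over all plane trees $T$ (rooted unicellular maps of genus $0$) with $n$ edges and all $\phi$ satisfying the order condition. Both are formal power series in the $p_i,q_i$. A C-permutation on $k$ elements is a permutation all of whose cycles have odd length, each cycle carrying a sign $\pm$; its genus is $(k-\ell)/2$ where $\ell$ is its number of cycles; $c_g(k)$ is the number of C-permutations of genus $g$ on $k$ elements. The linear operator $D$ is defined by $D(x^k)=\sum_{g\geq0}c_g(k)x^{k-2g}$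 for each variable $x$ and $k\ge0$, extended multiplicatively to monomials in distinct variables ($D(\prod_i x_i^{k_i})=\prod_i D(x_i^{k_i})$) and then linearly to polynomials and formal power series in the variables $p_i,q_i$. *)

theory Defs
  imports
    "HOL-Combinatorics.Orbits"
    "HOL-Library.FuncSet"
    "HOL-Library.Poly_Mapping"
begin

section \<open>Rooted maps\<close>

text \<open>
  A map is encoded by its darts (half-edges), the rotation \<open>rot\<close> (the next dart around the same
  vertex) and the edge involution \<open>opp\<close> (the other half of the same edge).  Corners correspond to
  darts, a corner being the one that follows its dart in the rotation, so the root corner is
  given by a dart.  The map with a single vertex and no edge is not covered by this encoding.
\<close>

record 'd rmap =
  darts :: "'d set"
  rot :: "'d \<Rightarrow> 'd"
  opp :: "'d \<Rightarrow> 'd"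
  root_dart :: 'd

definition connected_map :: "'d rmap \<Rightarrow> bool" where
  "connected_map M \<longleftrightarrow>
     (\<forall>d\<in>darts M. \<forall>d'\<in>darts M.
        (d, d') \<in> {(x, y). x \<in> darts M \<and> (y = rot M x \<or> y = opp M x)}\<^sup>*)"

definition rooted_map :: "'d rmap \<Rightarrow> bool" where
  "rooted_map M \<longleftrightarrow>
     finite (darts M) \<and> rot M permutes darts M \<and> opp M permutes darts M \<and>
     (\<forall>d\<in>darts M. opp M d \<noteq> d \<and> opp M (opp M d) = d) \<and>
     connected_map M \<and> root_dart M \<in> darts M"

definition vertex_of :: "'d rmap \<Rightarrow> 'd \<Rightarrow> 'd set" where
  "vertex_of M d = orbit (rot M) d"

definition vertices :: "'d rmap \<Rightarrow> 'd set set" where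
  "vertices M = vertex_of M ` darts M"

definition edges :: "'d rmap \<Rightarrow> 'd set set" where
  "edges M = (\<lambda>d. {d, opp M d}) ` darts M"

definition faces :: "'d rmap \<Rightarrow> 'd set set" where
  "faces M = orbit (rot M \<circ> opp M) ` darts M"

definition unicellular :: "'d rmap \<Rightarrow> bool" where
  "unicellular M \<longleftrightarrow> card (faces M) = 1"

definition has_genus :: "'d rmap \<Rightarrow> nat \<Rightarrow> bool" where
  "has_genus M g \<longleftrightarrow>
     int (card (vertices M)) - int (card (edges M)) + int (card (faces M)) = 2 - 2 * int g"

definition rmap_iso :: "'d rmap \<Rightarrow> 'e rmap \<Rightarrow> bool" where
  "rmap_iso M N \<longleftrightarrow>
     (\<exists>f. bij_betw f (darts M) (darts N) \<and>
          (\<forall>d\<in>darts M. f (rot M d) = rot N (f d) \<and> f (opp M d) = opp N (f d)) \<and>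
          f (root_dart M) = root_dart N)"

definition labelled_maps :: "nat \<Rightarrow> nat rmap set" where
  "labelled_maps n = {M. rooted_map M \<and> darts M = {..<2 * n}}"

definition iso_rel :: "nat \<Rightarrow> (nat rmap \<times> nat rmap) set" where
  "iso_rel n = {(M, N). M \<in> labelled_maps n \<and> N \<in> labelled_maps n \<and> rmap_iso M N}"

text \<open>
  Rooted maps are considered up to root-preserving isomorphism: this is a system of
  representatives (one for each isomorphism class) of the rooted maps with \<open>n\<close> edges.
\<close>

definition rooted_maps :: "nat \<Rightarrow> nat rmap set" where
  "rooted_maps n = (\<lambda>C. SOME M. M \<in> C) ` (labelled_maps n // iso_rel n)"

section \<open>Bipartite maps\<close>

definition color_class :: "'d rmap \<Rightarrow> 'd set set \<Rightarrow> bool" where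
  "color_class M B \<longleftrightarrow> B \<subseteq> vertices M \<and>
     (\<forall>d\<in>darts M. vertex_of M d \<in> B \<longleftrightarrow> vertex_of M (opp M d) \<notin> B)"

definition bipartite :: "'d rmap \<Rightarrow> bool" where
  "bipartite M \<longleftrightarrow> (\<exists>B. color_class M B)"

text \<open>
  By connectedness, a proper two-coloring of a bipartite map is determined by the color of the
  root vertex.
\<close>

definition black_vertices :: "'d rmap \<Rightarrow> 'd set set" where
  "black_vertices M = (THE B. color_class M B \<and> vertex_of M (root_dart M) \<in> B)"

definition white_vertices :: "'d rmap \<Rightarrow> 'd set set" where
  "white_vertices M = vertices M - black_vertices M"

definition black_end :: "'d rmap \<Rightarrow> 'd set \<Rightarrow> 'd set" where
  "black_end M e = (THE v. v \<in> black_vertices M \<and> v \<inter> e \<noteq> {})"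

definition white_end :: "'d rmap \<Rightarrow> 'd set \<Rightarrow> 'd set" where
  "white_end M e = (THE v. v \<in> white_vertices M \<and> v \<inter> e \<noteq> {})"

definition order_condition :: "'d rmap \<Rightarrow> ('d set \<Rightarrow> nat) \<Rightarrow> bool" where
  "order_condition M \<phi> \<longleftrightarrow> (\<forall>e\<in>edges M. \<phi> (black_end M e) \<ge> \<phi> (white_end M e))"

definition order_labellings :: "'d rmap \<Rightarrow> ('d set \<Rightarrow> nat) set" where
  "order_labellings M = {\<phi> \<in> vertices M \<rightarrow>\<^sub>E {1..}. order_condition M \<phi>}"

section \<open>Power series in the variables \<open>p\<^sub>i\<close>, \<open>q\<^sub>i\<close>\<close>

text \<open>
  \<open>Pvar i\<close> and \<open>Qvar i\<close> stand for \<open>p\<^sub>i\<close> and \<open>q\<^sub>i\<close>; only indices \<open>i \<ge> 1\<close> occur.  A monomial is its finitely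
  supported exponent function, a polynomial a finitely supported family of coefficients, and a
  formal power series an arbitrary family of coefficients.
\<close>

datatype var = Pvar nat | Qvar nat

type_synonym monomial = "var \<Rightarrow>\<^sub>0 nat"
type_synonym polynomial = "monomial \<Rightarrow>\<^sub>0 int"
type_synonym series = "monomial \<Rightarrow> int"

definition wt :: "'d rmap \<Rightarrow> ('d set \<Rightarrow> nat) \<Rightarrow> monomial" where
  "wt M \<phi> = (\<Sum>v\<in>white_vertices M. Poly_Mapping.single (Pvar (\<phi> v)) 1)
           + (\<Sum>v\<in>black_vertices M. Poly_Mapping.single (Qvar (\<phi> v)) 1)"

text \<open>
  The coefficientwise sum of the monomials \<open>wt M \<phi>\<close>, where \<open>M\<close> ranges over a set of maps and \<open>\<phi>\<close>
  over the labellings satisfying the order condition.  For finitely many (finite) maps, only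
  finitely many pairs have a given weight.
\<close>

definition weight_series :: "'d rmap set \<Rightarrow> series" where
  "weight_series \<M> = (\<lambda>m. int (card {(M, \<phi>). M \<in> \<M> \<and> \<phi> \<in> order_labellings M \<and> wt M \<phi> = m}))"

definition F_series :: "nat \<Rightarrow> series" where
  "F_series n = weight_series {M \<in> rooted_maps n. unicellular M \<and> bipartite M}"

text \<open>The index of \<open>R_series\<close> is the number of vertices of the trees.\<close>

definition plane_trees :: "nat \<Rightarrow> nat rmap set" where
  "plane_trees n = {M \<in> rooted_maps n. unicellular M \<and> has_genus M 0}"

definition R_series :: "nat \<Rightarrow> series" where
  "R_series k = weight_series (plane_trees (k - 1))"

section \<open>C-permutations and the operator \<open>D_op\<close>\<close>

definition perm_cycles :: "nat \<Rightarrow> (nat \<Rightarrow> nat) \<Rightarrow> nat set set" where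
  "perm_cycles k \<pi> = orbit \<pi> ` {..<k}"

definition C_permutations :: "nat \<Rightarrow> ((nat \<Rightarrow> nat) \<times> (nat set \<Rightarrow> bool)) set" where
  "C_permutations k =
     {(\<pi>, s). \<pi> permutes {..<k} \<and> (\<forall>c\<in>perm_cycles k \<pi>. odd (card c)) \<and>
             s \<in> perm_cycles k \<pi> \<rightarrow>\<^sub>E UNIV}"

definition C_count :: "nat \<Rightarrow> nat \<Rightarrow> nat" where
  "C_count g k = card {(\<pi>, s). (\<pi>, s) \<in> C_permutations k \<and> k = card (perm_cycles k \<pi>) + 2 * g}"

text \<open>The sum is over all \<open>g\<close> with \<open>2 * g \<le> k\<close>; for other \<open>g\<close> one has \<open>C_count g k = 0\<close>.\<close>

definition D_power :: "var \<Rightarrow> nat \<Rightarrow> polynomial" where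
  "D_power x k = (\<Sum>g\<le>k div 2.
     Poly_Mapping.single (Poly_Mapping.single x (k - 2 * g)) (int (C_count g k)))"

definition D_monomial :: "monomial \<Rightarrow> polynomial" where
  "D_monomial m = (\<Prod>x\<in>Poly_Mapping.keys m. D_power x (Poly_Mapping.lookup m x))"

text \<open>
  \<open>D_op\<close> is extended to series coefficientwise.  This needs only finitely many monomials of the
  argument to contribute to each coefficient of the result, which holds for series of bounded
  degree (\<open>R_series k\<close> is homogeneous), because \<open>D_monomial m\<close> only involves monomials with the same
  variables as \<open>m\<close>.  Where it fails, \<^const>\<open>Sum_any\<close> yields the junk value 0.
\<close>

definition D_op :: "series \<Rightarrow> series" where
  "D_op f = (\<lambda>m'. Sum_any (\<lambda>m. f m * Poly_Mapping.lookup (D_monomial m) m'))"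

end

theory Submission
  imports Defs "HOL-Library.Disjoint_Sets"
begin

text \<open>
  Cut all maps into half-edges (darts): fix the edge involution on the darts and a colouring of the
  darts by variables, and count the rotations that preserve the colours and have a single face.

  Contracting the colour classes gives a graph \<open>G\<close> with \<open>r\<close> vertices and \<open>n\<close> edges.  One-face
  rotations are Eulerian tours of the bidirected graph \<open>G\<close>; by the BEST theorem there are
  \<open>\<tau> * (\<Prod>v. (deg v - 1)!)\<close> of them, where \<open>\<tau>\<close> is the number of spanning trees.  A plane tree with a
  colour-preserving map to \<open>G\<close> that is bijective on edges is encoded by its parent darts and its
  parent function, and a Pruefer code shows that there are \<open>2^(n+1-r) * \<tau> * (\<Prod>v. (deg v - 1)!)\<close> such
  trees when the vertices in each of the \<open>r\<close> fibres are linearly ordered: a spanning tree of last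
  letters, and an arbitrary choice of a parent dart on each of the other \<open>n + 1 - r\<close> edges.  Hence
  \<open>2^(n+1)\<close> times the number of one-face rotations equals the sum over plane trees of
  \<open>\<Prod>v. 2 * (k\<^sub>v)!\<close>, with \<open>k\<^sub>v\<close> vertices over \<open>v\<close>.

  Since \<open>2 * k!\<close> is the number of C-permutations of \<open>k > 0\<close> elements, this is the claim summed over all
  ways of splitting the vertices of \<open>G\<close>, and inversion over the partitions of the darts yields
  the claim for each fixed set of vertices.
\<close>

section \<open>Permutations and their orbits\<close>

text \<open>Bipartiteness, the black root and the order condition only concern the colours of the
  root dart and of the two darts of each edge. They are conditions on the coloured graph
  \<open>G\<close>, shared by the unicellular maps and the trees over it, so the identity can be
  proved for one colouring at a time.

  A face is a cyclic sequence without a beginning, whereas the BEST theorem and parent functions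
  need a root. Hence an extra dart, the leg, marks a corner of a fixed colour; it can be attached in
  equally many ways on both sides, and this number cancels.

  The \<open>r - 1\<close> edges of a spanning tree have a forced direction, so
  \<open>2 ^ (n + 1 - r)\<close> is \<open>2 ^ (n + 1)\<close> with one factor 2 removed per colour.
  This is the 2 in \<open>2 * k!\<close>; the factor \<open>k!\<close> orders the vertices of a
  fibre.

  \<open>D_op\<close> separates C-permutations by their number of cycles, while the identity for
  \<open>G\<close> only sees their total number. Gluing the vertices of a tree along the cycles of a
  C-permutation turns both sides into functions of a partition of the darts, and the freedom in the
  colouring then separates them.\<close>

definition invar :: "('a \<Rightarrow> 'b) \<Rightarrow> 'a set \<Rightarrow> ('a \<Rightarrow> 'a) set" where
  "invar c D = {\<rho>. \<rho> permutes D \<and> (\<forall>x\<in>D. c (\<rho> x) = c x)}"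

text \<open>With \<open>f = \<rho> \<circ> opp\<close>, whose orbits are the faces of the map with
  rotation \<rho>, this is the unicellular condition. A rotation in \<open>invar c D\<close> has
  monochromatic vertices, so that \<open>c\<close> also colours the vertices.\<close>

definition one_orbit :: "('a \<Rightarrow> 'a) \<Rightarrow> 'a set \<Rightarrow> bool" where
  "one_orbit f D \<longleftrightarrow> (\<forall>x\<in>D. orbit f x = D)"

section \<open>Orbits of permutations of a finite set\<close>

lemma perm_self_in_orbit: "finite D \<Longrightarrow> f permutes D \<Longrightarrow> x \<in> orbit f x"
  by (metis permutation_permutes permutation_self_in_orbit)

lemma perm_orbit_eq: "finite D \<Longrightarrow> f permutes D \<Longrightarrow> y \<in> orbit f x \<Longrightarrow> orbit f y = orbit f x"
  by (metis cyclic_on_orbit orbit_cyclic_eq3)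

lemma perm_orbit_step: "finite D \<Longrightarrow> f permutes D \<Longrightarrow> orbit f (f x) = orbit f x"
  by (metis permutation_permutes permutation_orbit_step)

lemma orbit_sub: "f permutes D \<Longrightarrow> x \<in> D \<Longrightarrow> orbit f x \<subseteq> D"
  by (rule permutes_orbit_subset)

lemma invar_const_orbit:
  assumes "\<rho> \<in> invar c D" "x \<in> D" "y \<in> orbit \<rho> x" shows "c y = c x"
  using assms(3)
proof induction
  case base then show ?case using assms(1,2) by (auto simp: invar_def)
next
  case (step y)
  have "y \<in> D" using step.hyps assms(1,2) orbit_sub by (fastforce simp: invar_def)
  then show ?case using step assms(1) by (auto simp: invar_def)
qed

lemma invar_iff_orbit:
  assumes "finite D" "\<rho> permutes D"
  shows "\<rho> \<in> invar c D \<longleftrightarrow> (\<forall>x\<in>D. \<forall>y\<in>orbit \<rho> x. c y = c x)"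
proof
  show "\<rho> \<in> invar c D \<Longrightarrow> \<forall>x\<in>D. \<forall>y\<in>orbit \<rho> x. c y = c x" using invar_const_orbit by metis
  assume "\<forall>x\<in>D. \<forall>y\<in>orbit \<rho> x. c y = c x"
  then have "\<forall>x\<in>D. c (\<rho> x) = c x" using orbit.base[of \<rho>] by blast
  then show "\<rho> \<in> invar c D" using assms(2) by (simp add: invar_def)
qed

lemma orbit_partition:
  assumes "finite D" "\<rho> permutes D"
  shows "partition_on D (orbit \<rho> ` D)"
proof (rule partition_onI)
  show "\<Union> (orbit \<rho> ` D) = D"
    using perm_self_in_orbit[OF assms] orbit_sub[OF assms(2)] by blast
  show "disjnt p q" if "p \<in> orbit \<rho> ` D" "q \<in> orbit \<rho> ` D" "p \<noteq> q" for p q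
    using that perm_orbit_eq[OF assms] unfolding disjnt_iff by (smt (verit, best) imageE)
  show "{} \<notin> orbit \<rho> ` D"
    by (metis imageE orbit_nonempty)
qed

text \<open>Left multiplication by \<open>transpose l d\<close> splices the new point
  \<open>l\<close> into a cycle just before \<open>d\<close> and changes nothing else. Attaching a
  leg to a map and the recursions over permutations are both of this kind.\<close>

lemma transpose_insert_orbit:
  assumes "finite D" "f permutes D" "l \<notin> D" "d \<in> D" "x \<in> D"
  shows "orbit (transpose l d \<circ> f) x = (if d \<in> orbit f x then insert l (orbit f x) else orbit f x)"
proof -
  define g where "g = transpose l d \<circ> f"
  have gp: "g permutes insert l D"
    unfolding g_def
    using assms by (intro permutes_compose permutes_imp_permutes_insert permutes_swap_id) auto
  have fin: "finite (insert l D)" using assms by auto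
  have fl: "f l = l" using assms(2,3) by (simp add: permutes_not_in)
  have gl: "g l = d" using fl by (simp add: g_def)
  have gx1: "g y = l" if "f y = d" for y
    using that by (simp add: g_def)
  have gx2: "g y = f y" if "y \<in> D" "f y \<noteq> d" for y
  proof -
    have "f y \<noteq> l" using that(1) assms(2,3) by (metis permutes_in_image)
    then show ?thesis using that(2) by (simp add: g_def transpose_def)
  qed
  have stp: "f y \<in> orbit g x" if "y \<in> D" "g y \<in> orbit g x" for y
  proof (cases "f y = d")
    case True
    then have "g l \<in> orbit g x" using orbit.step[OF that(2)] gx1 by simp
    then show ?thesis using gl True by simp
  next
    case False
    then show ?thesis using gx2 that by simp
  qed
  have sub1: "y \<in> orbit g x" if "y \<in> orbit f x" for y
    using that
  proof induction
    case base
    show ?case using stp[OF assms(5) orbit.base] .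
  next
    case (step y)
    have "y \<in> D" using step.hyps orbit_sub[OF assms(2,5)] by auto
    then show ?case using stp orbit.step[OF step.IH] by blast
  qed
  have sub2: "y \<in> orbit f x \<or> (y = l \<and> d \<in> orbit f x)" if "y \<in> orbit g x" for y
    using that
  proof induction
    case base
    have "f x \<in> orbit f x" by (rule orbit.base)
    then show ?case using gx1[of x] gx2[OF assms(5)] by metis
  next
    case (step y)
    show ?case
    proof (cases "y = l")
      case True
      then show ?thesis using step gl assms(3) orbit_sub[OF assms(2,5)] by auto
    next
      case False
      then have y: "y \<in> orbit f x" using step by auto
      then have "y \<in> D" "f y \<in> orbit f x" using orbit_sub[OF assms(2,5)] by (auto intro: orbit.step)
      then show ?thesis using gx1[of y] gx2[of y] by metis
    qed
  qed
  have "l \<in> orbit g x" if "d \<in> orbit f x"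
  proof -
    have "d \<in> orbit g x" using sub1 that .
    then have "orbit g d = orbit g x" using perm_orbit_eq[OF fin gp] by simp
    moreover have "d \<in> orbit g l" using gl by (metis orbit.base)
    then have "orbit g d = orbit g l" using perm_orbit_eq[OF fin gp] by simp
    ultimately show ?thesis using perm_self_in_orbit[OF fin gp, of l] by simp
  qed
  then have "orbit g x = (if d \<in> orbit f x then insert l (orbit f x) else orbit f x)"
    using sub1 sub2 by auto
  then show ?thesis unfolding g_def .
qed

lemma transpose_insert_orbit_new:
  assumes "finite D" "f permutes D" "l \<notin> D" "d \<in> D"
  shows "orbit (transpose l d \<circ> f) l = insert l (orbit f d)"
proof -
  define g where "g = transpose l d \<circ> f"
  have gp: "g permutes insert l D"
    unfolding g_def
    using assms by (intro permutes_compose permutes_imp_permutes_insert permutes_swap_id) auto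
  have "g l = d" using assms(2,3) by (simp add: g_def permutes_not_in)
  then have "d \<in> orbit g l" by (metis orbit.base)
  then have "orbit g l = orbit g d" using perm_orbit_eq[OF _ gp] assms(1) by simp
  also have "\<dots> = insert l (orbit f d)"
    using transpose_insert_orbit[OF assms(1-4) assms(4)] g_def perm_self_in_orbit[OF assms(1,2), of d] by simp
  finally show ?thesis unfolding g_def .
qed

lemma one_orbit_transpose_insert:
  assumes "finite D" "f permutes D" "l \<notin> D" "d \<in> D"
  shows "one_orbit (transpose l d \<circ> f) (insert l D) \<longleftrightarrow> one_orbit f D"
proof
  assume L: "one_orbit (transpose l d \<circ> f) (insert l D)"
  show "one_orbit f D" unfolding one_orbit_def
  proof
    fix x assume x: "x \<in> D"
    have "orbit (transpose l d \<circ> f) x = insert l D" using L x by (auto simp: one_orbit_def)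
    then have *: "insert l D = (if d \<in> orbit f x then insert l (orbit f x) else orbit f x)"
      using transpose_insert_orbit[OF assms x] by simp
    have "l \<notin> orbit f x" using orbit_sub[OF assms(2) x] assms(3) by auto
    then show "orbit f x = D" using * assms(3) by (auto split: if_splits)
  qed
next
  assume R: "one_orbit f D"
  show "one_orbit (transpose l d \<circ> f) (insert l D)"
    unfolding one_orbit_def
  proof
    fix x assume "x \<in> insert l D"
    then show "orbit (transpose l d \<circ> f) x = insert l D"
      using transpose_insert_orbit[OF assms, of x] transpose_insert_orbit_new[OF assms] R assms(4)
      by (auto simp: one_orbit_def)
  qed
qed

text \<open>A new point can be spliced before any of the old points, which multiplies the count by
  \<open>card S\<close>.\<close>

lemma card_one_orbit:
  assumes "finite S" "S \<noteq> {}"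
  shows "card {f. f permutes S \<and> one_orbit f S} = fact (card S - 1)"
  using assms
proof (induction rule: finite_ne_induct)
  case (singleton x)
  have "{f. f permutes {x} \<and> one_orbit f {x}} = {id}"
    by (auto simp: one_orbit_def orbit_eq_singleton_iff)
  then show ?case by simp
next
  case (insert x S)
  let ?T = "{f. f permutes S \<and> one_orbit f S}"
  have "{f. f permutes insert x S \<and> one_orbit f (insert x S)} = (\<lambda>(d, f). transpose x d \<circ> f) ` (S \<times> ?T)"
    (is "?L = ?R")
  proof
    show "?R \<subseteq> ?L"
    proof
      fix g assume "g \<in> ?R"
      then obtain d f where g: "d \<in> S" "f permutes S" "one_orbit f S" "g = transpose x d \<circ> f" by auto
      have "g permutes insert x S"
        unfolding g(4) using g by (intro permutes_compose permutes_imp_permutes_insert permutes_swap_id) auto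
      then show "g \<in> ?L" using g one_orbit_transpose_insert[of S f x d] insert by auto
    qed
    show "?L \<subseteq> ?R"
    proof
      fix g assume g: "g \<in> ?L"
      then have "g \<in> {p. p permutes insert x S}" by simp
      then obtain d f where df: "d \<in> insert x S" "f permutes S" "g = transpose x d \<circ> f"
        unfolding permutes_insert by auto
      \<comment> \<open>Splicing before itself would leave \<open>x\<close> as a fixed point, hence
        a second orbit next to the nonempty \<open>S\<close>.\<close>
      have "d \<noteq> x"
      proof
        assume "d = x"
        then have "g x = x" using df insert.hyps by (simp add: permutes_not_in)
        then have "orbit g x = {x}" by (simp add: orbit_eq_singleton_iff)
        then show False using g insert.hyps by (auto simp: one_orbit_def)
      qed
      then have d: "d \<in> S" using df by auto
      then have "one_orbit f S" using one_orbit_transpose_insert[of S f x d] insert.hyps df g by auto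
      then show "g \<in> ?R" using d df by auto
    qed
  qed
  moreover have "inj_on (\<lambda>(d, f). transpose x d \<circ> f) (S \<times> ?T)"
  proof (rule inj_onI, clarsimp)
    fix d f d' f'
    assume h: "f permutes S" "f' permutes S" "transpose x d \<circ> f = transpose x d' \<circ> f'"
    have "(transpose x d \<circ> f) x = d" "(transpose x d' \<circ> f') x = d'"
      using h(1,2) insert.hyps by (simp_all add: permutes_not_in)
    then have d: "d = d'" using h(3) by metis
    then have "transpose x d \<circ> (transpose x d \<circ> f) = transpose x d \<circ> (transpose x d \<circ> f')" using h(3) by simp
    then have "f = f'" by (simp add: o_assoc)
    then show "d = d' \<and> f = f'" using d by simp
  qed
  ultimately have "card {f. f permutes insert x S \<and> one_orbit f (insert x S)} = card S * card ?T"
    by (simp add: card_image card_cartesian_product)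
  moreover have "card S > 0" using insert.hyps by (simp add: card_gt_0_iff)
  ultimately show ?case using insert by (simp add: fact_reduce)
qed

text \<open>A colour-preserving permutation is an independent choice of a permutation of each colour
  class. In \<open>sum_invar_prod\<close> this turns sums over rotations into products over
  colours.\<close>

lemma bij_betw_invar:
  assumes "finite D" "c ` D \<subseteq> V"
  shows "bij_betw (\<lambda>\<rho>. \<lambda>v\<in>V. perm_restrict \<rho> {x\<in>D. c x = v}) (invar c D)
           (\<Pi>\<^sub>E v\<in>V. {f. f permutes {x\<in>D. c x = v}})"
proof (rule bij_betw_byWitness[where f' = "\<lambda>h x. if x \<in> D then h (c x) x else x"])
  let ?r = "\<lambda>\<rho>. \<lambda>v\<in>V. perm_restrict \<rho> {x\<in>D. c x = v}"
  let ?g = "\<lambda>h x. if x \<in> D then h (c x) x else x"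
  show "\<forall>a\<in>invar c D. ?g (?r a) = a"
    using assms(2) by (auto simp: invar_def fun_eq_iff perm_restrict_def permutes_not_in)
  show "\<forall>h\<in>\<Pi>\<^sub>E v\<in>V. {f. f permutes {x\<in>D. c x = v}}. ?r (?g h) = h"
  proof
    fix h assume h: "h \<in> (\<Pi>\<^sub>E v\<in>V. {f. f permutes {x\<in>D. c x = v}})"
    show "?r (?g h) = h"
    proof (rule ext)
      fix v show "?r (?g h) v = h v"
      proof (cases "v \<in> V")
        case True
        then have "h v permutes {x\<in>D. c x = v}" using h by auto
        then show ?thesis using True by (auto simp: fun_eq_iff perm_restrict_def permutes_not_in)
      next
        case False then show ?thesis using h by (auto simp: PiE_def extensional_def)
      qed
    qed
  qed
  show "?r ` invar c D \<subseteq> (\<Pi>\<^sub>E v\<in>V. {f. f permutes {x\<in>D. c x = v}})"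
  proof (rule image_subsetI, rule restrict_PiE_iff[THEN iffD2], rule ballI, rule CollectI)
    fix \<rho> v assume r: "\<rho> \<in> invar c D" and v: "v \<in> V"
    let ?S = "{x\<in>D. c x = v}"
    have p: "\<rho> permutes D" using r by (simp add: invar_def)
    have "\<rho> ` ?S \<subseteq> ?S" using r by (auto simp: invar_def permutes_in_image)
    moreover have "inj_on \<rho> ?S" using p by (meson permutes_inj_on)
    ultimately have "bij_betw \<rho> ?S ?S"
      using assms(1) by (simp add: bij_betw_def endo_inj_surj)
    then have "bij_betw (perm_restrict \<rho> ?S) ?S ?S"
      by (rule bij_betw_cong[THEN iffD1, rotated]) (simp add: perm_restrict_def)
    then show "perm_restrict \<rho> ?S permutes ?S"
      by (intro bij_imp_permutes) (auto simp: perm_restrict_def)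
  qed
  show "?g ` (\<Pi>\<^sub>E v\<in>V. {f. f permutes {x\<in>D. c x = v}}) \<subseteq> invar c D"
  proof (rule image_subsetI)
    fix h assume h: "h \<in> (\<Pi>\<^sub>E v\<in>V. {f. f permutes {x\<in>D. c x = v}})"
    have hp: "h (c x) permutes {y\<in>D. c y = c x}" if "x \<in> D" for x
      using h that assms(2) by (auto simp: PiE_def Pi_def)
    have im: "h (c x) x \<in> D \<and> c (h (c x) x) = c x" if "x \<in> D" for x
      using hp[OF that] that permutes_in_image[OF hp[OF that], of x] by auto
    have inj: "inj_on (?g h) D"
    proof (rule inj_onI)
      fix x y assume x: "x \<in> D" and y: "y \<in> D" and e: "?g h x = ?g h y"
      have "c x = c y" using im[OF x] im[OF y] e x y by (metis (full_types))
      then show "x = y" using e x y permutes_inj[OF hp[OF x]] by (auto dest: injD)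
    qed
    have "?g h ` D \<subseteq> D" using im by auto
    then have "bij_betw (?g h) D D" using inj assms(1) endo_inj_surj unfolding bij_betw_def by blast
    then have "?g h permutes D" by (rule bij_imp_permutes) auto
    then show "?g h \<in> invar c D" using im by (auto simp: invar_def)
  qed
qed

lemma sum_invar_prod:
  fixes G :: "'b \<Rightarrow> ('a \<Rightarrow> 'a) \<Rightarrow> 'c::comm_semiring_1"
  assumes "finite D" "finite V" "c ` D \<subseteq> V"
  shows "(\<Sum>\<rho>\<in>invar c D. \<Prod>v\<in>V. G v (perm_restrict \<rho> {x\<in>D. c x = v}))
       = (\<Prod>v\<in>V. \<Sum>f\<in>{f. f permutes {x\<in>D. c x = v}}. G v f)"
proof -
  have "(\<Prod>v\<in>V. \<Sum>f\<in>{f. f permutes {x\<in>D. c x = v}}. G v f)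
     = (\<Sum>h\<in>(\<Pi>\<^sub>E v\<in>V. {f. f permutes {x\<in>D. c x = v}}). \<Prod>v\<in>V. G v (h v))"
    using assms by (intro prod_sum_PiE finite_permutations) auto
  also have "\<dots> = (\<Sum>\<rho>\<in>invar c D. \<Prod>v\<in>V. G v ((\<lambda>v\<in>V. perm_restrict \<rho> {x\<in>D. c x = v}) v))"
    by (rule sum.reindex_bij_betw[OF bij_betw_invar[OF assms(1,3)], symmetric])
  also have "\<dots> = (\<Sum>\<rho>\<in>invar c D. \<Prod>v\<in>V. G v (perm_restrict \<rho> {x\<in>D. c x = v}))"
    by (intro sum.cong prod.cong) auto
  finally show ?thesis by simp
qed

lemma orbit_perm_restrict:
  assumes "\<rho> \<in> invar c D" "x \<in> D" "c x = v"
  shows "orbit (perm_restrict \<rho> {x\<in>D. c x = v}) x = orbit \<rho> x"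
proof (rule orbit_cong0[of _ "{x\<in>D. c x = v}"])
  have "(if x \<in> D \<and> c x = v then \<rho> x else x) \<in> {x\<in>D. c x = v}" if "x \<in> {x\<in>D. c x = v}" for x
    using that assms(1) permutes_in_image[of \<rho> D x] by (auto simp: invar_def)
  then show "perm_restrict \<rho> {x\<in>D. c x = v} \<in> {x \<in> D. c x = v} \<rightarrow> {x \<in> D. c x = v}"
    unfolding perm_restrict_def by auto
qed (use assms in \<open>auto simp: perm_restrict_def\<close>)

section \<open>Trees with prescribed indegrees\<close>

inductive reach :: "('a \<Rightarrow> 'a) \<Rightarrow> 'a \<Rightarrow> 'a \<Rightarrow> bool" for f l where
  base: "reach f l l"
| step: "reach f l (f x) \<Longrightarrow> reach f l x"

text \<open>The path from \<open>x\<close> stops as soon as it meets \<open>l\<close>, so only the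
  values off \<open>l\<close> on a set closed under \<open>f\<close> matter; at \<open>l\<close>
  itself the functions of \<open>flow\<close> are undefined.\<close>

lemma reach_transfer:
  assumes "reach f l x" "x \<in> A" "\<And>x. x \<in> A \<Longrightarrow> x \<noteq> l \<Longrightarrow> f x \<in> A \<and> g x = f x"
  shows "reach g l x"
  using assms(1,2)
proof induction
  case base
  show ?case by (rule reach.base)
next
  case (step x)
  show ?case
  proof (cases "x = l")
    case True then show ?thesis by (simp add: reach.base)
  next
    case False
    then have "reach g l (g x)" using step assms(3)[of x] by auto
    then show ?thesis by (rule reach.step)
  qed
qed

text \<open>
  An element of \<open>flow P t c l\<close> chooses for every \<open>p \<noteq> l\<close> a parent of the prescribed colour \<open>t p\<close>; it is a
  tree rooted at \<open>l\<close> if all of \<open>P\<close> reaches \<open>l\<close>.  In \<open>flow_trees\<close> this is required of \<open>f \<circ> \<kappa>\<close> instead of \<open>f\<close>.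
\<close>

definition flow :: "'a set \<Rightarrow> ('a \<Rightarrow> 'b) \<Rightarrow> ('a \<Rightarrow> 'b) \<Rightarrow> 'a \<Rightarrow> ('a \<Rightarrow> 'a) set" where
  "flow P t c l = (\<Pi>\<^sub>E p\<in>P - {l}. {b\<in>P. c b = t p})"

lemma flow_mem: "f \<in> flow P t c l \<Longrightarrow> x \<in> P - {l} \<Longrightarrow> f x \<in> P \<and> c (f x) = t x"
  unfolding flow_def by (drule PiE_mem[of f _ _ x]) simp_all

lemma flow_arb: "f \<in> flow P t c l \<Longrightarrow> x \<notin> P - {l} \<Longrightarrow> f x = undefined"
  unfolding flow_def by (rule PiE_arb)

lemma flowI: "(\<And>x. x \<in> P - {l} \<Longrightarrow> f x \<in> P \<and> c (f x) = t x) \<Longrightarrow> (\<And>x. x \<notin> P - {l} \<Longrightarrow> f x = undefined)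
   \<Longrightarrow> f \<in> flow P t c l"
  unfolding flow_def by (rule PiE_I) simp_all

definition flow_trees :: "'a set \<Rightarrow> ('a \<Rightarrow> 'b) \<Rightarrow> ('a \<Rightarrow> 'b) \<Rightarrow> 'a \<Rightarrow> ('a \<Rightarrow> 'a) \<Rightarrow> ('a \<Rightarrow> 'a) set" where
  "flow_trees P t c l \<kappa> = {f \<in> flow P t c l. \<forall>p\<in>P. reach (f \<circ> \<kappa>) l p}"

definition indeg :: "'a set \<Rightarrow> 'a \<Rightarrow> ('a \<Rightarrow> 'a) \<Rightarrow> 'a \<Rightarrow> nat" where
  "indeg P l f b = card {p\<in>P - {l}. f p = b}"

lemma indeg_pos: "finite P \<Longrightarrow> p \<in> P - {l} \<Longrightarrow> f p = b \<Longrightarrow> 0 < indeg P l f b"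
  unfolding indeg_def by (subst card_gt_0_iff) auto

definition flow_trees_deg where
  "flow_trees_deg P t c l \<kappa> \<delta> = {f \<in> flow_trees P t c l \<kappa>. \<forall>b\<in>P. indeg P l f b = \<delta> b}"

lemma finite_flow: "finite P \<Longrightarrow> finite (flow P t c l)"
  unfolding flow_def by (intro finite_PiE) auto

lemma finite_flow_trees_deg: "finite P \<Longrightarrow> finite (flow_trees_deg P t c l \<kappa> \<delta>)"
  unfolding flow_trees_deg_def flow_trees_def using finite_flow[of P t c l] by simp

text \<open>An element of indegree 0 is a leaf: it is nobody's parent, and by the last hypothesis
  its own value is read by \<open>f \<circ> \<kappa>\<close> at most at \<open>p0\<close>. Deleting
  it and recording its parent \<open>b\<close>, whose remaining indegree drops by one, is one step
  of the Pruefer code.\<close>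

lemma delete_leaf:
  assumes fin: "finite P" and l: "l \<in> P" and p0: "p0 \<in> P" "p0 \<noteq> l" "\<delta> p0 = 0"
    and kap: "\<And>x. x \<in> P - {l} \<Longrightarrow> \<kappa> x \<in> P - {l}"
    and sep: "\<And>x. x \<in> P - {l} \<Longrightarrow> \<kappa> x = p0 \<Longrightarrow> x = p0"
  shows "card (flow_trees_deg P t c l \<kappa> \<delta>) =
    (\<Sum>b\<in>{b\<in>P - {p0}. c b = t p0 \<and> 0 < \<delta> b}. card (flow_trees_deg (P - {p0}) t c l \<kappa> (\<delta>(b := \<delta> b - 1))))"
proof -
  let ?B = "{b\<in>P - {p0}. c b = t p0 \<and> 0 < \<delta> b}"
  let ?Q = "P - {p0}"
  let ?T = "\<lambda>b. flow_trees_deg ?Q t c l \<kappa> (\<delta>(b := \<delta> b - 1))"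
  let ?h = "\<lambda>(b, g). g(p0 := b)"
  have deg: "indeg P l (g(p0 := b)) x = indeg ?Q l g x + (if x = b then 1 else 0)" for b g x
  proof -
    have "{p\<in>P - {l}. (g(p0 := b)) p = x} = {p\<in>?Q - {l}. g p = x} \<union> (if x = b then {p0} else {})"
      using p0 by auto
    then have "indeg P l (g(p0 := b)) x = card ({p\<in>?Q - {l}. g p = x} \<union> (if x = b then {p0} else {}))"
      unfolding indeg_def by simp
    also have "\<dots> = indeg ?Q l g x + (if x = b then 1 else 0)"
      unfolding indeg_def using fin by (subst card_Un_disjoint) auto
    finally show ?thesis .
  qed
  have agree: "reach (g(p0 := b) \<circ> \<kappa>) l p \<longleftrightarrow> reach (g \<circ> \<kappa>) l p"
    if g: "\<And>x. x \<in> ?Q - {l} \<Longrightarrow> g x \<in> ?Q" and p: "p \<in> ?Q" for b g p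
  proof -
    have "(g(p0 := b) \<circ> \<kappa>) x = (g \<circ> \<kappa>) x \<and> (g \<circ> \<kappa>) x \<in> ?Q" if "x \<in> ?Q" "x \<noteq> l" for x
      using kap[of x] sep[of x] g[of "\<kappa> x"] that by auto
    then show ?thesis using reach_transfer[OF _ p, of "g(p0 := b) \<circ> \<kappa>" l "g \<circ> \<kappa>"]
        reach_transfer[OF _ p, of "g \<circ> \<kappa>" l "g(p0 := b) \<circ> \<kappa>"] by metis
  qed
  have img: "flow_trees_deg P t c l \<kappa> \<delta> = ?h ` (SIGMA b:?B. ?T b)"
  proof
    show "flow_trees_deg P t c l \<kappa> \<delta> \<subseteq> ?h ` (SIGMA b:?B. ?T b)"
    proof
      fix f assume f: "f \<in> flow_trees_deg P t c l \<kappa> \<delta>"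
      have f1: "f \<in> flow P t c l" and fr: "\<forall>p\<in>P. reach (f \<circ> \<kappa>) l p" and fd: "\<And>b. b \<in> P \<Longrightarrow> indeg P l f b = \<delta> b"
        using f by (auto simp: flow_trees_deg_def flow_trees_def)
      define b g where "b = f p0" and "g = restrict f (?Q - {l})"
      have fg: "f = g(p0 := b)"
        using f1 p0 by (auto simp: fun_eq_iff g_def b_def flow_def PiE_def extensional_def)
      have np0: "f x \<noteq> p0" if "x \<in> P - {l}" for x
      proof
        assume "f x = p0"
        then have "indeg P l f p0 > 0" using indeg_pos[OF fin that, of f] by metis
        then show False using fd[OF p0(1)] p0(3) by simp
      qed
      have gQ: "g x \<in> ?Q" if "x \<in> ?Q - {l}" for x
        using that np0[of x] f1 by (auto simp: g_def flow_def)
      have "g \<in> flow ?Q t c l"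
        using f1 gQ by (auto simp: flow_def g_def)
      moreover have "\<forall>p\<in>?Q. reach (g \<circ> \<kappa>) l p"
        using agree[of g, OF gQ] fr unfolding fg by (metis DiffD1)
      moreover have dfg: "\<delta> x = indeg ?Q l g x + (if x = b then 1 else 0)" if "x \<in> P" for x
        using fd[OF that] deg[of g b x] unfolding fg by simp
      have bP: "b \<in> P" "c b = t p0" "b \<noteq> p0" using f1 p0 np0[of p0] by (auto simp: b_def flow_def)
      then have bB: "b \<in> ?B" using dfg[of b] by auto
      moreover have "\<forall>x\<in>?Q. indeg ?Q l g x = (\<delta>(b := \<delta> b - 1)) x"
        using dfg by auto
      ultimately have "(b, g) \<in> (SIGMA b:?B. ?T b)"
        by (auto simp: flow_trees_deg_def flow_trees_def)
      then show "f \<in> ?h ` (SIGMA b:?B. ?T b)" using fg by force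
    qed
    show "?h ` (SIGMA b:?B. ?T b) \<subseteq> flow_trees_deg P t c l \<kappa> \<delta>"
    proof (rule image_subsetI)
      fix u assume "u \<in> (SIGMA b:?B. ?T b)"
      then obtain b g where u: "u = (b, g)" and b: "b \<in> P" "b \<noteq> p0" "c b = t p0" "0 < \<delta> b" and g: "g \<in> ?T b"
        by auto
      have gf: "g \<in> flow ?Q t c l" and gr: "\<forall>p\<in>?Q. reach (g \<circ> \<kappa>) l p"
        and gd: "\<And>x. x \<in> ?Q \<Longrightarrow> indeg ?Q l g x = (\<delta>(b := \<delta> b - 1)) x"
        using g by (auto simp: flow_trees_deg_def flow_trees_def)
      have gQ: "g x \<in> ?Q" if "x \<in> ?Q - {l}" for x using gf that by (auto simp: flow_def PiE_def Pi_def)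
      let ?f = "g(p0 := b)"
      have "?f \<in> flow P t c l"
        using gf b p0 by (auto simp: flow_def PiE_def Pi_def extensional_def)
      moreover have rQ: "reach (?f \<circ> \<kappa>) l p" if "p \<in> ?Q" for p using agree[of g, OF gQ that] gr that by blast
      moreover have "reach (?f \<circ> \<kappa>) l p0"
      proof (rule reach.step)
        have "\<kappa> p0 \<in> P - {l}" using kap p0 by auto
        then have "?f (\<kappa> p0) \<in> ?Q" using b gQ[of "\<kappa> p0"] by auto
        then show "reach (?f \<circ> \<kappa>) l ((?f \<circ> \<kappa>) p0)" using rQ by simp
      qed
      moreover have "indeg P l ?f x = \<delta> x" if "x \<in> P" for x
      proof (cases "x = p0")
        case True
        have "{p\<in>?Q - {l}. g p = p0} = {}" using gQ by auto
        then have "indeg ?Q l g p0 = 0" unfolding indeg_def by (simp only: card.empty)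
        then show ?thesis using deg[of g b p0] True p0 b by simp
      next
        case False
        then show ?thesis using deg[of g b x] gd[of x] that b by auto
      qed
      ultimately show "?h u \<in> flow_trees_deg P t c l \<kappa> \<delta>"
        unfolding u by (auto simp: flow_trees_deg_def flow_trees_def)
    qed
  qed
  have inj: "inj_on ?h (SIGMA b:?B. ?T b)"
  proof (rule inj_onI)
    fix u u' assume "u \<in> (SIGMA b:?B. ?T b)" "u' \<in> (SIGMA b:?B. ?T b)" and e: "?h u = ?h u'"
    then obtain b g b' g' where u: "u = (b, g)" "u' = (b', g')" and g: "g \<in> ?T b" "g' \<in> ?T b'"
      by auto
    have e: "g(p0 := b) = g'(p0 := b')" using e u by simp
    have "g p0 = undefined" "g' p0 = undefined"
      using g by (auto simp: flow_trees_deg_def flow_trees_def intro: flow_arb)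
    moreover have "b = b'" using fun_cong[OF e, of p0] by simp
    ultimately show "u = u'" using e u by (metis fun_upd_triv fun_upd_upd)
  qed
  show ?thesis
    unfolding img card_image[OF inj] using fin by (intro card_SigmaI) (auto intro: finite_flow_trees_deg)
qed

text \<open>Precomposing \<open>f\<close> with the transposition cancels the one in front of
  \<kappa>. It moves values only between elements with the same prescribed colour, and indegrees do
  not see which element takes a value.\<close>

lemma swap_index:
  assumes fin: "finite P" and p: "p \<in> P - {l}" and q: "q \<in> P - {l}" and t: "t p = t q"
  shows "card (flow_trees_deg P t c l (transpose p q \<circ> \<kappa>) \<delta>) = card (flow_trees_deg P t c l \<kappa> \<delta>)"
proof -
  let ?s = "transpose p q"
  have sp: "?s permutes (P - {l})" using p q by (rule permutes_swap_id)
  have ts: "t (?s x) = t x" for x using t by (auto simp: transpose_def)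
  have F: "f \<circ> ?s \<in> flow P t c l" if "f \<in> flow P t c l" for f
  proof -
    have "f (?s x) \<in> P \<and> c (f (?s x)) = t x" if "x \<in> P - {l}" for x
      using flow_mem[OF \<open>f \<in> flow P t c l\<close>, of "?s x"] ts[of x] permutes_in_image[OF sp, of x] that by metis
    moreover have "f (?s x) = undefined" if "x \<notin> P - {l}" for x
      using flow_arb[OF \<open>f \<in> flow P t c l\<close> that] permutes_not_in[OF sp that] by metis
    ultimately show ?thesis by (intro flowI) (simp_all only: comp_apply)
  qed
  have deg: "indeg P l (f \<circ> ?s) b = indeg P l f b" for f b
  proof -
    have "{x\<in>P - {l}. (f \<circ> ?s) x = b} = ?s ` {x\<in>P - {l}. f x = b}"
    proof
      show "{x\<in>P - {l}. (f \<circ> ?s) x = b} \<subseteq> ?s ` {x\<in>P - {l}. f x = b}"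
      proof
        fix x assume "x \<in> {x\<in>P - {l}. (f \<circ> ?s) x = b}"
        then have "?s x \<in> {x\<in>P - {l}. f x = b}" using permutes_in_image[OF sp, of x] by simp
        then have "?s (?s x) \<in> ?s ` {x\<in>P - {l}. f x = b}" by (rule imageI)
        then show "x \<in> ?s ` {x\<in>P - {l}. f x = b}" by simp
      qed
      show "?s ` {x\<in>P - {l}. f x = b} \<subseteq> {x\<in>P - {l}. (f \<circ> ?s) x = b}"
      proof
        fix y assume "y \<in> ?s ` {x\<in>P - {l}. f x = b}"
        then obtain x where "x \<in> P - {l}" "f x = b" "y = ?s x" by blast
        moreover from this have "y \<in> P - {l}" using permutes_in_image[OF sp, of x] by metis
        moreover have "?s (?s x) = x" by simp
        ultimately show "y \<in> {x\<in>P - {l}. (f \<circ> ?s) x = b}" by (simp del: transpose_apply_commute)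
      qed
    qed
    then have "indeg P l (f \<circ> ?s) b = card (?s ` {x\<in>P - {l}. f x = b})" unfolding indeg_def by (simp only:)
    also have "\<dots> = indeg P l f b" unfolding indeg_def
      by (rule card_image) (metis inj_on_subset inj_transpose subset_UNIV)
    finally show ?thesis .
  qed
  have ss: "?s \<circ> ?s = id" by (simp add: fun_eq_iff)
  have cc: "(f \<circ> ?s) \<circ> (?s \<circ> \<kappa>) = f \<circ> \<kappa>" "(f \<circ> ?s) \<circ> ?s = f" for f by (simp_all add: fun_eq_iff)
  have "bij_betw (\<lambda>f. f \<circ> ?s) (flow_trees_deg P t c l \<kappa> \<delta>) (flow_trees_deg P t c l (?s \<circ> \<kappa>) \<delta>)"
  proof (rule bij_betw_byWitness[where f' = "\<lambda>f. f \<circ> ?s"])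
    show "(\<lambda>f. f \<circ> ?s) ` flow_trees_deg P t c l \<kappa> \<delta> \<subseteq> flow_trees_deg P t c l (?s \<circ> \<kappa>) \<delta>"
      unfolding flow_trees_deg_def flow_trees_def using F deg by (auto simp only: cc mem_Collect_eq)
    have "f \<circ> ?s \<in> flow_trees_deg P t c l \<kappa> \<delta>" if f: "f \<in> flow_trees_deg P t c l (?s \<circ> \<kappa>) \<delta>" for f
    proof -
      have "f \<circ> ?s \<circ> \<kappa> = f \<circ> (?s \<circ> \<kappa>)" by (simp add: o_assoc)
      then show ?thesis using f F deg unfolding flow_trees_deg_def flow_trees_def by (auto simp only: mem_Collect_eq)
    qed
    then show "(\<lambda>f. f \<circ> ?s) ` flow_trees_deg P t c l (?s \<circ> \<kappa>) \<delta> \<subseteq> flow_trees_deg P t c l \<kappa> \<delta>" by blast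
  qed (simp_all add: cc)
  then show ?thesis by (metis bij_betw_same_card)
qed

text \<open>
  This contains the Pruefer code and the BEST theorem.  If \<open>\<kappa>\<close> is constant on the fibres of \<open>t\<close>, then
  \<open>f \<circ> \<kappa>\<close> depends only on one value of \<open>f\<close> per colour (the last letters of the code, or the last
  exits of the tour), so that the remaining values of \<open>f\<close> are free.  The proof removes an element of
  indegree 0, after making it avoid the range of \<open>\<kappa>\<close> by the symmetry \<open>swap_index\<close>.
\<close>

theorem card_flow_trees_deg:
  assumes "finite P" "l \<in> P"
    and "\<And>x. x \<in> P - {l} \<Longrightarrow> \<kappa> x \<in> P - {l} \<and> t (\<kappa> x) = t x"
  shows "card (flow_trees_deg P t c l \<kappa> \<delta>) = card (flow_trees_deg P t c l id \<delta>)"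
  using assms
proof (induction "card P" arbitrary: P \<kappa> \<delta> rule: less_induct)
  case less
  note fin = less.prems(1) and l = less.prems(2)
  note kap = less.prems(3)
  show ?case
  proof (cases "P = {l}")
    case True
    then have "\<forall>p\<in>P. reach g l p" for g using reach.base[of g l] by simp
    then have "flow_trees P t c l k = flow P t c l" for k by (simp add: flow_trees_def)
    then show ?thesis by (simp add: flow_trees_deg_def)
  next
    case False
    show ?thesis
    proof (cases "\<exists>p0\<in>P - {l}. \<delta> p0 = 0")
      case False
      \<comment> \<open>Without a leaf off \<open>l\<close>, every element off \<open>l\<close> has
        indegree at least 1. The \<open>card P - 1\<close> values are then used up, \<open>l\<close>
        is nobody's parent, and nothing else can reach it.\<close>
      have "flow_trees_deg P t c l \<kappa>' \<delta> = {}" if kap': "\<And>x. x \<in> P - {l} \<Longrightarrow> \<kappa>' x \<in> P - {l}" for \<kappa>'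
      proof (rule ccontr)
        assume "flow_trees_deg P t c l \<kappa>' \<delta> \<noteq> {}"
        then obtain f where f: "f \<in> flow P t c l" "\<forall>p\<in>P. reach (f \<circ> \<kappa>') l p" "\<And>b. b \<in> P \<Longrightarrow> indeg P l f b = \<delta> b"
          by (auto simp: flow_trees_deg_def flow_trees_def)
        have "(\<Sum>b\<in>P. indeg P l f b) = card (P - {l})"
        proof -
          have "(\<Sum>b\<in>P. indeg P l f b) = card (\<Union>b\<in>P. {p\<in>P - {l}. f p = b})"
            unfolding indeg_def using fin by (subst card_UN_disjoint) auto
          also have "(\<Union>b\<in>P. {p\<in>P - {l}. f p = b}) = P - {l}" using flow_mem[OF f(1)] by blast
          finally show ?thesis .
        qed
        moreover have "(\<Sum>b\<in>P. indeg P l f b) = indeg P l f l + (\<Sum>b\<in>P - {l}. indeg P l f b)"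
          using fin l by (simp add: sum.remove)
        moreover have "(\<Sum>b\<in>P - {l}. indeg P l f b) \<ge> (\<Sum>b\<in>P - {l}. 1)"
          using False f(3) by (intro sum_mono) (auto simp: Suc_le_eq)
        ultimately have z: "indeg P l f l = 0" by simp
        obtain p where p: "p \<in> P" "p \<noteq> l" using \<open>P \<noteq> {l}\<close> l by auto
        have "x = l" if "reach (f \<circ> \<kappa>') l x" "x \<in> P" for x
          using that
        proof induction
          case (step x)
          show ?case
          proof (rule ccontr)
            assume x: "x \<noteq> l"
            have k: "\<kappa>' x \<in> P - {l}" using kap' x step.prems by auto
            then have "f (\<kappa>' x) \<in> P" using flow_mem[OF f(1)] by blast
            then have "f (\<kappa>' x) = l" using step.IH by simp
            then show False using z indeg_pos[OF fin k, of f l] by simp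
          qed
        qed simp
        then show False using f(2) p by auto
      qed
      then show ?thesis using kap by simp
    next
      case True
      then obtain p0 where p0: "p0 \<in> P" "p0 \<noteq> l" "\<delta> p0 = 0" by auto
      \<comment> \<open>Pigeonhole: \<kappa> preserves the fibre \<open>Fb\<close> of
        \<open>p0\<close>, and without \<open>p0\<close> the fibre is too small to cover itself. A
        missed element \<open>q\<close> is hit by \<kappa> at most from \<open>p0\<close>;
        exchanging \<open>q\<close> and \<open>p0\<close> gives the separation required by
        \<open>delete_leaf\<close>.\<close>
      define Fb where "Fb = {x\<in>P - {l}. t x = t p0}"
      have Fb: "finite Fb" "p0 \<in> Fb" using fin p0 by (auto simp: Fb_def)
      have "card (\<kappa> ` (Fb - {p0})) \<le> card (Fb - {p0})" using Fb by (intro card_image_le) auto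
      also have "\<dots> < card Fb" using Fb by (intro card_Diff1_less) auto
      finally have "\<not> Fb \<subseteq> \<kappa> ` (Fb - {p0})" using Fb by (meson card_mono finite_Diff finite_imageI not_le)
      then obtain q where q: "q \<in> Fb" "q \<notin> \<kappa> ` (Fb - {p0})" by auto
      have qx: "x = p0" if "x \<in> P - {l}" "\<kappa> x = q" for x
        using that q kap[of x] by (auto simp: Fb_def)
      let ?k = "transpose p0 q \<circ> \<kappa>"
      have sp: "transpose p0 q permutes (P - {l})" using p0 q by (intro permutes_swap_id) (auto simp: Fb_def)
      have k1: "?k x \<in> P - {l} \<and> t (?k x) = t x" if "x \<in> P - {l}" for x
        using that kap[OF that] permutes_in_image[OF sp, of "\<kappa> x"] q by (auto simp: transpose_def Fb_def)
      have k2: "x = p0" if "x \<in> P - {l}" "?k x = p0" for x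
      proof -
        have "\<kappa> x = q" using that(2) by (auto simp: transpose_def split: if_splits)
        then show ?thesis using qx that(1) by simp
      qed
      have IH: "card (flow_trees_deg (P - {p0}) t c l ?k \<delta>') = card (flow_trees_deg (P - {p0}) t c l id \<delta>')" for \<delta>'
      proof (rule less.hyps)
        show "card (P - {p0}) < card P" using fin p0 by (intro card_Diff1_less)
        show "?k x \<in> P - {p0} - {l} \<and> t (?k x) = t x" if "x \<in> P - {p0} - {l}" for x
          using k1[of x] k2[of x] that by auto
      qed (use fin l p0 in auto)
      have "card (flow_trees_deg P t c l \<kappa> \<delta>) = card (flow_trees_deg P t c l ?k \<delta>)"
        using swap_index[OF fin, of p0 l q t c \<kappa> \<delta>] p0 q by (auto simp: Fb_def)
      also have "\<dots> = (\<Sum>b\<in>{b\<in>P - {p0}. c b = t p0 \<and> 0 < \<delta> b}. card (flow_trees_deg (P - {p0}) t c l ?k (\<delta>(b := \<delta> b - 1))))"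
        by (rule delete_leaf[where \<delta> = \<delta>, OF fin l p0]) (use k1 k2 in blast)+
      also have "\<dots> = (\<Sum>b\<in>{b\<in>P - {p0}. c b = t p0 \<and> 0 < \<delta> b}. card (flow_trees_deg (P - {p0}) t c l id (\<delta>(b := \<delta> b - 1))))"
        by (intro sum.cong refl IH)
      also have "\<dots> = card (flow_trees_deg P t c l id \<delta>)"
        by (rule delete_leaf[where \<delta> = \<delta>, OF fin l p0, symmetric]) simp_all
      finally show ?thesis .
    qed
  qed
qed

text \<open>Any weight that depends on the indegrees alone may be summed with a convenient \<kappa>.
  The indegree function is restricted to \<open>P\<close> because \<delta> prescribes it only
  there.\<close>

corollary sum_flow_trees:
  fixes \<Psi> :: "('a \<Rightarrow> nat) \<Rightarrow> int"
  assumes "finite P" "l \<in> P"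
    and "\<And>x. x \<in> P - {l} \<Longrightarrow> \<kappa> x \<in> P - {l} \<and> t (\<kappa> x) = t x"
  shows "(\<Sum>f\<in>flow_trees P t c l \<kappa>. \<Psi> (restrict (indeg P l f) P)) = (\<Sum>f\<in>flow_trees P t c l id. \<Psi> (restrict (indeg P l f) P))"
proof -
  let ?h = "\<lambda>f. restrict (indeg P l f) P"
  let ?Y = "?h ` flow P t c l"
  have fin: "finite (flow P t c l)" using assms by (simp add: finite_flow)
  have sub: "flow_trees P t c l \<kappa>' \<subseteq> flow P t c l" for \<kappa>' by (auto simp: flow_trees_def)
  have *: "(\<Sum>f\<in>flow_trees P t c l \<kappa>'. \<Psi> (?h f)) = (\<Sum>\<delta>\<in>?Y. int (card (flow_trees_deg P t c l \<kappa>' \<delta>)) * \<Psi> \<delta>)" for \<kappa>'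
  proof -
    have "(\<Sum>f\<in>flow_trees P t c l \<kappa>'. \<Psi> (?h f)) = (\<Sum>\<delta>\<in>?Y. \<Sum>f\<in>{f\<in>flow_trees P t c l \<kappa>'. ?h f = \<delta>}. \<Psi> (?h f))"
      using fin sub[of \<kappa>'] by (intro sum.group[symmetric]) (auto intro: finite_subset)
    also have "\<dots> = (\<Sum>\<delta>\<in>?Y. \<Sum>f\<in>flow_trees_deg P t c l \<kappa>' \<delta>. \<Psi> \<delta>)"
    proof (rule sum.cong[OF refl])
      fix \<delta> assume "\<delta> \<in> ?Y"
      then have "\<delta> \<in> extensional P" by auto
      then have "{f\<in>flow_trees P t c l \<kappa>'. ?h f = \<delta>} = flow_trees_deg P t c l \<kappa>' \<delta>"
        unfolding flow_trees_deg_def by (auto simp: fun_eq_iff restrict_def extensional_def)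
      moreover have "(\<Sum>f\<in>{f\<in>flow_trees P t c l \<kappa>'. ?h f = \<delta>}. \<Psi> (?h f)) = (\<Sum>f\<in>{f\<in>flow_trees P t c l \<kappa>'. ?h f = \<delta>}. \<Psi> \<delta>)"
        by simp
      ultimately show "(\<Sum>f\<in>{f\<in>flow_trees P t c l \<kappa>'. ?h f = \<delta>}. \<Psi> (?h f)) = (\<Sum>f\<in>flow_trees_deg P t c l \<kappa>' \<delta>. \<Psi> \<delta>)"
        by simp
    qed
    also have "\<dots> = (\<Sum>\<delta>\<in>?Y. int (card (flow_trees_deg P t c l \<kappa>' \<delta>)) * \<Psi> \<delta>)" by simp
    finally show ?thesis .
  qed
  show ?thesis unfolding * using card_flow_trees_deg[OF assms] by simp
qed

section \<open>Weighted sums over trees\<close>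

text \<open>
  Falling factorials (\<open>e = -1\<close>) or rising factorials (\<open>e = 1\<close>).  As \<open>rp e 1 k\<close> is the indicator of
  \<open>k \<le> 1\<close> or \<open>k!\<close>, the same computation serves for Eulerian tours and for plane trees.
\<close>

definition rp :: "int \<Rightarrow> int \<Rightarrow> nat \<Rightarrow> int" where
  "rp e a k = (\<Prod>i<k. a + e * int i)"

lemma rp_0 [simp]: "rp e a 0 = 1" by (simp add: rp_def)

lemma rp_Suc: "rp e a (Suc k) = rp e a k * (a + e * int k)" by (simp add: rp_def)

lemma rp_Suc_shift: "rp e a (Suc k) = a * rp e (a + e) k"
  unfolding rp_def prod.lessThan_Suc_shift by (simp add: algebra_simps)

lemma rp_rising: "fact m * rp 1 (int m + 1) k = fact (m + k)"
proof (induction k)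
  case (Suc k)
  have "fact m * rp 1 (int m + 1) (Suc k) = (fact m * rp 1 (int m + 1) k) * (int m + 1 + int k)"
    by (simp add: rp_Suc)
  also have "\<dots> = fact (m + Suc k)" unfolding Suc by (simp add: algebra_simps)
  finally show ?case .
qed simp

lemma rp_rising_1: "rp 1 1 k = fact k"
  using rp_rising[of 0 k] by simp

lemma rp_falling: "k \<le> m \<Longrightarrow> rp (-1) (int m) k * fact (m - k) = fact m"
proof (induction k)
  case (Suc k)
  then have "fact (m - k) = (of_nat (m - k) :: int) * fact (m - Suc k)"
    by (metis Suc_diff_Suc Suc_le_lessD fact_Suc)
  then have "rp (-1) (int m) (Suc k) * fact (m - Suc k) = rp (-1) (int m) k * fact (m - k)"
    using Suc.prems by (simp add: rp_Suc of_nat_diff)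
  then show ?case using Suc by simp
qed simp

lemma rp_falling_1: "rp (-1) 1 k = (if k \<le> 1 then 1 else 0)"
proof (cases k)
  case (Suc j)
  then have "rp (-1) 1 k = rp (-1) 0 j" by (simp add: rp_Suc_shift)
  moreover have "rp (-1) 0 j = (if j = 0 then 1 else 0)" by (cases j) (simp_all add: rp_Suc_shift)
  ultimately show ?thesis using Suc by simp
qed simp

lemma sum_PiE_insert:
  fixes F :: "('a \<Rightarrow> 'b) \<Rightarrow> 'c::comm_monoid_add"
  assumes "x \<notin> T"
  shows "(\<Sum>f\<in>Pi\<^sub>E (insert x T) B. F f) = (\<Sum>g\<in>Pi\<^sub>E T B. \<Sum>b\<in>B x. F (g(x := b)))"
proof -
  have "(\<Sum>f\<in>Pi\<^sub>E (insert x T) B. F f) = (\<Sum>(b, g)\<in>B x \<times> Pi\<^sub>E T B. F (g(x := b)))"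
    unfolding PiE_insert_eq
    by (subst sum.reindex) (use inj_combinator[OF assms, of B] in \<open>auto simp: case_prod_beta intro!: sum.cong\<close>)
  also have "\<dots> = (\<Sum>b\<in>B x. \<Sum>g\<in>Pi\<^sub>E T B. F (g(x := b)))" by (simp add: sum.cartesian_product)
  also have "\<dots> = (\<Sum>g\<in>Pi\<^sub>E T B. \<Sum>b\<in>B x. F (g(x := b)))" by (rule sum.swap)
  finally show ?thesis .
qed

text \<open>Polya's urn: when the values of \<open>f\<close> are chosen one at a time, a value
  \<open>b\<close> comes with weight \<open>a b\<close> plus \<open>e\<close> times the number of
  its earlier uses. The total weight of a colour class then depends only on how many values of that
  colour were drawn, not on which ones, so the sum factorises.\<close>

lemma sum_polya:
  assumes "finite T" "finite P" "finite V" "t ` T \<subseteq> V"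
  shows "(\<Sum>f\<in>(\<Pi>\<^sub>E p\<in>T. {b\<in>P. c b = t p}). \<Prod>b\<in>P. rp e (a b) (card {p\<in>T. f p = b}))
       = (\<Prod>v\<in>V. rp e (\<Sum>b\<in>{b\<in>P. c b = v}. a b) (card {p\<in>T. t p = v}))"
  using assms(1,4)
proof (induction T rule: finite_induct)
  case empty
  then show ?case by simp
next
  case (insert x T)
  let ?B = "\<lambda>p. {b\<in>P. c b = t p}"
  let ?W = "\<lambda>f. \<Prod>b\<in>P. rp e (a b) (card {p\<in>T. f p = b})"
  have tx: "t x \<in> V" using insert.prems by simp
  have cnt: "card {p\<in>insert x T. (f(x := b)) p = b'} = card {p\<in>T. f p = b'} + (if b' = b then 1 else 0)" for f b b'
  proof -
    have "{p\<in>insert x T. (f(x := b)) p = b'} = {p\<in>T. f p = b'} \<union> (if b' = b then {x} else {})"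
      using insert.hyps by auto
    then have "card {p\<in>insert x T. (f(x := b)) p = b'} = card ({p\<in>T. f p = b'} \<union> (if b' = b then {x} else {}))"
      by (simp only:)
    also have "\<dots> = card {p\<in>T. f p = b'} + (if b' = b then 1 else 0)"
      using insert.hyps by (subst card_Un_disjoint) auto
    finally show ?thesis .
  qed
  have step: "(\<Prod>b'\<in>P. rp e (a b') (card {p\<in>insert x T. (f(x := b)) p = b'})) = ?W f * (a b + e * int (card {p\<in>T. f p = b}))"
    if "b \<in> P" for f b
  proof -
    have "(\<Prod>b'\<in>P. rp e (a b') (card {p\<in>insert x T. (f(x := b)) p = b'}))
       = (\<Prod>b'\<in>P. rp e (a b') (card {p\<in>T. f p = b'}) * (if b' = b then a b + e * int (card {p\<in>T. f p = b}) else 1))"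
      unfolding cnt by (intro prod.cong) (auto simp: rp_Suc)
    also have "\<dots> = ?W f * (a b + e * int (card {p\<in>T. f p = b}))"
      using assms(2) that by (simp add: prod.distrib)
    finally show ?thesis .
  qed
  \<comment> \<open>Each earlier choice with target colour \<open>t x\<close> fell on exactly one
    \<open>b\<close> of the class, so the counts add up to the number of these choices.\<close>
  have inner: "(\<Sum>b\<in>?B x. a b + e * int (card {p\<in>T. f p = b})) = (\<Sum>b\<in>?B x. a b) + e * int (card {p\<in>T. t p = t x})"
    if f: "f \<in> (\<Pi>\<^sub>E p\<in>T. ?B p)" for f
  proof -
    have fm: "f p \<in> P \<and> c (f p) = t p" if "p \<in> T" for p using PiE_mem[OF f that] by simp
    have "(\<Sum>b\<in>?B x. card {p\<in>T. f p = b}) = card (\<Union>b\<in>?B x. {p\<in>T. f p = b})"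
      using insert.hyps assms(2) by (subst card_UN_disjoint) auto
    also have "(\<Union>b\<in>?B x. {p\<in>T. f p = b}) = {p\<in>T. t p = t x}" using fm by auto
    finally have "(\<Sum>b\<in>?B x. int (card {p\<in>T. f p = b})) = int (card {p\<in>T. t p = t x})"
      by (simp flip: of_nat_sum)
    then show ?thesis by (simp add: sum.distrib flip: sum_distrib_left)
  qed
  have "(\<Sum>f\<in>Pi\<^sub>E (insert x T) ?B. \<Prod>b\<in>P. rp e (a b) (card {p\<in>insert x T. f p = b}))
      = (\<Sum>f\<in>Pi\<^sub>E T ?B. \<Sum>b\<in>?B x. ?W f * (a b + e * int (card {p\<in>T. f p = b})))"
    by (subst sum_PiE_insert[OF insert.hyps(2)]) (intro sum.cong refl, use step in simp)
  also have "\<dots> = (\<Sum>f\<in>Pi\<^sub>E T ?B. ?W f * ((\<Sum>b\<in>?B x. a b) + e * int (card {p\<in>T. t p = t x})))"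
    by (intro sum.cong refl) (simp only: sum_distrib_left[symmetric] inner)
  also have "\<dots> = (\<Prod>v\<in>V. rp e (\<Sum>b\<in>{b\<in>P. c b = v}. a b) (card {p\<in>T. t p = v})) * ((\<Sum>b\<in>?B x. a b) + e * int (card {p\<in>T. t p = t x}))"
    using insert by (simp flip: sum_distrib_right)
  also have "\<dots> = (\<Prod>v\<in>V. rp e (\<Sum>b\<in>{b\<in>P. c b = v}. a b) (card {p\<in>T. t p = v}) * (if v = t x then (\<Sum>b\<in>?B x. a b) + e * int (card {p\<in>T. t p = t x}) else 1))"
    using assms(3) tx by (simp add: prod.distrib)
  also have "\<dots> = (\<Prod>v\<in>V. rp e (\<Sum>b\<in>{b\<in>P. c b = v}. a b) (card {p\<in>insert x T. t p = v}))"
  proof (rule prod.cong[OF refl])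
    fix v
    have "{p\<in>insert x T. t p = v} = {p\<in>T. t p = v} \<union> (if v = t x then {x} else {})" by auto
    then have "card {p\<in>insert x T. t p = v} = card ({p\<in>T. t p = v} \<union> (if v = t x then {x} else {}))" by (simp only:)
    also have "\<dots> = card {p\<in>T. t p = v} + (if v = t x then 1 else 0)"
      using insert.hyps by (subst card_Un_disjoint) auto
    finally show "rp e (\<Sum>b\<in>{b\<in>P. c b = v}. a b) (card {p\<in>T. t p = v}) * (if v = t x then (\<Sum>b\<in>?B x. a b) + e * int (card {p\<in>T. t p = t x}) else 1)
       = rp e (\<Sum>b\<in>{b\<in>P. c b = v}. a b) (card {p\<in>insert x T. t p = v})"
      by (auto simp: rp_Suc)
  qed
  finally show ?case .
qed

text \<open>A section chooses one element of each target colour, leading from the colour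
  \<open>v\<close> on to the colour \<open>t (s v)\<close>. Reaching \<open>l\<close> makes these
  choices a spanning tree of the contracted graph, directed towards \<open>l\<close>.\<close>

definition sections :: "'a set \<Rightarrow> ('a \<Rightarrow> 'b) \<Rightarrow> ('a \<Rightarrow> 'b) \<Rightarrow> 'a \<Rightarrow> ('b \<Rightarrow> 'a) set" where
  "sections P t c l = {s \<in> (\<Pi>\<^sub>E v\<in>t ` (P - {l}). {b\<in>P. c b = v}). \<forall>p\<in>P. reach (s \<circ> t) l p}"

lemma section_image:
  assumes "\<And>v. v \<in> W \<Longrightarrow> c (s v) = v" "v \<in> W" "c b = v"
  shows "b \<in> s ` W \<longleftrightarrow> b = s v"
  using assms by auto

text \<open>If \<kappa> sends every element with target colour \<open>v\<close> to one
  representative \<open>lam v\<close>, the tree condition only involves the values of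
  \<open>f\<close> at the representatives, that is, a section. The other values are free and are
  summed by \<open>sum_polya\<close>.\<close>

lemma sum_flow_trees_rp:
  fixes P :: "'a set" and t :: "'a \<Rightarrow> 'b"
  assumes fin: "finite P" and l: "l \<in> P"
  shows "(\<Sum>f\<in>flow_trees P t c l id. \<Prod>b\<in>P. rp e 1 (indeg P l f b))
    = (\<Sum>s\<in>sections P t c l. \<Prod>v\<in>t ` (P - {l}). rp e (int (card {b\<in>P. c b = v}) + e) (card {p\<in>P - {l}. t p = v} - 1))"
proof -
  let ?D = "P - {l}"
  let ?V = "t ` ?D"
  define lam where "lam v = (SOME p. p \<in> ?D \<and> t p = v)" for v
  have lam: "lam v \<in> ?D \<and> t (lam v) = v" if "v \<in> ?V" for v
    unfolding lam_def using that by (intro someI_ex[of "\<lambda>p. p \<in> ?D \<and> t p = v"]) auto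
  have lamt: "lam (t p) \<in> ?D \<and> t (lam (t p)) = t p" if "p \<in> ?D" for p using lam that by blast
  define T where "T = ?D - lam ` ?V"
  have finT: "finite T" "finite ?V" using fin by (simp_all add: T_def)
  let ?X = "\<lambda>p. {b\<in>P. c b = t p}"
  define mk :: "('b \<Rightarrow> 'a) \<times> ('a \<Rightarrow> 'a) \<Rightarrow> 'a \<Rightarrow> 'a" where "mk = (\<lambda>(s, g). \<lambda>p\<in>?D. if p \<in> lam ` ?V then s (t p) else g p)"
  have T_D: "T \<subseteq> ?D" by (auto simp: T_def)
  let ?S = "sections P t c l"
  have lamT: "lam v \<notin> T" if "v \<in> ?V" for v using that by (auto simp: T_def)
  have mklam: "mk (s, g) (lam v) = s v" if "v \<in> ?V" for s g v
    using lam[OF that] that by (auto simp: mk_def)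
  have mkT: "mk (s, g) p = g p" if "p \<in> T" for s g p
    using that T_D by (auto simp: mk_def T_def)
  have cases_D: "p \<in> T \<or> (\<exists>v\<in>?V. p = lam v)" if "p \<in> ?D" for p using that by (auto simp: T_def)
  have tr: "reach ((f \<circ> (lam \<circ> t))) l p \<longleftrightarrow> reach (s \<circ> t) l p"
    if fs: "\<And>v. v \<in> ?V \<Longrightarrow> f (lam v) = s v" and s: "\<And>v. v \<in> ?V \<Longrightarrow> s v \<in> P" and p: "p \<in> P" for f s p
  proof -
    have "(s \<circ> t) x \<in> P \<and> (f \<circ> (lam \<circ> t)) x = (s \<circ> t) x" if "x \<in> P" "x \<noteq> l" for x
    proof -
      have "t x \<in> ?V" using that by blast
      then show ?thesis using fs s by simp
    qed
    then show ?thesis using reach_transfer[OF _ p, of "f \<circ> (lam \<circ> t)" l "s \<circ> t"]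
       reach_transfer[OF _ p, of "s \<circ> t" l "f \<circ> (lam \<circ> t)"] by metis
  qed
  have bij: "bij_betw mk (?S \<times> (\<Pi>\<^sub>E p\<in>T. ?X p)) (flow_trees P t c l (lam \<circ> t))"
  proof (rule bij_betw_byWitness[where f' = "\<lambda>f. (\<lambda>v\<in>?V. f (lam v), restrict f T)"])
    show "\<forall>a\<in>?S \<times> (\<Pi>\<^sub>E p\<in>T. ?X p). (\<lambda>v\<in>?V. mk a (lam v), restrict (mk a) T) = a"
    proof clarify
      fix s g assume s: "s \<in> ?S" and g: "g \<in> (\<Pi>\<^sub>E p\<in>T. ?X p)"
      have sE: "s \<in> (\<Pi>\<^sub>E v\<in>?V. {b\<in>P. c b = v})" using s by (simp add: sections_def)
      have "(\<lambda>v\<in>?V. mk (s, g) (lam v)) v = s v" for v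
        using mklam[of v s g] PiE_arb[OF sE, of v] by (cases "v \<in> ?V") auto
      moreover have "restrict (mk (s, g)) T p = g p" for p
        using mkT[of p s g] PiE_arb[OF g, of p] by (cases "p \<in> T") auto
      ultimately show "(\<lambda>v\<in>?V. mk (s, g) (lam v)) = s \<and> restrict (mk (s, g)) T = g" by blast
    qed
    show "\<forall>f\<in>flow_trees P t c l (lam \<circ> t). mk (\<lambda>v\<in>?V. f (lam v), restrict f T) = f"
    proof (rule ballI, rule ext)
      fix f p assume f: "f \<in> flow_trees P t c l (lam \<circ> t)"
      show "mk (\<lambda>v\<in>?V. f (lam v), restrict f T) p = f p"
      proof (cases "p \<in> ?D")
        case False
        then show ?thesis using f flow_arb[of f P t c l p] by (auto simp: mk_def flow_trees_def)
      next
        case True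
        then consider "p \<in> T" | v where "v \<in> ?V" "p = lam v" using cases_D by blast
        then show ?thesis
        proof cases
          case 1 then show ?thesis by (simp add: mkT)
        next
          case 2
          then show ?thesis using mklam[OF 2(1), of "\<lambda>v\<in>?V. f (lam v)" "restrict f T"] by simp
        qed
      qed
    qed
    show "mk ` (?S \<times> (\<Pi>\<^sub>E p\<in>T. ?X p)) \<subseteq> flow_trees P t c l (lam \<circ> t)"
    proof (rule image_subsetI)
      fix u assume "u \<in> ?S \<times> (\<Pi>\<^sub>E p\<in>T. ?X p)"
      then obtain s g where u: "u = (s, g)" and s: "s \<in> ?S" and g: "g \<in> (\<Pi>\<^sub>E p\<in>T. ?X p)" by auto
      have sE: "s \<in> (\<Pi>\<^sub>E v\<in>?V. {b\<in>P. c b = v})" and sr: "\<And>p. p \<in> P \<Longrightarrow> reach (s \<circ> t) l p"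
        using s by (simp_all add: sections_def)
      have sm: "s v \<in> P \<and> c (s v) = v" if "v \<in> ?V" for v using PiE_mem[OF sE that] by simp
      have "mk (s, g) \<in> flow P t c l"
      proof (rule flowI)
        fix p assume p: "p \<in> ?D"
        then consider "p \<in> T" | v where "v \<in> ?V" "p = lam v" using cases_D by blast
        then show "mk (s, g) p \<in> P \<and> c (mk (s, g) p) = t p"
        proof cases
          case 1 then show ?thesis using PiE_mem[OF g 1] by (simp add: mkT)
        next
          case 2
          then show ?thesis using mklam[OF 2(1)] sm[OF 2(1)] lam[OF 2(1)] by simp
        qed
      next
        fix p assume "p \<notin> ?D" then show "mk (s, g) p = undefined" by (auto simp: mk_def)
      qed
      moreover have "reach (mk (s, g) \<circ> (lam \<circ> t)) l p" if "p \<in> P" for p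
        using tr[of "mk (s, g)" s p] mklam sm sr that by metis
      ultimately show "mk u \<in> flow_trees P t c l (lam \<circ> t)" unfolding u flow_trees_def by simp
    qed
    show "(\<lambda>f. (\<lambda>v\<in>?V. f (lam v), restrict f T)) ` flow_trees P t c l (lam \<circ> t) \<subseteq> ?S \<times> (\<Pi>\<^sub>E p\<in>T. ?X p)"
    proof (rule image_subsetI)
      fix f assume f: "f \<in> flow_trees P t c l (lam \<circ> t)"
      let ?s = "\<lambda>v\<in>?V. f (lam v)"
      have fm: "f p \<in> P \<and> c (f p) = t p" if "p \<in> ?D" for p
        using f flow_mem[of f P t c l p] that by (simp add: flow_trees_def)
      have sm: "?s v \<in> P \<and> c (?s v) = v" if "v \<in> ?V" for v using fm[of "lam v"] lam[OF that] that by simp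
      then have "?s \<in> (\<Pi>\<^sub>E v\<in>?V. {b\<in>P. c b = v})" by (intro PiE_I) auto
      moreover have "reach (?s \<circ> t) l p" if "p \<in> P" for p
        using tr[of f ?s p] sm that f by (simp add: flow_trees_def)
      moreover have "restrict f T \<in> (\<Pi>\<^sub>E p\<in>T. ?X p)" using fm T_D by auto
      ultimately show "(?s, restrict f T) \<in> ?S \<times> (\<Pi>\<^sub>E p\<in>T. ?X p)" by (simp add: sections_def)
    qed
  qed
  \<comment> \<open>The section accounts for one use of each \<open>b\<close> in its range.
    Splitting off the first factor, which is 1, moves the start weight from 1 to
    \<open>1 + e\<close>.\<close>
  have weight: "(\<Prod>b\<in>P. rp e 1 (indeg P l (mk (s, g)) b))
      = (\<Prod>b\<in>P. rp e (if b \<in> s ` ?V then 1 + e else 1) (card {p\<in>T. g p = b}))"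
    if s: "s \<in> ?S" for s g
  proof (rule prod.cong[OF refl])
    fix b assume b: "b \<in> P"
    have sE: "s \<in> (\<Pi>\<^sub>E v\<in>?V. {b\<in>P. c b = v})" using s by (simp add: sections_def)
    have sm: "c (s v) = v" if "v \<in> ?V" for v using PiE_mem[OF sE that] by simp
    have eq: "{p\<in>?D. mk (s, g) p = b} = {p\<in>T. g p = b} \<union> lam ` {v\<in>?V. s v = b}"
    proof
      show "{p\<in>?D. mk (s, g) p = b} \<subseteq> {p\<in>T. g p = b} \<union> lam ` {v\<in>?V. s v = b}"
      proof
        fix p assume p: "p \<in> {p\<in>?D. mk (s, g) p = b}"
        then consider "p \<in> T" | v where "v \<in> ?V" "p = lam v" using cases_D by blast
        then show "p \<in> {p\<in>T. g p = b} \<union> lam ` {v\<in>?V. s v = b}"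
        proof cases
          case 1 then show ?thesis using mkT[OF 1, of s g] p by simp
        next
          case 2
          have "mk (s, g) p = b" using p by simp
          then have "s v = b" using mklam[OF 2(1), of s g] 2(2) by simp
          then have "v \<in> {v\<in>?V. s v = b}" using 2(1) by simp
          then have "lam v \<in> lam ` {v\<in>?V. s v = b}" by (rule imageI)
          then show ?thesis using 2(2) by (intro UnI2) simp
        qed
      qed
      show "{p\<in>T. g p = b} \<union> lam ` {v\<in>?V. s v = b} \<subseteq> {p\<in>?D. mk (s, g) p = b}"
      proof
        fix p assume "p \<in> {p\<in>T. g p = b} \<union> lam ` {v\<in>?V. s v = b}"
        then show "p \<in> {p\<in>?D. mk (s, g) p = b}"
        proof
          assume "p \<in> {p\<in>T. g p = b}"
          then show ?thesis using mkT[of p s g] T_D by auto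
        next
          assume "p \<in> lam ` {v\<in>?V. s v = b}"
          then obtain v where "v \<in> ?V" "s v = b" "p = lam v" by blast
          then show ?thesis using mklam[of v s g] lam[of v] by simp
        qed
      qed
    qed
    have "{v\<in>W. s v = b} = (if b \<in> s ` W then {c b} else {})" if "\<And>v. v \<in> W \<Longrightarrow> c (s v) = v" for W
      using that by (auto; metis)
    from this[OF sm] have "{v\<in>?V. s v = b} = (if b \<in> s ` ?V then {c b} else {})" .
    then have "card (lam ` {v\<in>?V. s v = b}) = (if b \<in> s ` ?V then 1 else 0)" by simp
    moreover have "card ({p\<in>T. g p = b} \<union> lam ` {v\<in>?V. s v = b}) = card {p\<in>T. g p = b} + card (lam ` {v\<in>?V. s v = b})"
      using finT lamT by (intro card_Un_disjoint) auto
    ultimately have "indeg P l (mk (s, g)) b = card {p\<in>T. g p = b} + (if b \<in> s ` ?V then 1 else 0)"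
      unfolding indeg_def eq by simp
    then show "rp e 1 (indeg P l (mk (s, g)) b) = rp e (if b \<in> s ` ?V then 1 + e else 1) (card {p\<in>T. g p = b})"
      by (simp add: rp_Suc_shift)
  qed
  have cT: "card {p\<in>T. t p = v} = card {p\<in>?D. t p = v} - 1" if v: "v \<in> ?V" for v
  proof -
    have memT: "p \<in> T \<longleftrightarrow> p \<in> ?D \<and> p \<noteq> lam (t p)" for p
    proof
      assume "p \<in> T"
      then have pD: "p \<in> ?D" "p \<notin> lam ` ?V" by (simp_all add: T_def)
      then have "lam (t p) \<in> lam ` ?V" by (intro imageI)
      then show "p \<in> ?D \<and> p \<noteq> lam (t p)" using pD by metis
    next
      assume p: "p \<in> ?D \<and> p \<noteq> lam (t p)"
      have "p \<notin> lam ` ?V"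
      proof
        assume "p \<in> lam ` ?V"
        then obtain w where w: "w \<in> ?V" "p = lam w" by blast
        then have "t p = w" using lam[OF w(1)] by simp
        then show False using p w by simp
      qed
      then show "p \<in> T" using p by (simp add: T_def)
    qed
    have "{p\<in>?D. t p = v} - {lam v} = {p\<in>T. t p = v}"
      unfolding memT by auto
    moreover have "lam v \<in> {p\<in>?D. t p = v}" using lam[OF v] by simp
    ultimately show ?thesis using fin by (metis card_Diff_singleton)
  qed
  \<comment> \<open>Each of these colour classes contains exactly one value of the section, hence a
    single extra \<open>e\<close>.\<close>
  have asum: "(\<Sum>b\<in>{b\<in>P. c b = v}. if b \<in> s ` ?V then 1 + e else 1) = int (card {b\<in>P. c b = v}) + e"
    if s: "s \<in> ?S" and v: "v \<in> ?V" for s v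
  proof -
    have sE: "s \<in> (\<Pi>\<^sub>E v\<in>?V. {b\<in>P. c b = v})" using s by (simp add: sections_def)
    have sm: "s v \<in> P \<and> c (s v) = v" if "v \<in> ?V" for v using PiE_mem[OF sE that] by simp
    have "(\<Sum>b\<in>{b\<in>P. c b = v}. if b \<in> s ` ?V then 1 + e else 1) = (\<Sum>b\<in>{b\<in>P. c b = v}. 1 + (if b = s v then e else 0))"
    proof (rule sum.cong[OF refl])
      fix b assume "b \<in> {b\<in>P. c b = v}"
      then have "b \<in> s ` ?V \<longleftrightarrow> b = s v"
        using section_image[of ?V c s v b] sm v by simp
      then show "(if b \<in> s ` ?V then 1 + e else 1) = 1 + (if b = s v then e else 0)" by simp
    qed
    also have "\<dots> = int (card {b\<in>P. c b = v}) + e" using sm[OF v] fin by (simp add: sum.distrib)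
    finally show ?thesis .
  qed
  have "(\<Sum>f\<in>flow_trees P t c l id. \<Prod>b\<in>P. rp e 1 (indeg P l f b))
    = (\<Sum>f\<in>flow_trees P t c l id. \<Prod>b\<in>P. rp e 1 (restrict (indeg P l f) P b))"
    by (intro sum.cong prod.cong) auto
  also have "\<dots> = (\<Sum>f\<in>flow_trees P t c l (lam \<circ> t). \<Prod>b\<in>P. rp e 1 (restrict (indeg P l f) P b))"
    using sum_flow_trees[OF fin l, of "lam \<circ> t" t "\<lambda>\<delta>. \<Prod>b\<in>P. rp e 1 (\<delta> b)" c] lamt by simp
  also have "\<dots> = (\<Sum>f\<in>flow_trees P t c l (lam \<circ> t). \<Prod>b\<in>P. rp e 1 (indeg P l f b))"
    by (intro sum.cong prod.cong) auto
  also have "\<dots> = (\<Sum>u\<in>?S \<times> (\<Pi>\<^sub>E p\<in>T. ?X p). \<Prod>b\<in>P. rp e 1 (indeg P l (mk u) b))"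
    by (rule sum.reindex_bij_betw[OF bij, symmetric])
  also have "\<dots> = (\<Sum>s\<in>?S. \<Sum>g\<in>(\<Pi>\<^sub>E p\<in>T. ?X p). \<Prod>b\<in>P. rp e 1 (indeg P l (mk (s, g)) b))"
    by (simp add: sum.cartesian_product case_prod_unfold)
  also have "\<dots> = (\<Sum>s\<in>?S. \<Sum>g\<in>(\<Pi>\<^sub>E p\<in>T. ?X p). \<Prod>b\<in>P. rp e (if b \<in> s ` ?V then 1 + e else 1) (card {p\<in>T. g p = b}))"
    by (intro sum.cong refl weight)
  also have "\<dots> = (\<Sum>s\<in>?S. \<Prod>v\<in>?V. rp e (\<Sum>b\<in>{b\<in>P. c b = v}. if b \<in> s ` ?V then 1 + e else 1) (card {p\<in>T. t p = v}))"
    by (intro sum.cong refl sum_polya finT fin) (use T_D in auto)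
  also have "\<dots> = (\<Sum>s\<in>?S. \<Prod>v\<in>?V. rp e (int (card {b\<in>P. c b = v}) + e) (card {p\<in>?D. t p = v} - 1))"
    by (intro sum.cong refl prod.cong) (simp only: asum cT)
  finally show ?thesis .
qed

section \<open>Maps with a root leg\<close>

lemma reach_funpow: "(f ^^ k) x = l \<Longrightarrow> reach f l x"
proof (induction k arbitrary: x)
  case 0 then show ?case by (simp add: reach.base)
next
  case (Suc k)
  then have "(f ^^ k) (f x) = l" by (simp add: funpow_swap1)
  then have "reach f l (f x)" by (rule Suc.IH)
  then show ?case by (rule reach.step)
qed

text \<open>On an edge meeting \<open>X\<close> the choice is forced, on every other edge it is
  binary. The statement is multiplied out to avoid a difference in the exponent.\<close>

lemma card_half_sets:
  fixes opp :: "'a \<Rightarrow> 'a"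
  assumes "finite D" "\<And>x. x \<in> D \<Longrightarrow> opp x \<in> D \<and> opp (opp x) = x \<and> opp x \<noteq> x"
    and "X \<subseteq> D" "\<And>x. x \<in> X \<Longrightarrow> opp x \<notin> X"
  shows "card {M. M \<subseteq> D \<and> X \<subseteq> M \<and> (\<forall>d\<in>D. opp d \<in> M \<longleftrightarrow> d \<notin> M)} * 2 ^ card X = 2 ^ (card D div 2)"
  using assms
proof (induction "card D" arbitrary: D X rule: less_induct)
  case less
  let ?H = "\<lambda>D X. {M. M \<subseteq> D \<and> X \<subseteq> M \<and> (\<forall>d\<in>D. opp d \<in> M \<longleftrightarrow> d \<notin> M)}"
  note fin = less.prems(1) and inv = less.prems(2)
  have A: "card (?H D X) * 2 ^ card X = 2 ^ (card D div 2)"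
    if X: "X \<subseteq> D" "\<And>x. x \<in> X \<Longrightarrow> opp x \<notin> X" "X \<noteq> {}" for X
  proof -
    obtain d where d: "d \<in> X" using X(3) by auto
    have dD: "d \<in> D" "opp d \<in> D" "opp d \<noteq> d" "opp (opp d) = d" "opp d \<notin> X"
      using d X inv[of d] by auto
    let ?D = "D - {d, opp d}" and ?X = "X - {d}"
    have card2: "card {d, opp d} = 2" using dD by auto
    have cD: "card D = card ?D + 2"
      using card_Diff_subset[of "{d, opp d}" D] card2 dD fin card_mono[of D "{d, opp d}"] by auto
    have cX: "card X = Suc (card ?X)" using d X(1) fin by (metis card_Suc_Diff1 finite_subset)
    have inv': "opp x \<in> ?D \<and> opp (opp x) = x \<and> opp x \<noteq> x" if "x \<in> ?D" for x
    proof -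
      have "opp x \<noteq> d" "opp x \<noteq> opp d" using that inv[of x] dD by (metis DiffE insertCI)+
      then show ?thesis using that inv[of x] by auto
    qed
    have "card (?H ?D ?X) * 2 ^ card ?X = 2 ^ (card ?D div 2)"
    proof (rule less.hyps)
      show "card ?D < card D" using cD by simp
    qed (use fin inv' X dD in auto)
    moreover have "bij_betw (\<lambda>M. M - {d}) (?H D X) (?H ?D ?X)"
    proof (rule bij_betw_byWitness[where f' = "insert d"])
      show "\<forall>a\<in>?H D X. insert d (a - {d}) = a" using d by auto
      show "\<forall>a\<in>?H ?D ?X. insert d a - {d} = a" by auto
      show "(\<lambda>M. M - {d}) ` ?H D X \<subseteq> ?H ?D ?X"
      proof (rule image_subsetI)
        fix M assume M: "M \<in> ?H D X"
        have "opp d \<notin> M" using M d dD by auto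
        then show "M - {d} \<in> ?H ?D ?X" using M inv' by auto
      qed
      show "insert d ` ?H ?D ?X \<subseteq> ?H D X"
      proof (rule image_subsetI)
        fix M assume M: "M \<in> ?H ?D ?X"
        have "opp x \<in> insert d M \<longleftrightarrow> x \<notin> insert d M" if "x \<in> D" for x
        proof (cases "x \<in> ?D")
          case True
          then have "opp x \<noteq> d" "x \<noteq> d" using inv'[of x] by auto
          then show ?thesis using M True by auto
        next
          case False
          then have "x = d \<or> x = opp d" using that by auto
          then show ?thesis using dD M by auto
        qed
        then show "insert d M \<in> ?H D X" using M dD by auto
      qed
    qed
    ultimately show ?thesis using cD cX bij_betw_same_card by fastforce
  qed
  show ?case
  proof (cases "X = {}")
    case False then show ?thesis using A less.prems(3,4) by blast
  next
    case True
    show ?thesis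
    proof (cases "D = {}")
      case True
      then have "?H D X = {{}}" using \<open>X = {}\<close> by auto
      then show ?thesis using True \<open>X = {}\<close> by simp
    next
      case False
      then obtain d where d: "d \<in> D" by auto
      note dd = inv[OF d]
      \<comment> \<open>With nothing prescribed, the choice on one edge splits the count into two
        cases with one prescribed dart each.\<close>
      have un: "?H D X = ?H D {d} \<union> ?H D {opp d}" using d dd \<open>X = {}\<close> by auto
      have dis: "?H D {d} \<inter> ?H D {opp d} = {}" using d by auto
      have fin2: "finite (?H D {d})" "finite (?H D {opp d})"
        using fin by (auto intro: finite_subset[of _ "Pow D"])
      have "card (?H D X) = card (?H D {d}) + card (?H D {opp d})"
        unfolding un by (rule card_Un_disjoint[OF fin2 dis])
      moreover have "card (?H D {d}) * 2 ^ card {d} = 2 ^ (card D div 2)"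
        using d dd by (intro A) auto
      moreover have "card (?H D {opp d}) * 2 ^ card {opp d} = 2 ^ (card D div 2)"
        using d dd by (intro A) auto
      ultimately show ?thesis using \<open>X = {}\<close> by simp
    qed
  qed
qed

text \<open>The leg \<open>l\<close> is an extra dart without opposite, which marks a corner.\<close>

locale leg_map =
  fixes D :: "'a set" and opp :: "'a \<Rightarrow> 'a" and l :: 'a and c :: "'a \<Rightarrow> 'b"
  assumes finD: "finite D" and neD: "D \<noteq> {}" and l: "l \<notin> D"
    and opp: "x \<in> D \<Longrightarrow> opp x \<in> D \<and> opp (opp x) = x \<and> opp x \<noteq> x"
    and opp_out: "x \<notin> D \<Longrightarrow> opp x = x" and cl: "c l \<in> c ` D"
begin

definition "Dp = insert l D"
definition "t = (\<lambda>x. c (opp x))"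
definition "V = c ` D"
text \<open>Spanning trees of the contracted graph, rooted at the colour of the leg:
  \<open>s v\<close> is the dart through which \<open>v\<close> is left towards the root, and at the
  root colour the value is \<open>l\<close>.\<close>

definition "arb = {s \<in> (\<Pi>\<^sub>E v\<in>V. {x\<in>Dp. c x = v}). \<forall>v\<in>V. reach (s \<circ> t) l (s v)}"
definition "cls v = {x\<in>Dp. c x = v}"
text \<open>The factor of the BEST theorem; the leg counts in the degree of its colour.\<close>

definition "wgt = (\<Prod>v\<in>V. fact (card (cls v) - 1) :: int)"
text \<open>An orientation of all edges, recorded by one dart of each, together with the
  leg.\<close>

definition "halves = {M. l \<in> M \<and> M \<subseteq> Dp \<and> (\<forall>d\<in>D. opp d \<in> M \<longleftrightarrow> d \<notin> M)}"

lemma finDp [simp]: "finite Dp" using finD by (simp add: Dp_def)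
lemma finV [simp]: "finite V" using finD by (simp add: V_def)
lemma l_Dp [simp]: "l \<in> Dp" by (simp add: Dp_def)
lemma Dp_l: "Dp - {l} = D" using l by (auto simp: Dp_def)
lemma opp_l: "opp l = l" using opp_out l by simp
lemma oppDp: "x \<in> Dp \<Longrightarrow> opp x \<in> Dp \<and> opp (opp x) = x" using opp opp_l by (auto simp: Dp_def)
lemma c_V: "x \<in> Dp \<Longrightarrow> c x \<in> V" using cl by (auto simp: Dp_def V_def)
lemma t_V: "x \<in> Dp \<Longrightarrow> t x \<in> V" using c_V oppDp by (simp add: t_def)

lemma opp_opp: "opp (opp x) = x" using opp opp_out by metis
lemma opp_perm: "opp permutes Dp"
  by (intro bij_imp_permutes bij_betw_byWitness[where f' = opp]) (use oppDp opp_out in \<open>auto simp: Dp_def\<close>)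

lemma opp_image: "opp ` D = D"
  using opp by (metis (no_types, lifting) image_subset_iff imageI subsetI subset_antisym)

lemma t_D: "t ` D = V"
proof -
  have "t ` D = c ` opp ` D" by (auto simp: t_def image_image)
  then show ?thesis using opp_image by (simp add: V_def)
qed

text \<open>Every edge can be traversed both ways, so each colour has as many incoming as outgoing
  darts: the balance condition of an Eulerian digraph.\<close>

lemma card_t: "card {p\<in>D. t p = v} = card {p\<in>D. c p = v}"
proof (rule bij_betw_same_card)
  show "bij_betw opp {p\<in>D. t p = v} {p\<in>D. c p = v}"
    by (rule bij_betw_byWitness[where f' = opp]) (use opp in \<open>auto simp: t_def\<close>)
qed

lemma sections_arb: "sections Dp t c l = arb"
proof -
  have "(\<forall>p\<in>Dp. reach (s \<circ> t) l p) \<longleftrightarrow> (\<forall>v\<in>V. reach (s \<circ> t) l (s v))"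
    if s: "s \<in> (\<Pi>\<^sub>E v\<in>V. {x\<in>Dp. c x = v})" for s
  proof
    assume "\<forall>p\<in>Dp. reach (s \<circ> t) l p"
    then show "\<forall>v\<in>V. reach (s \<circ> t) l (s v)" using PiE_mem[OF s] by simp
  next
    assume a: "\<forall>v\<in>V. reach (s \<circ> t) l (s v)"
    show "\<forall>p\<in>Dp. reach (s \<circ> t) l p"
    proof
      fix p assume "p \<in> Dp"
      then have "reach (s \<circ> t) l ((s \<circ> t) p)" using a t_V by simp
      then show "reach (s \<circ> t) l p" by (rule reach.step)
    qed
  qed
  then show ?thesis unfolding sections_def arb_def Dp_l t_D by blast
qed

section \<open>Eulerian tours and the BEST theorem\<close>

lemma one_orbit_iff_reach:
  assumes "\<psi> permutes Dp"
  shows "one_orbit \<psi> Dp \<longleftrightarrow> (\<forall>x\<in>Dp. reach \<psi> l x)"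
proof
  assume o: "one_orbit \<psi> Dp"
  show "\<forall>x\<in>Dp. reach \<psi> l x"
  proof
    fix x assume "x \<in> Dp"
    then have "l \<in> orbit \<psi> x" using o by (simp add: one_orbit_def)
    then obtain k where "(\<psi> ^^ k) x = l" unfolding orbit_altdef by auto
    then show "reach \<psi> l x" by (rule reach_funpow)
  qed
next
  assume r: "\<forall>x\<in>Dp. reach \<psi> l x"
  have eq: "orbit \<psi> x = orbit \<psi> l" if "reach \<psi> l x" for x
    using that by induction (simp_all add: perm_orbit_step[OF finDp assms])
  show "one_orbit \<psi> Dp" unfolding one_orbit_def
  proof
    fix x assume x: "x \<in> Dp"
    have "y \<in> orbit \<psi> x" if "y \<in> Dp" for y
      using eq r x that perm_self_in_orbit[OF finDp assms, of y] by metis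
    then show "orbit \<psi> x = Dp" using orbit_sub[OF assms x] by auto
  qed
qed

lemma tour_flow:
  "bij_betw (\<lambda>\<rho>. restrict (\<rho> \<circ> opp) D) {\<rho>\<in>invar c Dp. one_orbit (\<rho> \<circ> opp) Dp}
     {f \<in> flow_trees Dp t c l id. inj_on f D}" (is "bij_betw ?r ?L ?R")
proof -
  have "inj_on ?r ?L"
  proof (rule inj_onI)
    fix \<rho> \<rho>' assume r: "\<rho> \<in> ?L" "\<rho>' \<in> ?L" and e: "?r \<rho> = ?r \<rho>'"
    have p: "\<rho> permutes Dp" "\<rho>' permutes Dp" using r by (auto simp: invar_def)
    have eD: "\<rho> x = \<rho>' x" if "x \<in> D" for x
      using fun_cong[OF e, of "opp x"] opp[OF that] by simp
    have "\<rho> l = \<rho>' l"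
    proof -
      have "\<rho> l \<in> Dp - \<rho> ` D" using p(1) permutes_in_image[OF p(1), of l] l permutes_inj[OF p(1)]
        by (auto dest: injD)
      moreover have "\<rho>' ` Dp = Dp" using p(2) by (rule permutes_image)
      ultimately have "\<rho> l \<in> \<rho>' ` Dp - \<rho>' ` D" using eD by auto
      then show ?thesis by (auto simp: Dp_def)
    qed
    then have "\<rho> x = \<rho>' x" if "x \<in> Dp" for x using eD that by (auto simp: Dp_def)
    moreover have "\<rho> x = \<rho>' x" if "x \<notin> Dp" for x using p that by (simp add: permutes_not_in)
    ultimately show "\<rho> = \<rho>'" by blast
  qed
  moreover have "?r ` ?L = ?R"
  proof
    show "?r ` ?L \<subseteq> ?R"
    proof (rule image_subsetI)
      fix \<rho> assume r: "\<rho> \<in> ?L"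
      have p: "\<rho> permutes Dp" using r by (simp add: invar_def)
      have pp: "\<rho> \<circ> opp permutes Dp" using opp_perm p by (rule permutes_compose)
      have fm: "?r \<rho> x \<in> Dp \<and> c (?r \<rho> x) = t x" if "x \<in> D" for x
        using r that opp[OF that] permutes_in_image[OF p, of "opp x"] by (auto simp: invar_def t_def Dp_def)
      have "?r \<rho> \<in> flow Dp t c l" by (rule flowI) (use fm Dp_l in auto)
      moreover have "reach (?r \<rho> \<circ> id) l x" if x: "x \<in> Dp" for x
      proof (rule reach_transfer[OF _ x])
        show "reach (\<rho> \<circ> opp) l x" using one_orbit_iff_reach[OF pp] r x by simp
        show "(\<rho> \<circ> opp) y \<in> Dp \<and> (?r \<rho> \<circ> id) y = (\<rho> \<circ> opp) y" if "y \<in> Dp" "y \<noteq> l" for y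
          using permutes_in_image[OF pp, of y] that by (auto simp: Dp_def)
      qed
      moreover have "inj_on (?r \<rho>) D"
      proof (rule inj_onI)
        fix x y assume "x \<in> D" "y \<in> D" "?r \<rho> x = ?r \<rho> y"
        then have "opp x = opp y" using permutes_inj[OF p] by (auto dest: injD)
        then show "x = y" using opp \<open>x \<in> D\<close> \<open>y \<in> D\<close> by metis
      qed
      ultimately show "?r \<rho> \<in> ?R" by (simp add: flow_trees_def)
    qed
    show "?R \<subseteq> ?r ` ?L"
    proof
      fix f assume f: "f \<in> ?R"
      have ff: "f \<in> flow Dp t c l" and fr: "\<And>p. p \<in> Dp \<Longrightarrow> reach f l p" and fi: "inj_on f D"
        using f by (auto simp: flow_trees_def)
      have fm: "f x \<in> Dp \<and> c (f x) = t x" if "x \<in> D" for x using flow_mem[OF ff] that Dp_l by simp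
      have "card (f ` D) = card D" using fi by (rule card_image)
      moreover have "f ` D \<subseteq> Dp" using fm by auto
      moreover have "card Dp = Suc (card D)" using finD l by (simp add: Dp_def)
      ultimately have "card (Dp - f ` D) = 1" using finD by (simp add: card_Diff_subset)
      then obtain d1 where d1: "Dp - f ` D = {d1}" by (auto simp: card_1_singleton_iff)
      \<comment> \<open>The missed dart \<open>d1\<close> becomes the image of the leg, so it must
        have the colour of \<open>l\<close>. In any other colour the balance \<open>card_t\<close>
        leaves no dart over.\<close>
      have cd1: "c d1 = c l"
      proof (rule ccontr)
        assume ne: "c d1 \<noteq> c l"
        have "f ` {p\<in>D. t p = c d1} \<subseteq> {p\<in>D. c p = c d1} - {d1}"
        proof
          fix y assume "y \<in> f ` {p\<in>D. t p = c d1}"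
          then obtain p where p: "p \<in> D" "t p = c d1" "y = f p" by auto
          then have "y \<noteq> d1" "c y = c d1" "y \<in> Dp" using fm[of p] d1 by auto
          then show "y \<in> {p\<in>D. c p = c d1} - {d1}" using ne by (auto simp: Dp_def)
        qed
        then have "card (f ` {p\<in>D. t p = c d1}) \<le> card ({p\<in>D. c p = c d1} - {d1})"
          using finD by (intro card_mono) auto
        also have "\<dots> < card {p\<in>D. c p = c d1}"
          using finD d1 ne by (intro card_Diff1_less) (auto simp: Dp_def)
        finally show False using card_image[of f "{p\<in>D. t p = c d1}"] fi card_t[of "c d1"]
          by (metis (no_types, lifting) inj_on_subset less_irrefl mem_Collect_eq subsetI)
      qed
      define psi where "psi x = (if x = l then d1 else if x \<in> D then f x else x)" for x
      have psiD: "psi x = f x" if "x \<in> D" for x using that l by (auto simp: psi_def)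
      have "psi ` D = f ` D" by (intro image_cong refl) (rule psiD)
      moreover have "psi l = d1" by (simp add: psi_def)
      ultimately have "psi ` Dp = insert d1 (f ` D)" by (simp only: Dp_def image_insert)
      also have "\<dots> = Dp" using d1 fm by auto
      finally have im: "psi ` Dp = Dp" .
      then have "bij_betw psi Dp Dp" by (simp add: bij_betw_def eq_card_imp_inj_on)
      then have psiP: "psi permutes Dp" by (rule bij_imp_permutes) (auto simp: psi_def Dp_def)
      let ?rho = "psi \<circ> opp"
      have rP: "?rho permutes Dp" using opp_perm psiP by (rule permutes_compose)
      have ro: "?rho \<circ> opp = psi" by (simp add: fun_eq_iff opp_opp)
      have "c (?rho x) = c x" if "x \<in> Dp" for x
      proof (cases "x = l")
        case True then show ?thesis using cd1 opp_l by (simp add: psi_def)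
      next
        case False
        then have x: "x \<in> D" using that by (auto simp: Dp_def)
        then have "opp x \<in> D" using opp by simp
        then show ?thesis using psiD fm[of "opp x"] opp[OF x] that by (simp add: t_def)
      qed
      then have "?rho \<in> invar c Dp" using rP by (simp add: invar_def)
      moreover have "one_orbit (?rho \<circ> opp) Dp"
        unfolding ro one_orbit_iff_reach[OF psiP]
      proof
        fix x assume x: "x \<in> Dp"
        show "reach psi l x"
          by (rule reach_transfer[OF fr[OF x] x]) (use fm psiD in \<open>auto simp: Dp_def\<close>)
      qed
      moreover have "?r ?rho = f"
      proof
        fix x show "?r ?rho x = f x"
        proof (cases "x \<in> D")
          case True
          then show ?thesis using True psiD opp_opp by simp
        next
          case False
          then show ?thesis using flow_arb[OF ff, of x] Dp_l by auto
        qed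
      qed
      ultimately show "f \<in> ?r ` ?L" by (intro image_eqI[of _ _ ?rho]) auto
    qed
  qed
  ultimately show ?thesis by (simp add: bij_betw_def)
qed

lemma card_cls: "card (cls v) = card {x\<in>D. c x = v} + (if v = c l then 1 else 0)"
proof -
  have "cls v = {x\<in>D. c x = v} \<union> (if v = c l then {l} else {})" by (auto simp: cls_def Dp_def)
  then have "card (cls v) = card ({x\<in>D. c x = v} \<union> (if v = c l then {l} else {}))" by simp
  also have "\<dots> = card {x\<in>D. c x = v} + (if v = c l then 1 else 0)"
    using finD l by (subst card_Un_disjoint) auto
  finally show ?thesis .
qed

text \<open>Injectivity means that all indegrees are at most 1, and \<open>rp (-1) 1\<close> is the
  indicator of this. With \<open>e = -1\<close> the general sum becomes a product of falling
  factorials that is the same for each spanning tree.\<close>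

theorem card_tours: "int (card {\<rho>\<in>invar c Dp. one_orbit (\<rho> \<circ> opp) Dp}) = int (card arb) * wgt"
proof -
  have inj: "inj_on f D \<longleftrightarrow> (\<forall>b\<in>Dp. indeg Dp l f b \<le> 1)" if f: "f \<in> flow_trees Dp t c l id" for f
  proof -
    have fm: "f x \<in> Dp" if "x \<in> D" for x
      using f flow_mem[of f Dp t c l x] that Dp_l by (simp add: flow_trees_def)
    show ?thesis unfolding indeg_def Dp_l
    proof
      assume i: "inj_on f D"
      show "\<forall>b\<in>Dp. card {p\<in>D. f p = b} \<le> 1"
      proof
        fix b show "card {p\<in>D. f p = b} \<le> 1"
          using finD i by (intro card_le_Suc0_iff_eq[THEN iffD2, simplified One_nat_def[symmetric]]) (auto dest: inj_onD)
      qed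
    next
      assume a: "\<forall>b\<in>Dp. card {p\<in>D. f p = b} \<le> 1"
      show "inj_on f D"
      proof (rule inj_onI)
        fix x y assume xy: "x \<in> D" "y \<in> D" "f x = f y"
        then have "card {p\<in>D. f p = f x} \<le> Suc 0" using a fm by auto
        then show "x = y" using xy finD by (subst (asm) card_le_Suc0_iff_eq) auto
      qed
    qed
  qed
  have "int (card {\<rho>\<in>invar c Dp. one_orbit (\<rho> \<circ> opp) Dp}) = int (card {f \<in> flow_trees Dp t c l id. inj_on f D})"
    using bij_betw_same_card[OF tour_flow] by simp
  also have "\<dots> = (\<Sum>f\<in>flow_trees Dp t c l id. if inj_on f D then 1 else 0)"
  proof -
    have "finite (flow_trees Dp t c l id)" unfolding flow_trees_def
      by (rule finite_subset[OF _ finite_flow[OF finDp, of t c l]]) blast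
    then show ?thesis by (simp add: sum.If_cases Int_def)
  qed
  also have "\<dots> = (\<Sum>f\<in>flow_trees Dp t c l id. \<Prod>b\<in>Dp. rp (-1) 1 (indeg Dp l f b))"
  proof (rule sum.cong[OF refl])
    fix f assume f: "f \<in> flow_trees Dp t c l id"
    show "(if inj_on f D then 1 else 0) = (\<Prod>b\<in>Dp. rp (-1) 1 (indeg Dp l f b))"
      unfolding rp_falling_1 using inj[OF f] by (auto simp: prod_zero_iff)
  qed
  also have "\<dots> = (\<Sum>s\<in>arb. \<Prod>v\<in>V. rp (-1) (int (card {b\<in>Dp. c b = v}) + -1) (card {p\<in>D. t p = v} - 1))"
    by (simp only: sum_flow_trees_rp[OF finDp l_Dp] sections_arb Dp_l t_D)
  also have "\<dots> = (\<Sum>s\<in>arb. wgt)"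
  proof (rule sum.cong[OF refl])
    fix s
    \<comment> \<open>Off the colour of the leg this is a complete falling factorial. In the colour
      of the leg the last factor is absent, and it would be 1.\<close>
    have "rp (-1) (int (card {b\<in>Dp. c b = v}) + -1) (card {p\<in>D. t p = v} - 1) = fact (card (cls v) - 1)"
      if v: "v \<in> V" for v
    proof -
      let ?m = "card {p\<in>D. c p = v}"
      have "{p\<in>D. c p = v} \<noteq> {}" using v by (auto simp: V_def)
      then have m: "?m > 0" using finD by (simp add: card_gt_0_iff)
      have "int (card {b\<in>Dp. c b = v}) + -1 = int (card (cls v) - 1)"
        using m card_cls[of v] by (simp add: cls_def of_nat_diff)
      moreover have "rp (-1) (int (card (cls v) - 1)) (?m - 1) = fact (card (cls v) - 1)"
        using rp_falling[of "?m - 1" "card (cls v) - 1"] m card_cls[of v] by (auto split: if_splits)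
      ultimately show ?thesis by (simp add: card_t)
    qed
    then show "(\<Prod>v\<in>V. rp (-1) (int (card {b\<in>Dp. c b = v}) + -1) (card {p\<in>D. t p = v} - 1)) = wgt"
      unfolding wgt_def by (intro prod.cong) auto
  qed
  also have "\<dots> = int (card arb) * wgt" by simp
  finally show ?thesis .
qed

text \<open>The tree vertices over \<open>v\<close> correspond to the darts of \<open>M\<close> of
  colour \<open>v\<close>, their parent darts. The left side thus weights a parent function by the
  linear orders of the fibres and the cyclic orders at the vertices. The rising factorials complete
  the factorials of the fibres to \<open>wgt\<close>, which does not depend on
  \<open>M\<close>.\<close>

lemma sum_half:
  assumes M: "M \<in> halves"
  shows "(\<Prod>v\<in>V. fact (card {x\<in>M. c x = v})) * (\<Sum>f\<in>flow_trees M t c l id. \<Prod>b\<in>M. fact (indeg M l f b))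
    = int (card {s\<in>arb. s ` V \<subseteq> M}) * wgt"
proof -
  have lM: "l \<in> M" and MDp: "M \<subseteq> Dp" and half: "\<And>d. d \<in> D \<Longrightarrow> opp d \<in> M \<longleftrightarrow> d \<notin> M"
    using M by (auto simp: halves_def)
  have finM: "finite M" using MDp finDp by (rule finite_subset)
  let ?U = "t ` (M - {l})"
  let ?m = "\<lambda>v. card {x\<in>M. c x = v}"
  let ?k = "\<lambda>v. card {p\<in>M - {l}. t p = v}"
  have UV: "?U \<subseteq> V" using t_V MDp by auto
  have mk: "card (cls v) = ?m v + ?k v" for v
  proof -
    have cv: "cls v = {x\<in>M. c x = v} \<union> opp ` {p\<in>M - {l}. t p = v}"
    proof
      show "cls v \<subseteq> {x\<in>M. c x = v} \<union> opp ` {p\<in>M - {l}. t p = v}"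
      proof
        fix x assume x: "x \<in> cls v"
        show "x \<in> {x\<in>M. c x = v} \<union> opp ` {p\<in>M - {l}. t p = v}"
        proof (cases "x \<in> M")
          case True then show ?thesis using x by (simp add: cls_def)
        next
          case False
          then have xD: "x \<in> D" using x lM by (auto simp: cls_def Dp_def)
          then have "opp x \<in> M - {l}" "t (opp x) = v" "x = opp (opp x)"
            using half[OF xD] False opp[OF xD] x l by (auto simp: cls_def t_def)
          then show ?thesis by blast
        qed
      qed
      show "{x\<in>M. c x = v} \<union> opp ` {p\<in>M - {l}. t p = v} \<subseteq> cls v"
        using MDp oppDp by (auto simp: cls_def t_def)
    qed
    have "{x\<in>M. c x = v} \<inter> opp ` {p\<in>M - {l}. t p = v} = {}"
      using half MDp by (auto simp: Dp_def)
    moreover have "inj_on opp {p\<in>M - {l}. t p = v}"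
      by (rule inj_on_inverseI[where g = opp]) (use MDp oppDp in auto)
    ultimately show ?thesis unfolding cv using finM by (subst card_Un_disjoint) (auto simp: card_image)
  qed
  have kU: "?k v > 0 \<longleftrightarrow> v \<in> ?U" for v
    using finM by (subst card_gt_0_iff) auto
  have cpos: "card (cls v) > 0" if "v \<in> V" for v
    using that finDp by (subst card_gt_0_iff) (auto simp: V_def cls_def Dp_def)
  have "(\<Sum>f\<in>flow_trees M t c l id. \<Prod>b\<in>M. fact (indeg M l f b))
     = (\<Sum>s\<in>sections M t c l. \<Prod>v\<in>?U. rp 1 (int (?m v) + 1) (?k v - 1))"
    using sum_flow_trees_rp[OF finM lM, where t = t and c = c and e = 1] by (simp add: rp_rising_1)
  also have "\<dots> = int (card (sections M t c l)) * (\<Prod>v\<in>?U. rp 1 (int (?m v) + 1) (?k v - 1))"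
    by simp
  finally have 1: "(\<Sum>f\<in>flow_trees M t c l id. \<Prod>b\<in>M. fact (indeg M l f b)) = \<dots>" .
  have 2: "(\<Prod>v\<in>V. fact (?m v)) * (\<Prod>v\<in>?U. rp 1 (int (?m v) + 1) (?k v - 1)) = wgt * (\<Prod>v\<in>V - ?U. int (?m v))"
  proof -
    have "(\<Prod>v\<in>V. fact (?m v)) * (\<Prod>v\<in>?U. rp 1 (int (?m v) + 1) (?k v - 1))
       = (\<Prod>v\<in>V - ?U. fact (?m v)) * (\<Prod>v\<in>?U. fact (?m v) * rp 1 (int (?m v) + 1) (?k v - 1))"
      using prod.subset_diff[OF UV finV, of "\<lambda>v. fact (?m v) :: int"] by (simp add: prod.distrib)
    also have "(\<Prod>v\<in>?U. fact (?m v) * rp 1 (int (?m v) + 1) (?k v - 1)) = (\<Prod>v\<in>?U. fact (card (cls v) - 1))"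
    proof (rule prod.cong[OF refl])
      fix v assume "v \<in> ?U"
      then have "?k v > 0" using kU by blast
      then have "?m v + (?k v - 1) = card (cls v) - 1" using mk[of v] by simp
      then show "fact (?m v) * rp 1 (int (?m v) + 1) (?k v - 1) = (fact (card (cls v) - 1) :: int)"
        unfolding rp_rising by simp
    qed
    \<comment> \<open>A colour outside \<open>?U\<close> is the target of no parent dart, so all of
      its darts lie in \<open>M\<close>. The surplus factor \<open>?m v\<close> will be the free
      choice of its dart in the spanning tree.\<close>
    also have "(\<Prod>v\<in>V - ?U. fact (?m v)) = (\<Prod>v\<in>V - ?U. fact (card (cls v) - 1) * int (?m v))"
    proof (rule prod.cong[OF refl])
      fix v assume v: "v \<in> V - ?U"
      then have "?k v = 0" using kU[of v] by auto
      then have "card (cls v) = ?m v" using mk[of v] by simp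
      then show "fact (?m v) = (fact (card (cls v) - 1) * int (?m v) :: int)"
        using cpos[of v] v by (simp add: fact_reduce)
    qed
    also have "(\<Prod>v\<in>V - ?U. fact (card (cls v) - 1) * int (?m v)) * (\<Prod>v\<in>?U. fact (card (cls v) - 1)) = wgt * (\<Prod>v\<in>V - ?U. int (?m v))"
      unfolding wgt_def using prod.subset_diff[OF UV finV, of "\<lambda>v. fact (card (cls v) - 1) :: int"] by (simp add: prod.distrib)
    finally show ?thesis .
  qed
  \<comment> \<open>A spanning tree inside \<open>M\<close> is a section on the colours in
    \<open>?U\<close> together with an arbitrary dart of \<open>M\<close> for each remaining colour:
    no dart of \<open>M\<close> leads to these, so they are leaves.\<close>
  have 3: "card {s\<in>arb. s ` V \<subseteq> M} = card (sections M t c l) * (\<Prod>v\<in>V - ?U. ?m v)"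
  proof -
    let ?B = "\<Pi>\<^sub>E v\<in>V - ?U. {x\<in>M. c x = v}"
    have tr: "(\<forall>p\<in>M. reach (s \<circ> t) l p) \<longleftrightarrow> (\<forall>v\<in>V. reach (s' \<circ> t) l (s' v))"
      if s': "\<And>v. v \<in> V \<Longrightarrow> s' v \<in> M" and e: "\<And>v. v \<in> ?U \<Longrightarrow> s v = s' v" for s s'
    proof -
      have a: "(s' \<circ> t) x \<in> M \<and> (s \<circ> t) x = (s' \<circ> t) x" if "x \<in> M" "x \<noteq> l" for x
      proof -
        have "t x \<in> ?U" using that by blast
        then show ?thesis using s' e UV by auto
      qed
      then have eq: "reach (s \<circ> t) l x \<longleftrightarrow> reach (s' \<circ> t) l x" if "x \<in> M" for x
        using reach_transfer[OF _ that, of "s \<circ> t" l "s' \<circ> t"] reach_transfer[OF _ that, of "s' \<circ> t" l "s \<circ> t"] by metis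
      show ?thesis
      proof
        assume "\<forall>p\<in>M. reach (s \<circ> t) l p"
        then show "\<forall>v\<in>V. reach (s' \<circ> t) l (s' v)" using eq s' by auto
      next
        assume b: "\<forall>v\<in>V. reach (s' \<circ> t) l (s' v)"
        show "\<forall>p\<in>M. reach (s \<circ> t) l p"
        proof
          fix p assume p: "p \<in> M"
          then have "reach (s' \<circ> t) l ((s' \<circ> t) p)" using b t_V MDp by auto
          then have "reach (s' \<circ> t) l p" by (rule reach.step)
          then show "reach (s \<circ> t) l p" using eq p by simp
        qed
      qed
    qed
    have "bij_betw (\<lambda>s. (restrict s ?U, restrict s (V - ?U))) {s\<in>arb. s ` V \<subseteq> M} (sections M t c l \<times> ?B)"
    proof (rule bij_betw_byWitness[where f' = "\<lambda>(s, g). \<lambda>v\<in>V. if v \<in> ?U then s v else g v"])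
      show "\<forall>s\<in>{s\<in>arb. s ` V \<subseteq> M}. (case (restrict s ?U, restrict s (V - ?U)) of (s, g) \<Rightarrow> \<lambda>v\<in>V. if v \<in> ?U then s v else g v) = s"
      proof
        fix s assume "s \<in> {s\<in>arb. s ` V \<subseteq> M}"
        then have "s \<in> (\<Pi>\<^sub>E v\<in>V. {x\<in>Dp. c x = v})" by (simp add: arb_def)
        from PiE_arb[OF this] show "(case (restrict s ?U, restrict s (V - ?U)) of (s, g) \<Rightarrow> \<lambda>v\<in>V. if v \<in> ?U then s v else g v) = s"
          by (intro ext) (auto simp: restrict_def)
      qed
      show "\<forall>u\<in>sections M t c l \<times> ?B. (restrict (case u of (s, g) \<Rightarrow> \<lambda>v\<in>V. if v \<in> ?U then s v else g v) ?U,
              restrict (case u of (s, g) \<Rightarrow> \<lambda>v\<in>V. if v \<in> ?U then s v else g v) (V - ?U)) = u"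
      proof
        fix u assume "u \<in> sections M t c l \<times> ?B"
        then obtain s g where u: "u = (s, g)" and s: "s \<in> (\<Pi>\<^sub>E v\<in>?U. {x\<in>M. c x = v})" and g: "g \<in> ?B"
          by (auto simp: sections_def)
        have "restrict (\<lambda>v\<in>V. if v \<in> ?U then s v else g v) ?U = s"
        proof
          fix v show "restrict (\<lambda>v\<in>V. if v \<in> ?U then s v else g v) ?U v = s v"
            using PiE_arb[OF s, of v] UV by (cases "v \<in> ?U") auto
        qed
        moreover have "restrict (\<lambda>v\<in>V. if v \<in> ?U then s v else g v) (V - ?U) = g"
        proof
          fix v show "restrict (\<lambda>v\<in>V. if v \<in> ?U then s v else g v) (V - ?U) v = g v"
            using PiE_arb[OF g, of v] by (cases "v \<in> V - ?U") auto
        qed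
        ultimately show "(restrict (case u of (s, g) \<Rightarrow> \<lambda>v\<in>V. if v \<in> ?U then s v else g v) ?U,
              restrict (case u of (s, g) \<Rightarrow> \<lambda>v\<in>V. if v \<in> ?U then s v else g v) (V - ?U)) = u" using u by simp
      qed
      show "(\<lambda>s. (restrict s ?U, restrict s (V - ?U))) ` {s\<in>arb. s ` V \<subseteq> M} \<subseteq> sections M t c l \<times> ?B"
      proof (rule image_subsetI)
        fix s assume s: "s \<in> {s\<in>arb. s ` V \<subseteq> M}"
        then have sE: "s \<in> (\<Pi>\<^sub>E v\<in>V. {x\<in>Dp. c x = v})" and sr: "\<forall>v\<in>V. reach (s \<circ> t) l (s v)" by (simp_all add: arb_def)
        have sm: "s v \<in> M \<and> c (s v) = v" if "v \<in> V" for v using PiE_mem[OF sE that] s that by auto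
        have "restrict s ?U \<in> (\<Pi>\<^sub>E v\<in>?U. {x\<in>M. c x = v})" using sm UV by (intro PiE_I) auto
        moreover have "\<forall>p\<in>M. reach (restrict s ?U \<circ> t) l p" using tr[of s "restrict s ?U"] sm sr by auto
        moreover have "restrict s (V - ?U) \<in> ?B" using sm by auto
        ultimately show "(restrict s ?U, restrict s (V - ?U)) \<in> sections M t c l \<times> ?B" by (simp add: sections_def)
      qed
      show "(\<lambda>(s, g). \<lambda>v\<in>V. if v \<in> ?U then s v else g v) ` (sections M t c l \<times> ?B) \<subseteq> {s\<in>arb. s ` V \<subseteq> M}"
      proof (rule image_subsetI)
        fix u assume "u \<in> sections M t c l \<times> ?B"
        then obtain s g where u: "u = (s, g)" and s: "s \<in> (\<Pi>\<^sub>E v\<in>?U. {x\<in>M. c x = v})" and g: "g \<in> ?B"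
          and sr: "\<forall>p\<in>M. reach (s \<circ> t) l p"
          by (auto simp: sections_def)
        let ?s = "\<lambda>v\<in>V. if v \<in> ?U then s v else g v"
        have sm: "?s v \<in> M \<and> c (?s v) = v" if "v \<in> V" for v
          using PiE_mem[OF s, of v] PiE_mem[OF g, of v] that by (cases "v \<in> ?U") auto
        have "?s \<in> (\<Pi>\<^sub>E v\<in>V. {x\<in>Dp. c x = v})"
        proof (rule PiE_I)
          fix v assume "v \<in> V" then show "?s v \<in> {x\<in>Dp. c x = v}" using sm MDp by blast
        qed simp
        moreover have "\<forall>v\<in>V. reach (?s \<circ> t) l (?s v)"
        proof -
          have "s v = ?s v" if "v \<in> ?U" for v using that UV by (simp add: subset_iff)
          then show ?thesis using tr[of ?s s] sm sr by blast
        qed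
        ultimately have "?s \<in> arb" by (simp add: arb_def)
        moreover have "?s ` V \<subseteq> M" using sm by blast
        ultimately show "(case u of (s, g) \<Rightarrow> \<lambda>v\<in>V. if v \<in> ?U then s v else g v) \<in> {s\<in>arb. s ` V \<subseteq> M}" using u by simp
      qed
    qed
    then show ?thesis by (simp add: bij_betw_same_card card_cartesian_product card_PiE)
  qed
  show ?thesis unfolding 1 3 using 2 by (simp add: algebra_simps)
qed

text \<open>If both darts of an edge were chosen, the two colours would point at each other and
  neither could reach the leg. A path that does arrive ends with the leg as a chosen dart.\<close>

lemma arb_props:
  assumes s: "s \<in> arb"
  shows "s ` V \<subseteq> Dp" "inj_on s V" "l \<in> s ` V" "x \<in> s ` V - {l} \<Longrightarrow> opp x \<notin> s ` V - {l}"
proof -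
  have sE: "s \<in> (\<Pi>\<^sub>E v\<in>V. {x\<in>Dp. c x = v})" and sr: "\<And>v. v \<in> V \<Longrightarrow> reach (s \<circ> t) l (s v)"
    using s by (simp_all add: arb_def)
  have sm: "s v \<in> Dp \<and> c (s v) = v" if "v \<in> V" for v using PiE_mem[OF sE that] by simp
  then show 1: "s ` V \<subseteq> Dp" by blast
  show "inj_on s V" by (rule inj_on_inverseI[of _ c]) (use sm in auto)
  have "l \<in> s ` V" if "reach (s \<circ> t) l x" "x \<in> s ` V" for x
    using that by induction (use t_V 1 in auto)
  then show "l \<in> s ` V" using sr c_V[OF l_Dp] by blast
  show "opp x \<notin> s ` V - {l}" if x: "x \<in> s ` V - {l}"
  proof
    assume ox: "opp x \<in> s ` V - {l}"
    have xD: "x \<in> D" using x 1 by (auto simp: Dp_def)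
    have s1: "s (c x) = x" using x sm by auto
    have s2: "s (c (opp x)) = opp x" using ox sm by (metis DiffE imageE)
    have "y \<noteq> x \<and> y \<noteq> opp x" if "reach (s \<circ> t) l y" for y
      using that
    proof induction
      case base then show ?case using xD opp[OF xD] l by auto
    next
      case (step y)
      then show ?case using s1 s2 opp[OF xD] by (auto simp: t_def)
    qed
    moreover have "reach (s \<circ> t) l x" using sr x by auto
    ultimately show False by blast
  qed
qed

text \<open>A spanning tree fixes the direction of \<open>card V - 1\<close> edges and leaves the
  others free. Multiplied out, the exponent exceeds the number of edges by 1, since one of the
  \<open>card V\<close> chosen darts is the leg.\<close>

lemma card_halves_above:
  assumes s: "s \<in> arb"
  shows "card {M\<in>halves. s ` V \<subseteq> M} * 2 ^ card V = 2 ^ (card D div 2 + 1)"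
proof -
  note sp = arb_props[OF s]
  let ?X = "s ` V - {l}"
  let ?H = "{M. M \<subseteq> D \<and> ?X \<subseteq> M \<and> (\<forall>d\<in>D. opp d \<in> M \<longleftrightarrow> d \<notin> M)}"
  have "bij_betw (insert l) ?H {M\<in>halves. s ` V \<subseteq> M}"
  proof (rule bij_betw_byWitness[where f' = "\<lambda>M. M - {l}"])
    show "\<forall>a\<in>?H. insert l a - {l} = a" using l by auto
    show "\<forall>a\<in>{M\<in>halves. s ` V \<subseteq> M}. insert l (a - {l}) = a" by (auto simp: halves_def)
    show "insert l ` ?H \<subseteq> {M\<in>halves. s ` V \<subseteq> M}"
    proof (rule image_subsetI)
      fix M assume M: "M \<in> ?H"
      have "opp d \<in> insert l M \<longleftrightarrow> d \<notin> insert l M" if "d \<in> D" for d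
        using M that opp[OF that] l by auto
      then show "insert l M \<in> {M\<in>halves. s ` V \<subseteq> M}" using M by (auto simp: halves_def Dp_def)
    qed
    show "(\<lambda>M. M - {l}) ` {M\<in>halves. s ` V \<subseteq> M} \<subseteq> ?H"
    proof (rule image_subsetI)
      fix M assume M: "M \<in> {M\<in>halves. s ` V \<subseteq> M}"
      have "opp d \<in> M - {l} \<longleftrightarrow> d \<notin> M - {l}" if "d \<in> D" for d
        using M that opp[OF that] l by (auto simp: halves_def)
      moreover have "M - {l} \<subseteq> D" using M by (auto simp: halves_def Dp_def)
      moreover have "s ` V - {l} \<subseteq> M - {l}" using M by blast
      ultimately show "M - {l} \<in> ?H" by simp
    qed
  qed
  from bij_betw_same_card[OF this] have c1: "card {M\<in>halves. s ` V \<subseteq> M} = card ?H" by (rule sym)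
  have "card ?H * 2 ^ card ?X = 2 ^ (card D div 2)"
  proof (rule card_half_sets[OF finD opp])
    show "?X \<subseteq> D" using sp(1) by (auto simp: Dp_def)
  qed (use sp(4) in blast)+
  moreover have "card V = Suc (card ?X)"
    using sp(2,3) finV by (metis card_Suc_Diff1 card_image finite_imageI)
  ultimately show ?thesis unfolding c1 by simp
qed

lemma finite_halves: "finite halves"
  by (rule finite_subset[of _ "Pow Dp"]) (auto simp: halves_def)

lemma finite_arb: "finite arb"
  by (rule finite_subset[of _ "\<Pi>\<^sub>E v\<in>V. {x\<in>Dp. c x = v}"]) (auto simp: arb_def intro!: finite_PiE)

text \<open>Pairs of a spanning tree and an orientation containing it, counted in both
  orders.\<close>

theorem sum_halves:
  "2 ^ card V * (\<Sum>M\<in>halves. (\<Prod>v\<in>V. fact (card {x\<in>M. c x = v})) * (\<Sum>f\<in>flow_trees M t c l id. \<Prod>b\<in>M. fact (indeg M l f b)))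
    = 2 ^ (card D div 2 + 1) * int (card {\<rho>\<in>invar c Dp. one_orbit (\<rho> \<circ> opp) Dp})"
proof -
  have "(\<Sum>M\<in>halves. (\<Prod>v\<in>V. fact (card {x\<in>M. c x = v})) * (\<Sum>f\<in>flow_trees M t c l id. \<Prod>b\<in>M. fact (indeg M l f b)))
     = (\<Sum>M\<in>halves. \<Sum>s\<in>arb. if s ` V \<subseteq> M then wgt else 0)"
    using finite_arb by (intro sum.cong refl) (simp add: sum_half sum.If_cases Int_def)
  also have "\<dots> = (\<Sum>s\<in>arb. int (card {M\<in>halves. s ` V \<subseteq> M}) * wgt)"
    using finite_halves by (subst sum.swap) (simp add: sum.If_cases Int_def)
  finally have "2 ^ card V * (\<Sum>M\<in>halves. (\<Prod>v\<in>V. fact (card {x\<in>M. c x = v})) * (\<Sum>f\<in>flow_trees M t c l id. \<Prod>b\<in>M. fact (indeg M l f b)))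
     = (\<Sum>s\<in>arb. (2 ^ card V * int (card {M\<in>halves. s ` V \<subseteq> M})) * wgt)"
    by (simp add: sum_distrib_left mult.assoc)
  also have "\<dots> = (\<Sum>s\<in>arb. 2 ^ (card D div 2 + 1) * wgt)"
  proof (rule sum.cong[OF refl])
    fix s assume "s \<in> arb"
    then have "int (card {M\<in>halves. s ` V \<subseteq> M} * 2 ^ card V) = int (2 ^ (card D div 2 + 1))"
      using card_halves_above[of s] by (simp only:)
    then have "2 ^ card V * int (card {M\<in>halves. s ` V \<subseteq> M}) = 2 ^ (card D div 2 + 1)"
      by (simp add: mult.commute)
    then show "(2 ^ card V * int (card {M\<in>halves. s ` V \<subseteq> M})) * wgt = 2 ^ (card D div 2 + 1) * wgt" by simp
  qed
  also have "\<dots> = 2 ^ (card D div 2 + 1) * int (card {\<rho>\<in>invar c Dp. one_orbit (\<rho> \<circ> opp) Dp})"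
    by (simp add: card_tours)
  finally show ?thesis .
qed

end

section \<open>Plane trees as parent functions\<close>

text \<open>The depth in the tree. The distance is a least exponent, so the recursion is available
  only where \<open>l\<close> can be reached.\<close>

lemma reach_dist:
  assumes "reach f l x" "x \<noteq> l"
  shows "funpow_dist f x l = Suc (funpow_dist f (f x) l)"
proof -
  have "\<exists>k. (f ^^ k) x = l" using assms(1)
  proof induction
    case base
    show ?case by (rule exI[of _ 0]) simp
  next
    case (step x)
    then obtain k where "(f ^^ k) (f x) = l" by blast
    then show ?case by (intro exI[of _ "Suc k"]) (simp add: funpow_swap1)
  qed
  then obtain k where k: "(f ^^ k) x = l" by blast
  then have "k > 0" using assms(2) by (cases k) auto
  then have "l \<in> orbit f x" unfolding orbit_altdef using k by blast
  then show ?thesis using assms(2) by (intro funpow_dist_step) auto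
qed

context leg_map
begin

text \<open>
  A plane tree with a root leg is given by the set \<open>M\<close> of the leg and of the darts that lead from a
  vertex to its parent (a half, in the sense of \<^const>\<open>halves\<close>), by the parent function \<open>f\<close> on \<open>M\<close>, and by
  a cyclic order on each block \<open>{x. rep M f x = p}\<close>, the vertex of \<open>p \<in> M\<close>.
\<close>

definition "rep M f x = (if x \<in> M then x else f (opp x))"
definition "blocks \<rho> M f \<longleftrightarrow> (\<forall>x\<in>Dp. orbit \<rho> x = {y\<in>Dp. rep M f y = rep M f x})"
text \<open>One face and one vertex more than edges: by Euler's relation this is genus 0. The leg is
  not counted as an edge.\<close>

definition "trees = {\<rho>\<in>invar c Dp. one_orbit (\<rho> \<circ> opp) Dp \<and> card (orbit \<rho> ` Dp) = card D div 2 + 1}"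
abbreviation "pf M \<equiv> flow_trees M t c l id"

section \<open>From parent functions to rotations\<close>

lemma halvesD:
  assumes "M \<in> halves"
  shows "l \<in> M" "M \<subseteq> Dp" "finite M" "d \<in> D \<Longrightarrow> opp d \<in> M \<longleftrightarrow> d \<notin> M" "p \<in> M - {l} \<Longrightarrow> p \<in> D"
    "p \<in> M - {l} \<Longrightarrow> opp p \<in> D - M" "x \<in> Dp \<Longrightarrow> x \<notin> M \<Longrightarrow> opp x \<in> M - {l}"
proof -
  show 1: "l \<in> M" "M \<subseteq> Dp" and 2: "d \<in> D \<Longrightarrow> opp d \<in> M \<longleftrightarrow> d \<notin> M" for d
    using assms by (auto simp: halves_def)
  show "finite M" using 1(2) finDp by (rule finite_subset)
  show 3: "p \<in> M - {l} \<Longrightarrow> p \<in> D" for p using 1 by (auto simp: Dp_def)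
  show "p \<in> M - {l} \<Longrightarrow> opp p \<in> D - M" using 2[of p] 3[of p] opp by blast
  show "opp x \<in> M - {l}" if x: "x \<in> Dp" "x \<notin> M"
  proof -
    have "x \<in> D" using x 1(1) by (auto simp: Dp_def)
    then show ?thesis using 2[of x] opp[of x] l x(2) by auto
  qed
qed

lemma pfD:
  assumes "f \<in> pf M"
  shows "p \<in> M - {l} \<Longrightarrow> f p \<in> M \<and> c (f p) = t p" "p \<in> M \<Longrightarrow> reach f l p" "p \<notin> M - {l} \<Longrightarrow> f p = undefined"
  using assms flow_mem[of f M t c l p] flow_arb[of f M t c l p] by (auto simp: flow_trees_def)

lemma rep_mem:
  assumes "M \<in> halves" "f \<in> pf M" "x \<in> Dp"
  shows "rep M f x \<in> M \<and> c (rep M f x) = c x"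
proof (cases "x \<in> M")
  case False
  then have "opp x \<in> M - {l}" using halvesD(7)[OF assms(1,3)] by simp
  then show ?thesis using pfD(1)[OF assms(2)] False by (simp add: rep_def t_def opp_opp)
qed (simp add: rep_def)

lemma card_half:
  assumes "M \<in> halves"
  shows "card M = card D div 2 + 1"
proof -
  note h = halvesD[OF assms]
  have "D = (M - {l}) \<union> opp ` (M - {l})"
  proof
    show "D \<subseteq> (M - {l}) \<union> opp ` (M - {l})"
    proof
      fix x assume x: "x \<in> D"
      show "x \<in> (M - {l}) \<union> opp ` (M - {l})"
      proof (cases "x \<in> M")
        case True then show ?thesis using x l by auto
      next
        case False
        then have "opp x \<in> M - {l}" using h(7)[of x] x by (simp add: Dp_def)
        then have "opp (opp x) \<in> opp ` (M - {l})" by (rule imageI)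
        then show ?thesis by (simp add: opp_opp)
      qed
    qed
    show "(M - {l}) \<union> opp ` (M - {l}) \<subseteq> D" using h(5,6) by blast
  qed
  moreover have "(M - {l}) \<inter> opp ` (M - {l}) = {}" using h(6) by blast
  moreover have "card (opp ` (M - {l})) = card (M - {l})"
    using permutes_inj[OF opp_perm] by (intro card_image) (auto intro: inj_on_subset)
  ultimately have "card D = card (M - {l}) + card (M - {l})"
    using card_Un_disjoint[of "M - {l}" "opp ` (M - {l})"] h(3) by simp
  moreover have "card M = Suc (card (M - {l}))" using h(1,3) by (simp only: card_Suc_Diff1)
  ultimately show ?thesis by simp
qed

text \<open>The vertex of \<open>b\<close> carries its parent dart \<open>b\<close> and the
  opposites of the parent darts of its children, so it has \<open>indeg M l f b + 1\<close> darts
  and \<open>fact (indeg M l f b)\<close> cyclic orders.\<close>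

lemma card_blocks_perms:
  assumes M: "M \<in> halves" and f: "f \<in> pf M"
  shows "card {\<rho>. \<rho> permutes Dp \<and> blocks \<rho> M f} = (\<Prod>b\<in>M. fact (indeg M l f b))"
proof -
  note hd = halvesD[OF M]
  let ?h = "rep M f"
  let ?F = "\<lambda>b. {x\<in>Dp. ?h x = b}"
  let ?G = "\<lambda>b g. if one_orbit g (?F b) then 1 else 0 :: nat"
  have hM: "?h ` Dp \<subseteq> M" using rep_mem[OF M f] by blast
  have iff: "\<rho> permutes Dp \<and> blocks \<rho> M f \<longleftrightarrow> \<rho> \<in> invar ?h Dp \<and> (\<forall>b\<in>M. one_orbit (perm_restrict \<rho> (?F b)) (?F b))" for \<rho>
  proof
    assume L: "\<rho> permutes Dp \<and> blocks \<rho> M f"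
    have i: "\<rho> \<in> invar ?h Dp"
      using L by (intro invar_iff_orbit[OF finDp, THEN iffD2]) (auto simp: blocks_def)
    moreover have "one_orbit (perm_restrict \<rho> (?F b)) (?F b)" for b
      unfolding one_orbit_def
    proof
      fix x assume x: "x \<in> ?F b"
      then have "orbit (perm_restrict \<rho> (?F b)) x = orbit \<rho> x" using orbit_perm_restrict[OF i, of x b] by simp
      then show "orbit (perm_restrict \<rho> (?F b)) x = ?F b" using L x by (auto simp: blocks_def)
    qed
    ultimately show "\<rho> \<in> invar ?h Dp \<and> (\<forall>b\<in>M. one_orbit (perm_restrict \<rho> (?F b)) (?F b))" by blast
  next
    assume R: "\<rho> \<in> invar ?h Dp \<and> (\<forall>b\<in>M. one_orbit (perm_restrict \<rho> (?F b)) (?F b))"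
    have "orbit \<rho> x = {y\<in>Dp. ?h y = ?h x}" if x: "x \<in> Dp" for x
    proof -
      have "?h x \<in> M" using rep_mem[OF M f x] by simp
      then have "orbit (perm_restrict \<rho> (?F (?h x))) x = ?F (?h x)" using R x by (auto simp: one_orbit_def)
      then show ?thesis using orbit_perm_restrict[of \<rho> ?h Dp x "?h x"] R x by simp
    qed
    then show "\<rho> permutes Dp \<and> blocks \<rho> M f" using R by (auto simp: blocks_def invar_def)
  qed
  have finI: "finite (invar ?h Dp)" using finDp
    by (auto simp: invar_def intro: finite_subset[OF _ finite_permutations])
  have "card {\<rho>. \<rho> permutes Dp \<and> blocks \<rho> M f} = card {\<rho>\<in>invar ?h Dp. \<forall>b\<in>M. one_orbit (perm_restrict \<rho> (?F b)) (?F b)}"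
    unfolding iff by simp
  also have "\<dots> = (\<Sum>\<rho>\<in>invar ?h Dp. if \<forall>b\<in>M. one_orbit (perm_restrict \<rho> (?F b)) (?F b) then 1 else 0)"
    using finI by (simp add: sum.If_cases Int_def)
  also have "\<dots> = (\<Sum>\<rho>\<in>invar ?h Dp. \<Prod>b\<in>M. ?G b (perm_restrict \<rho> (?F b)))"
    using hd(3) by (intro sum.cong refl) (auto simp: prod_zero_iff)
  also have "\<dots> = (\<Prod>b\<in>M. \<Sum>g\<in>{g. g permutes ?F b}. ?G b g)"
    by (rule sum_invar_prod[OF finDp hd(3) hM])
  also have "\<dots> = (\<Prod>b\<in>M. fact (indeg M l f b))"
  proof (rule prod.cong[OF refl])
    fix b assume b: "b \<in> M"
    have F: "?F b = insert b (opp ` {p\<in>M - {l}. f p = b})"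
    proof
      show "?F b \<subseteq> insert b (opp ` {p\<in>M - {l}. f p = b})"
      proof
        fix x assume x: "x \<in> ?F b"
        show "x \<in> insert b (opp ` {p\<in>M - {l}. f p = b})"
        proof (cases "x \<in> M")
          case True then show ?thesis using x by (simp add: rep_def)
        next
          case False
          then have "opp x \<in> {p\<in>M - {l}. f p = b}" using hd(7)[of x] x by (simp add: rep_def)
          then have "opp (opp x) \<in> opp ` {p\<in>M - {l}. f p = b}" by (rule imageI)
          then show ?thesis by (simp add: opp_opp)
        qed
      qed
      show "insert b (opp ` {p\<in>M - {l}. f p = b}) \<subseteq> ?F b"
      proof
        fix x assume "x \<in> insert b (opp ` {p\<in>M - {l}. f p = b})"
        then consider "x = b" | p where "p \<in> M - {l}" "f p = b" "x = opp p" by blast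
        then show "x \<in> ?F b"
        proof cases
          case 1 then show ?thesis using b hd(2) by (auto simp: rep_def)
        next
          case 2 then show ?thesis using hd(6)[of p] by (auto simp: rep_def opp_opp Dp_def)
        qed
      qed
    qed
    have "b \<notin> opp ` {p\<in>M - {l}. f p = b}" using hd(6) b by blast
    moreover have "card (opp ` {p\<in>M - {l}. f p = b}) = indeg M l f b"
      unfolding indeg_def using permutes_inj[OF opp_perm] by (intro card_image) (auto intro: inj_on_subset)
    ultimately have cF: "card (?F b) = Suc (indeg M l f b)"
      unfolding F using hd(3) by simp
    have finF: "finite (?F b)" "?F b \<noteq> {}" using finDp by (simp, use F in blast)
    have "(\<Sum>g\<in>{g. g permutes ?F b}. ?G b g) = card {g. g permutes ?F b \<and> one_orbit g (?F b)}"
      using finite_permutations[OF finF(1)] by (simp add: sum.If_cases Int_def)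
    also have "\<dots> = fact (indeg M l f b)" using card_one_orbit[OF finF] cF by simp
    finally show "(\<Sum>g\<in>{g. g permutes ?F b}. ?G b g) = fact (indeg M l f b)" .
  qed
  finally show ?thesis .
qed

text \<open>Each vertex contains exactly one dart of \<open>M\<close>, namely its parent dart or the
  leg.\<close>

lemma blocks_orbits:
  assumes M: "M \<in> halves" and f: "f \<in> pf M" and p: "\<rho> permutes Dp" and b: "blocks \<rho> M f"
  shows "card (orbit \<rho> ` cls v) = card {x\<in>M. c x = v}" "card (orbit \<rho> ` Dp) = card D div 2 + 1"
proof -
  note hd = halvesD[OF M]
  have orb: "orbit \<rho> x = orbit \<rho> (rep M f x)" if "x \<in> Dp" for x
  proof -
    have "rep M f x \<in> M" using rep_mem[OF M f that] by simp
    then have "rep M f x \<in> orbit \<rho> x" using b that hd(2) by (auto simp: blocks_def rep_def)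
    then show ?thesis using perm_orbit_eq[OF finDp p] by metis
  qed
  have inj: "inj_on (orbit \<rho>) M"
  proof (rule inj_onI)
    fix x y assume x: "x \<in> M" and y: "y \<in> M" and e: "orbit \<rho> x = orbit \<rho> y"
    have "y \<in> orbit \<rho> x" using perm_self_in_orbit[OF finDp p, of y] e by simp
    then show "x = y" using b x y hd(2) by (auto simp: blocks_def rep_def)
  qed
  have im: "orbit \<rho> ` A = orbit \<rho> ` {x\<in>M. x \<in> A}" if A: "A \<subseteq> Dp" "\<And>x. x \<in> A \<Longrightarrow> rep M f x \<in> A" for A
  proof
    show "orbit \<rho> ` A \<subseteq> orbit \<rho> ` {x\<in>M. x \<in> A}"
    proof (rule image_subsetI)
      fix x assume "x \<in> A"
      then have "rep M f x \<in> {x\<in>M. x \<in> A}" "orbit \<rho> x = orbit \<rho> (rep M f x)"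
        using A rep_mem[OF M f, of x] orb[of x] by auto
      then show "orbit \<rho> x \<in> orbit \<rho> ` {x\<in>M. x \<in> A}" by (metis imageI)
    qed
  qed blast
  have "orbit \<rho> ` cls v = orbit \<rho> ` {x\<in>M. x \<in> cls v}"
    using rep_mem[OF M f] hd(2) by (intro im) (auto simp: cls_def)
  also have "{x\<in>M. x \<in> cls v} = {x\<in>M. c x = v}" using hd(2) by (auto simp: cls_def)
  finally show "card (orbit \<rho> ` cls v) = card {x\<in>M. c x = v}"
    using inj by (simp add: card_image inj_on_def)
  have "orbit \<rho> ` Dp = orbit \<rho> ` {x\<in>M. x \<in> Dp}"
    using rep_mem[OF M f] hd(2) by (intro im) auto
  also have "{x\<in>M. x \<in> Dp} = M" using hd(2) by auto
  finally show "card (orbit \<rho> ` Dp) = card D div 2 + 1"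
    using inj card_half[OF M] by (simp add: card_image)
qed

text \<open>A walk along the face that enters a vertex from its parent goes around the subtree and
  returns to the parent. Hence the two darts of each edge share a face, and following parents down
  to the leg leaves only one face.\<close>

lemma blocks_tree:
  assumes M: "M \<in> halves" and f: "f \<in> pf M" and p: "\<rho> permutes Dp" and b: "blocks \<rho> M f"
  shows "\<rho> \<in> trees"
proof -
  note hd = halvesD[OF M]
  have inv: "\<rho> \<in> invar c Dp"
  proof (rule invar_iff_orbit[OF finDp p, THEN iffD2], intro ballI)
    fix x y assume x: "x \<in> Dp" and "y \<in> orbit \<rho> x"
    then have "y \<in> Dp" "rep M f y = rep M f x" using b by (auto simp: blocks_def)
    then show "c y = c x" using rep_mem[OF M f] x by metis
  qed
  define psi where "psi = \<rho> \<circ> opp"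
  have pp: "psi permutes Dp" unfolding psi_def using opp_perm p by (rule permutes_compose)
  note self = perm_self_in_orbit[OF finDp pp]
  note eq = perm_orbit_eq[OF finDp pp]
  note stp = perm_orbit_step[OF finDp pp]
  have rpsi: "\<rho> x = psi (opp x)" for x by (simp add: psi_def opp_opp)
  let ?dep = "\<lambda>p. funpow_dist f p l"
  let ?F = "{p\<in>M - {l}. p \<notin> orbit psi (opp p)}"
  \<comment> \<open>A counterexample \<open>q\<close> of maximal depth: from each child the walk
    comes back, so it visits the darts around the vertex one after the other and arrives at
    \<open>q\<close> after all.\<close>
  have Q: "p \<in> orbit psi (opp p)" if "p \<in> M - {l}" for p
  proof (rule ccontr)
    assume "p \<notin> orbit psi (opp p)"
    then have ne: "?F \<noteq> {}" using that by blast
    have "finite (?dep ` ?F)" using hd(3) by simp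
    then have "Max (?dep ` ?F) \<in> ?dep ` ?F" "\<And>q. q \<in> ?F \<Longrightarrow> ?dep q \<le> Max (?dep ` ?F)" using ne by auto
    then obtain q where q: "q \<in> ?F" and mx: "\<And>q'. q' \<in> ?F \<Longrightarrow> ?dep q' \<le> ?dep q" by auto
    have qM: "q \<in> M - {l}" and qn: "q \<notin> orbit psi (opp q)" using q by auto
    have qDp: "q \<in> Dp" using qM hd(2) by auto
    have repq: "rep M f q = q" using qM by (simp add: rep_def)
    have "y \<in> orbit psi (opp q)" if "y \<in> orbit \<rho> q" for y
      using that
    proof induction
      case base
      show ?case unfolding rpsi by (rule orbit.base)
    next
      case (step y)
      have y: "y \<in> Dp" "rep M f y = q" using step.hyps b qDp repq by (auto simp: blocks_def)
      have "y \<noteq> q" using step.IH qn by auto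
      then have "y \<notin> M" using y by (auto simp: rep_def)
      then have p1: "opp y \<in> M - {l}" "f (opp y) = q" using hd(7)[OF y(1)] y by (simp_all add: rep_def)
      have "?dep (opp y) = Suc (?dep q)"
        using reach_dist[OF pfD(2)[OF f, of "opp y"]] p1 by auto
      then have "opp y \<notin> ?F" using mx[of "opp y"] by fastforce
      then have "opp y \<in> orbit psi (opp (opp y))" using p1 by blast
      then have "orbit psi (opp y) = orbit psi y" using eq by (simp add: opp_opp)
      moreover have "orbit psi y = orbit psi (opp q)" using eq step.IH by simp
      moreover have "\<rho> y \<in> orbit psi (opp y)" unfolding rpsi by (rule orbit.base)
      ultimately show ?case by simp
    qed
    then show False using qn perm_self_in_orbit[OF finDp p, of q] by blast
  qed
  have O: "orbit psi (opp x) = orbit psi x" if x: "x \<in> Dp" for x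
  proof (cases "x \<in> M")
    case True
    show ?thesis
    proof (cases "x = l")
      case True then show ?thesis by (simp add: opp_l)
    next
      case False then show ?thesis using eq[OF Q[of x]] True by simp
    qed
  next
    case False
    then show ?thesis using eq[OF Q[of "opp x"]] hd(7)[OF x] by (simp add: opp_opp)
  qed
  have rO: "orbit psi (\<rho> x) = orbit psi x" if x: "x \<in> Dp" for x
    unfolding rpsi stp using O[OF x] .
  have bO: "orbit psi y = orbit psi x" if "y \<in> orbit \<rho> x" "x \<in> Dp" for x y
    using that
  proof induction
    case base then show ?case using rO by simp
  next
    case (step y)
    then have "y \<in> Dp" using orbit_sub[OF p step.prems] by blast
    then show ?case using step rO by simp
  qed
  have hO: "orbit psi x = orbit psi (rep M f x)" if x: "x \<in> Dp" for x
  proof -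
    have "rep M f x \<in> M" using rep_mem[OF M f x] by simp
    then have "rep M f x \<in> orbit \<rho> x" using b x hd(2) by (auto simp: blocks_def rep_def)
    then show ?thesis using bO x by metis
  qed
  have lO: "orbit psi q = orbit psi l" if "reach f l q" "q \<in> M" for q
    using that
  proof induction
    case (step q)
    show ?case
    proof (cases "q = l")
      case False
      then have qM: "q \<in> M - {l}" using step.prems by simp
      have "orbit psi q = orbit psi (opp q)" using O[of q] step.prems hd(2) by auto
      also have "\<dots> = orbit psi (rep M f (opp q))" using hO[of "opp q"] hd(6)[OF qM] by (simp add: Dp_def)
      also have "rep M f (opp q) = f q" using hd(6)[OF qM] by (simp add: rep_def opp_opp)
      finally show ?thesis using step.IH pfD(1)[OF f qM] by simp
    qed simp
  qed simp
  have all: "orbit psi x = orbit psi l" if x: "x \<in> Dp" for x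
    using hO[OF x] lO[of "rep M f x"] rep_mem[OF M f x] pfD(2)[OF f] by simp
  have "one_orbit psi Dp" unfolding one_orbit_def
  proof
    fix x assume x: "x \<in> Dp"
    have "y \<in> orbit psi x" if "y \<in> Dp" for y using all[OF x] all[OF that] self[of y] by simp
    then show "orbit psi x = Dp" using orbit_sub[OF pp x] by blast
  qed
  then show ?thesis using inv blocks_orbits(2)[OF M f p b] by (simp add: trees_def psi_def)
qed

text \<open>From a dart in \<open>M - M'\<close>, the parent function would stay in \<open>M - M'\<close> and never reach the leg.\<close>

lemma blocks_unique_half:
  assumes M: "M \<in> halves" "f \<in> pf M" "blocks \<rho> M f" and M': "M' \<in> halves" "f' \<in> pf M'" "blocks \<rho> M' f'"
  shows "M \<subseteq> M'"
proof
  note hd = halvesD[OF M(1)]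
  have "q \<in> M'" if "reach f l q" "q \<in> M" for q
    using that
  proof induction
    case base
    show ?case using halvesD(1)[OF M'(1)] .
  next
    case (step q)
    show ?case
    proof (rule ccontr)
      assume n: "q \<notin> M'"
      have qM: "q \<in> M - {l}" using n step.prems halvesD(1)[OF M'(1)] by auto
      have fq: "f q \<in> M" using pfD(1)[OF M(2) qM] by simp
      then have fq': "f q \<in> M'" using step.IH by simp
      have oq: "opp q \<in> D - M" using hd(6)[OF qM] .
      have oq': "opp q \<in> M'" using halvesD(7)[OF M'(1), of q] qM hd(2) n by auto
      have "rep M f (f q) = rep M f (opp q)" using fq oq by (simp add: rep_def opp_opp)
      then have "f q \<in> orbit \<rho> (opp q)" using M(3) fq hd(2) oq by (auto simp: blocks_def Dp_def)
      then have "rep M' f' (f q) = rep M' f' (opp q)" using M'(3) oq by (auto simp: blocks_def Dp_def)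
      then show False using fq fq' oq oq' by (simp add: rep_def)
    qed
  qed
  then show "x \<in> M'" if "x \<in> M" for x using that pfD(2)[OF M(2)] by blast
qed

text \<open>Once \<open>M\<close> is known, \<open>f p\<close> is the only dart of \<open>M\<close>
  in the vertex of \<open>opp p\<close>.\<close>

lemma blocks_unique:
  assumes M: "M \<in> halves" "f \<in> pf M" "blocks \<rho> M f" and M': "M' \<in> halves" "f' \<in> pf M'" "blocks \<rho> M' f'"
  shows "M' = M \<and> f' = f"
proof
  show e: "M' = M" using blocks_unique_half[OF M M'] blocks_unique_half[OF M' M] by blast
  show "f' = f"
  proof
    fix p show "f' p = f p"
    proof (cases "p \<in> M - {l}")
      case True
      note hd = halvesD[OF M(1)]
      have fM: "f p \<in> M" "f' p \<in> M" using pfD(1)[OF M(2) True] pfD(1)[OF M'(2), of p] True e by auto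
      have op: "opp p \<in> D - M" using hd(6)[OF True] .
      have "rep M f (f p) = rep M f (opp p)" using fM op by (simp add: rep_def opp_opp)
      then have "f p \<in> orbit \<rho> (opp p)" using M(3) fM hd(2) op by (auto simp: blocks_def Dp_def)
      then have "rep M' f' (f p) = rep M' f' (opp p)" using M'(3) op by (auto simp: blocks_def Dp_def)
      then show ?thesis using fM op e by (simp add: rep_def opp_opp)
    next
      case False
      then show ?thesis using pfD(3)[OF M(2), of p] pfD(3)[OF M'(2), of p] e by simp
    qed
  qed
qed

section \<open>From plane trees to parent functions\<close>

lemma even_card_D: "card D = 2 * (card D div 2)"
proof -
  have "card {M. M \<subseteq> D \<and> {} \<subseteq> M \<and> (\<forall>d\<in>D. opp d \<in> M \<longleftrightarrow> d \<notin> M)} * 2 ^ card ({} :: 'a set) = 2 ^ (card D div 2)"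
    by (rule card_half_sets[OF finD opp]) auto
  \<comment> \<open>The number of such \<open>M\<close> is a power of 2, hence not 0, so one
    exists.\<close>
  then have "{M. M \<subseteq> D \<and> {} \<subseteq> M \<and> (\<forall>d\<in>D. opp d \<in> M \<longleftrightarrow> d \<notin> M)} \<noteq> {}"
    by (metis card.empty mult_0 power_not_zero zero_neq_numeral)
  then obtain M where M: "M \<subseteq> D" "\<And>d. d \<in> D \<Longrightarrow> opp d \<in> M \<longleftrightarrow> d \<notin> M" by blast
  have "D = M \<union> opp ` M"
  proof
    show "D \<subseteq> M \<union> opp ` M"
    proof
      fix x assume "x \<in> D"
      then have "x \<in> M \<or> opp x \<in> M" using M by blast
      then show "x \<in> M \<union> opp ` M" using imageI[of "opp x" M opp] by (auto simp: opp_opp)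
    qed
    show "M \<union> opp ` M \<subseteq> D" using M(1) opp by blast
  qed
  moreover have "M \<inter> opp ` M = {}" using M by blast
  moreover have "card (opp ` M) = card M"
    using permutes_inj[OF opp_perm] by (intro card_image) (auto intro: inj_on_subset)
  ultimately have "card D = card M + card M"
    using card_Un_disjoint[of M "opp ` M"] finite_subset[OF M(1) finD] by simp
  then show ?thesis by simp
qed

text \<open>The parent darts are the last exits, from each vertex, of the tour of the face that ends at the leg.\<close>

lemma tree_blocks:
  assumes r: "\<rho> \<in> trees"
  shows "\<exists>M f. M \<in> halves \<and> f \<in> pf M \<and> blocks \<rho> M f"
proof -
  have inv: "\<rho> \<in> invar c Dp" and p: "\<rho> permutes Dp" and uni: "one_orbit (\<rho> \<circ> opp) Dp"
    and cnt: "card (orbit \<rho> ` Dp) = card D div 2 + 1"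
    using r by (auto simp: trees_def invar_def)
  define psi where "psi = \<rho> \<circ> opp"
  have pp: "psi permutes Dp" unfolding psi_def using opp_perm p by (rule permutes_compose)
  \<comment> \<open>\<open>T x\<close> is the time left on the tour before it arrives at the leg, so
    the last exit \<open>R x\<close> from a vertex is its dart with the least time.\<close>
  define T where "T x = funpow_dist psi x l" for x
  have Tl: "T l = 0" unfolding T_def by (simp add: funpow_dist_0)
  have Ts: "T x = Suc (T (psi x))" if "x \<in> Dp" "x \<noteq> l" for x
  proof -
    have "reach psi l x" using uni one_orbit_iff_reach[OF pp] that by (simp add: psi_def)
    then show ?thesis unfolding T_def using that by (intro reach_dist)
  qed
  note self = perm_self_in_orbit[OF finDp p]
  note eq = perm_orbit_eq[OF finDp p]
  define R where "R x = arg_min_on T (orbit \<rho> x)" for x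
  have fino: "finite (orbit \<rho> x)" if "x \<in> Dp" for x
    using orbit_sub[OF p that] finDp by (rule finite_subset)
  have Rin: "R x \<in> orbit \<rho> x" if "x \<in> Dp" for x
    unfolding R_def using arg_min_if_finite(1)[OF fino[OF that] orbit_nonempty] .
  have Rmin: "T (R x) \<le> T y" if "x \<in> Dp" "y \<in> orbit \<rho> x" for x y
    unfolding R_def using arg_min_least[OF fino[OF that(1)] orbit_nonempty that(2)] .
  have Req: "R x = R y \<longleftrightarrow> orbit \<rho> x = orbit \<rho> y" if "x \<in> Dp" "y \<in> Dp" for x y
    using Rin[OF that(1)] Rin[OF that(2)] eq by (metis R_def)
  have RDp: "R x \<in> Dp" if "x \<in> Dp" for x using Rin[OF that] orbit_sub[OF p that] by blast
  have RR: "R (R x) = R x" if "x \<in> Dp" for x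
    using Req[OF RDp[OF that] that] eq[OF Rin[OF that]] by simp
  define M where "M = R ` Dp"
  have MDp: "M \<subseteq> Dp" using RDp by (auto simp: M_def)
  have RM: "R x = x" if "x \<in> M" for x using that RR by (auto simp: M_def)
  have lM: "l \<in> M"
  proof -
    have "T (R l) = 0" using Rmin[of l l] self[of l] Tl by simp
    then have "R l = l" using Ts[of "R l"] RDp[of l] by fastforce
    then show ?thesis unfolding M_def using l_Dp by (metis imageI)
  qed
  have inD: "q \<in> D" if "q \<in> M - {l}" for q using that MDp by (auto simp: Dp_def)
  \<comment> \<open>After \<open>q\<close> the tour leaves the vertex of \<open>opp q\<close>
    through \<open>psi q\<close>, and the last exit from there is not earlier.\<close>
  have dec: "T (R (opp q)) < T q" if q: "q \<in> M - {l}" for q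
  proof -
    have "\<rho> (opp q) \<in> orbit \<rho> (opp q)" by (rule orbit.base)
    then have "T (R (opp q)) \<le> T (psi q)" using Rmin[of "opp q" "psi q"] opp[OF inD[OF q]] by (simp add: psi_def Dp_def)
    also have "\<dots> < T q" using Ts[of q] q MDp by auto
    finally show ?thesis .
  qed
  have noopp: "opp q \<notin> M" if q: "q \<in> M - {l}" for q
  proof
    assume o: "opp q \<in> M"
    have oD: "opp q \<in> D" using opp[OF inD[OF q]] by simp
    then have "opp q \<noteq> l" using l by auto
    then have "T (R (opp (opp q))) < T (opp q)" using o by (intro dec) simp
    moreover have "T (R (opp q)) < T q" using dec[OF q] .
    ultimately show False using RM[OF o] RM[of q] q by (simp add: opp_opp)
  qed
  have finM: "finite M" using MDp finDp by (rule finite_subset)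
  \<comment> \<open>Here the number of vertices enters: the last exits other than the leg lie on
    distinct edges and are as many as the edges, so every edge contains one.\<close>
  have cM: "card (M - {l}) = card D div 2"
  proof -
    have "card M = card (orbit \<rho> ` Dp)"
    proof -
      have "inj_on (orbit \<rho>) M"
      proof (rule inj_onI)
        fix x y assume "x \<in> M" "y \<in> M" "orbit \<rho> x = orbit \<rho> y"
        then show "x = y" using RM[of x] RM[of y] Req[of x y] MDp by auto
      qed
      moreover have "orbit \<rho> ` M = orbit \<rho> ` Dp"
      proof
        show "orbit \<rho> ` M \<subseteq> orbit \<rho> ` Dp" using MDp by blast
        show "orbit \<rho> ` Dp \<subseteq> orbit \<rho> ` M"
        proof (rule image_subsetI)
          fix x assume x: "x \<in> Dp"
          then have "R x \<in> M" by (simp add: M_def)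
          then show "orbit \<rho> x \<in> orbit \<rho> ` M" using eq[OF Rin[OF x]] by (metis imageI)
        qed
      qed
      ultimately show ?thesis by (metis card_image)
    qed
    then show ?thesis using cnt lM finM by simp
  qed
  have cover: "M - {l} \<union> opp ` (M - {l}) = D"
  proof (rule card_subset_eq[OF finD])
    show "M - {l} \<union> opp ` (M - {l}) \<subseteq> D" using inD opp by blast
    have "card (opp ` (M - {l})) = card (M - {l})"
      using permutes_inj[OF opp_perm] by (intro card_image) (auto intro: inj_on_subset)
    moreover have "(M - {l}) \<inter> opp ` (M - {l}) = {}" using noopp by blast
    ultimately show "card (M - {l} \<union> opp ` (M - {l})) = card D"
      using card_Un_disjoint[of "M - {l}" "opp ` (M - {l})"] finM cM even_card_D by simp
  qed
  have Mh: "M \<in> halves"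
  proof -
    have "opp d \<in> M \<longleftrightarrow> d \<notin> M" if d: "d \<in> D" for d
    proof
      assume "opp d \<in> M"
      moreover have "opp d \<noteq> l" using opp[OF d] l by auto
      ultimately show "d \<notin> M" using noopp[of "opp d"] by (auto simp: opp_opp)
    next
      assume "d \<notin> M"
      then obtain q where "q \<in> M - {l}" "d = opp q" using d cover by blast
      then show "opp d \<in> M" by (simp add: opp_opp)
    qed
    then show ?thesis using lM MDp by (simp add: halves_def)
  qed
  define f where "f = (\<lambda>q\<in>M - {l}. R (opp q))"
  have oDp: "opp q \<in> Dp" if "q \<in> M - {l}" for q using opp[OF inD[OF that]] by (simp add: Dp_def)
  have fM: "f q \<in> M \<and> c (f q) = t q" if q: "q \<in> M - {l}" for q
  proof
    show "f q \<in> M" using oDp[OF q] q by (simp add: f_def M_def)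
    show "c (f q) = t q"
      using invar_const_orbit[OF inv oDp[OF q] Rin[OF oDp[OF q]]] q by (simp add: f_def t_def)
  qed
  have "f \<in> flow M t c l" by (rule flowI) (use fM in \<open>auto simp: f_def\<close>)
  moreover have "reach f l q" if "q \<in> M" for q
    using that
  proof (induction "T q" arbitrary: q rule: less_induct)
    case less
    show ?case
    proof (cases "q = l")
      case False
      then have q: "q \<in> M - {l}" using less.prems by simp
      have "T (f q) < T q" using dec[OF q] q by (simp add: f_def)
      then have "reach f l (f q)" using less.hyps fM[OF q] by blast
      then show ?thesis by (rule reach.step)
    qed (simp add: reach.base)
  qed
  ultimately have fpf: "f \<in> pf M" by (simp add: flow_trees_def)
  have repR: "rep M f x = R x" if x: "x \<in> Dp" for x
  proof (cases "x \<in> M")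
    case False
    then show ?thesis using halvesD(7)[OF Mh x] by (simp add: rep_def f_def opp_opp)
  qed (simp add: rep_def RM)
  have "blocks \<rho> M f" unfolding blocks_def
  proof
    fix x assume x: "x \<in> Dp"
    have "y \<in> orbit \<rho> x \<longleftrightarrow> y \<in> Dp \<and> R y = R x" for y
      using orbit_sub[OF p x] Req[of y x] x eq[of y x] self[of y] by blast
    then show "orbit \<rho> x = {y\<in>Dp. rep M f y = rep M f x}" using repR x by auto
  qed
  then show ?thesis using Mh fpf by blast
qed

text \<open>Each plane tree comes from exactly one orientation and parent function, and each such
  pair from as many trees as there are cyclic orders at the vertices.\<close>

theorem sum_trees_halves:
  "(\<Sum>\<rho>\<in>trees. \<Prod>v\<in>V. fact (card (orbit \<rho> ` cls v)) :: int)
    = (\<Sum>M\<in>halves. (\<Prod>v\<in>V. fact (card {x\<in>M. c x = v})) * (\<Sum>f\<in>pf M. \<Prod>b\<in>M. fact (indeg M l f b)))"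
proof -
  let ?S = "SIGMA M:halves. pf M"
  let ?w = "\<lambda>(M, f). \<Prod>v\<in>V. fact (card {x\<in>M. c x = v}) :: int"
  have finpf: "finite (pf M)" if "M \<in> halves" for M
    unfolding flow_trees_def
    by (rule finite_subset[OF _ finite_flow[OF halvesD(3)[OF that], of t c l]]) blast
  have finS: "finite ?S" using finite_halves finpf by blast
  have fint: "finite trees" unfolding trees_def invar_def
    by (rule finite_subset[OF _ finite_permutations[OF finDp]]) blast
  have "(\<Sum>\<rho>\<in>trees. \<Prod>v\<in>V. fact (card (orbit \<rho> ` cls v)) :: int)
     = (\<Sum>\<rho>\<in>trees. \<Sum>u\<in>?S. if blocks \<rho> (fst u) (snd u) then ?w u else 0)"
  proof (rule sum.cong[OF refl])
    fix \<rho> assume r: "\<rho> \<in> trees"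
    then obtain M f where Mf: "M \<in> halves" "f \<in> pf M" "blocks \<rho> M f" using tree_blocks by blast
    have p: "\<rho> permutes Dp" using r by (simp add: trees_def invar_def)
    have "(\<Sum>u\<in>?S. if blocks \<rho> (fst u) (snd u) then ?w u else 0) = (\<Sum>u\<in>?S. if u = (M, f) then ?w u else 0)"
    proof (rule sum.cong[OF refl])
      fix u assume u: "u \<in> ?S"
      have "blocks \<rho> (fst u) (snd u) \<longleftrightarrow> u = (M, f)"
        using blocks_unique[OF Mf, of "fst u" "snd u"] u Mf(3) by (metis SigmaD1 SigmaD2 fst_conv prod.collapse snd_conv)
      then show "(if blocks \<rho> (fst u) (snd u) then ?w u else 0) = (if u = (M, f) then ?w u else 0)" by simp
    qed
    also have "\<dots> = ?w (M, f)" using finS Mf by (simp add: sum.delta)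
    also have "\<dots> = (\<Prod>v\<in>V. fact (card (orbit \<rho> ` cls v)) :: int)"
      using blocks_orbits(1)[OF Mf(1,2) p Mf(3)] by simp
    finally show "(\<Prod>v\<in>V. fact (card (orbit \<rho> ` cls v)) :: int) = (\<Sum>u\<in>?S. if blocks \<rho> (fst u) (snd u) then ?w u else 0)" by simp
  qed
  also have "\<dots> = (\<Sum>u\<in>?S. \<Sum>\<rho>\<in>trees. if blocks \<rho> (fst u) (snd u) then ?w u else 0)" by (rule sum.swap)
  also have "\<dots> = (\<Sum>u\<in>?S. ?w u * (\<Prod>b\<in>fst u. fact (indeg (fst u) l (snd u) b)))"
  proof (rule sum.cong[OF refl])
    fix u assume "u \<in> ?S"
    then obtain M f where u: "u = (M, f)" "M \<in> halves" "f \<in> pf M" by blast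
    have "{\<rho>\<in>trees. blocks \<rho> M f} = {\<rho>. \<rho> permutes Dp \<and> blocks \<rho> M f}"
      using blocks_tree[OF u(2,3)] by (auto simp: trees_def invar_def)
    then have "card {\<rho>\<in>trees. blocks \<rho> M f} = (\<Prod>b\<in>M. fact (indeg M l f b))"
      using card_blocks_perms[OF u(2,3)] by simp
    then have "int (card {\<rho>\<in>trees. blocks \<rho> M f}) = (\<Prod>b\<in>M. fact (indeg M l f b))" by simp
    moreover have "(\<Sum>\<rho>\<in>trees. if blocks \<rho> M f then ?w u else 0) = ?w u * int (card {\<rho>\<in>trees. blocks \<rho> M f})"
      using fint by (simp add: sum.If_cases Int_def)
    ultimately show "(\<Sum>\<rho>\<in>trees. if blocks \<rho> (fst u) (snd u) then ?w u else 0) = ?w u * (\<Prod>b\<in>fst u. fact (indeg (fst u) l (snd u) b))"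
      using u by simp
  qed
  also have "\<dots> = (\<Sum>M\<in>halves. \<Sum>f\<in>pf M. ?w (M, f) * (\<Prod>b\<in>M. fact (indeg M l f b)))"
    using finite_halves finpf by (subst sum.Sigma) (auto simp: case_prod_beta)
  finally show ?thesis by (simp add: sum_distrib_left)
qed

theorem leg_identity:
  "2 ^ (card D div 2 + 1) * int (card {\<rho>\<in>invar c Dp. one_orbit (\<rho> \<circ> opp) Dp})
    = (\<Sum>\<rho>\<in>trees. \<Prod>v\<in>V. 2 * fact (card (orbit \<rho> ` cls v)))"
  using sum_halves by (simp add: prod.distrib sum_trees_halves flip: sum_distrib_left)

end

section \<open>Unicellular maps and plane trees over a fixed graph\<close>

text \<open>The spliced point joins an existing cycle, so a leg neither creates nor destroys a
  vertex, whether or not it is included in the class that is counted.\<close>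

lemma card_orbits_transpose_insert:
  assumes "finite D" "f permutes D" "l \<notin> D" "d \<in> D" "S \<subseteq> D"
  shows "card (orbit (transpose l d \<circ> f) ` S) = card (orbit f ` S)"
    "d \<in> S \<Longrightarrow> card (orbit (transpose l d \<circ> f) ` insert l S) = card (orbit f ` S)"
proof -
  let ?g = "transpose l d \<circ> f"
  let ?j = "\<lambda>X. if d \<in> X then insert l X else X"
  have "orbit ?g ` S = ?j ` orbit f ` S"
    unfolding image_image
    by (intro image_cong refl) (rule transpose_insert_orbit[OF assms(1-4)], use assms(5) in auto)
  moreover have "inj_on ?j (orbit f ` S)"
  proof (rule inj_on_inverseI[where g = "\<lambda>X. X - {l}"])
    fix X assume "X \<in> orbit f ` S"
    then have "l \<notin> X" using assms orbit_sub[OF assms(2)] by blast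
    then show "?j X - {l} = X" by auto
  qed
  ultimately show 1: "card (orbit ?g ` S) = card (orbit f ` S)" by (simp only: card_image)
  assume d: "d \<in> S"
  have "orbit ?g l = insert l (orbit f d)" by (rule transpose_insert_orbit_new[OF assms(1-4)])
  also have "\<dots> = orbit ?g d"
    using transpose_insert_orbit[OF assms(1-4) assms(4)] perm_self_in_orbit[OF assms(1,2), of d] by simp
  finally have "orbit ?g ` insert l S = orbit ?g ` S" using d by auto
  then show "card (orbit ?g ` insert l S) = card (orbit f ` S)" using 1 by simp
qed

text \<open>As \<open>opp\<close> fixes \<open>l\<close>, splicing \<open>l\<close> before
  \<open>d\<close> in the rotation also splices it before \<open>d\<close> in the face permutation,
  which keeps a single face. A leg of colour \<open>v0\<close> is thus the choice of a dart of that
  colour.\<close>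

lemma bij_betw_add_leg:
  fixes opp :: "'a \<Rightarrow> 'a"
  assumes fin: "finite D" and l: "l \<notin> D" and ne: "D \<noteq> {}" and op: "opp permutes D"
  shows "bij_betw (\<lambda>(d, \<rho>). transpose l d \<circ> \<rho>)
    ({d\<in>D. c d = v0} \<times> {\<rho>\<in>invar c D. one_orbit (\<rho> \<circ> opp) D})
    {\<rho>\<in>invar (c(l := v0)) (insert l D). one_orbit (\<rho> \<circ> opp) (insert l D)}"
  (is "bij_betw ?m (?A \<times> ?B) ?C")
proof -
  have orb: "one_orbit (transpose l d \<circ> \<rho> \<circ> opp) (insert l D) \<longleftrightarrow> one_orbit (\<rho> \<circ> opp) D"
    if "d \<in> D" "\<rho> permutes D" for d \<rho>
    using one_orbit_transpose_insert[OF fin permutes_compose[OF op that(2)] l that(1)] by (simp add: o_assoc)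
  have "inj_on ?m (?A \<times> ?B)"
  proof (rule inj_onI)
    fix u u' assume "u \<in> ?A \<times> ?B" "u' \<in> ?A \<times> ?B" and e: "?m u = ?m u'"
    then obtain d \<rho> d' \<rho>' where u: "u = (d, \<rho>)" "u' = (d', \<rho>')" and p: "\<rho> permutes D" "\<rho>' permutes D"
      by (auto simp: invar_def)
    have e': "transpose l d \<circ> \<rho> = transpose l d' \<circ> \<rho>'" using e u by simp
    have "(transpose l d \<circ> \<rho>) l = d" "(transpose l d' \<circ> \<rho>') l = d'"
      using p l by (simp_all add: permutes_not_in)
    then have d: "d = d'" using e' by metis
    then have "transpose l d \<circ> (transpose l d \<circ> \<rho>) = transpose l d \<circ> (transpose l d \<circ> \<rho>')" using e' by simp
    then have "\<rho> = \<rho>'" by (simp add: o_assoc)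
    then show "u = u'" using d u by simp
  qed
  moreover have "?m ` (?A \<times> ?B) = ?C"
  proof
    show "?m ` (?A \<times> ?B) \<subseteq> ?C"
    proof (rule image_subsetI)
      fix u assume "u \<in> ?A \<times> ?B"
      then obtain d \<rho> where u: "u = (d, \<rho>)" and d: "d \<in> D" "c d = v0" and r: "\<rho> \<in> invar c D" "one_orbit (\<rho> \<circ> opp) D"
        by auto
      have p: "\<rho> permutes D" using r by (simp add: invar_def)
      let ?r = "transpose l d \<circ> \<rho>"
      have rp: "?r permutes insert l D"
        using p d by (intro permutes_compose permutes_imp_permutes_insert permutes_swap_id) auto
      have "(c(l := v0)) (?r x) = (c(l := v0)) x" if x: "x \<in> insert l D" for x
      proof (cases "x = l")
        case True
        then have "?r x = d" using p l by (simp add: permutes_not_in)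
        then show ?thesis using True d l by auto
      next
        case False
        then have xD: "x \<in> D" using x by simp
        have cx: "c (\<rho> x) = c x" using r xD by (simp add: invar_def)
        have rx: "\<rho> x \<in> D" using permutes_in_image[OF p] xD by simp
        show ?thesis
        proof (cases "\<rho> x = d")
          case True then show ?thesis using False cx d by simp
        next
          case False
          have "\<rho> x \<noteq> l" using rx l by auto
          then have "?r x = \<rho> x" using False by (simp add: transpose_def)
          then show ?thesis using cx \<open>\<rho> x \<noteq> l\<close> \<open>x \<noteq> l\<close> by simp
        qed
      qed
      then have "?r \<in> invar (c(l := v0)) (insert l D)" using rp unfolding invar_def by blast
      then show "?m u \<in> ?C" using orb[OF d(1) p] r u by simp
    qed
    show "?C \<subseteq> ?m ` (?A \<times> ?B)"
    proof
      fix g assume g: "g \<in> ?C"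
      then have gi: "g permutes insert l D" "\<And>x. x \<in> insert l D \<Longrightarrow> (c(l := v0)) (g x) = (c(l := v0)) x"
        and go: "one_orbit (g \<circ> opp) (insert l D)" unfolding invar_def by blast+
      from gi(1) have "g \<in> {p. p permutes insert l D}" by simp
      then obtain d \<rho> where df: "d \<in> insert l D" "\<rho> permutes D" "g = transpose l d \<circ> \<rho>"
        unfolding permutes_insert by auto
      have gl: "g l = d" using df l by (simp add: permutes_not_in)
      \<comment> \<open>With \<open>d = l\<close> the leg would be a vertex and a face by
        itself.\<close>
      have "d \<noteq> l"
      proof
        assume "d = l"
        then have "(g \<circ> opp) l = l" using gl op l by (simp add: permutes_not_in)
        then have "orbit (g \<circ> opp) l = {l}" by (simp add: orbit_eq_singleton_iff)
        then show False using go ne l by (auto simp: one_orbit_def)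
      qed
      then have d: "d \<in> D" using df by auto
      have cd: "c d = v0" using gi(2)[of l] gl \<open>d \<noteq> l\<close> by simp
      have "c (\<rho> x) = c x" if x: "x \<in> D" for x
      proof -
        have xl: "x \<noteq> l" "\<rho> x \<noteq> l" using x l permutes_in_image[OF df(2), of x] by auto
        show ?thesis
        proof (cases "\<rho> x = d")
          case True
          then have "g x = l" using df(3) by simp
          then show ?thesis using gi(2)[of x] x xl True cd by simp
        next
          case False
          then have "g x = \<rho> x" using df(3) xl by (simp add: transpose_def)
          then show ?thesis using gi(2)[of x] x xl by simp
        qed
      qed
      then have "\<rho> \<in> ?B" using df(2) orb[OF d df(2)] go df(3) by (simp add: invar_def)
      then have "(d, \<rho>) \<in> ?A \<times> ?B" using d cd by simp
      then show "g \<in> ?m ` (?A \<times> ?B)" using df(3) by (intro image_eqI[of _ _ "(d, \<rho>)"]) simp_all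
    qed
  qed
  ultimately show ?thesis by (simp add: bij_betw_def)
qed

definition tree_rotations :: "'a set \<Rightarrow> ('a \<Rightarrow> 'a) \<Rightarrow> ('a \<Rightarrow> 'a) set" where
  "tree_rotations D \<alpha> = {\<rho>. \<rho> permutes D \<and> one_orbit (\<rho> \<circ> \<alpha>) D \<and> card (orbit \<rho> ` D) = card D div 2 + 1}"

text \<open>The leg is attached in the colour of some dart. On both sides this multiplies the count
  by the number of darts of that colour and leaves the number of vertices over each colour as it
  was, so the factor cancels.\<close>

theorem unicellular_tree_identity:
  fixes c :: "'a \<Rightarrow> 'b" and opp :: "'a \<Rightarrow> 'a"
  assumes fin: "finite D" and ne: "D \<noteq> {}" and l: "l \<notin> D" and op: "opp permutes D"
    and inv: "\<And>x. x \<in> D \<Longrightarrow> opp x \<noteq> x \<and> opp (opp x) = x"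
  shows "2 ^ (card D div 2 + 1) * int (card {\<rho>\<in>invar c D. one_orbit (\<rho> \<circ> opp) D})
    = (\<Sum>\<rho>\<in>invar c D \<inter> tree_rotations D opp. \<Prod>v\<in>c ` D. 2 * fact (card (orbit \<rho> ` {x\<in>D. c x = v})))"
proof -
  obtain d0 where d0: "d0 \<in> D" using ne by auto
  define v0 where "v0 = c d0"
  define cp where "cp = c(l := v0)"
  have cpD: "cp x = c x" if "x \<in> D" for x using that l by (auto simp: cp_def)
  have cpl: "cp l = v0" by (simp add: cp_def)
  have cpim: "cp ` D = c ` D" using cpD by (auto simp: image_def)
  interpret leg_map D opp l cp
    by unfold_locales (use fin ne l op inv d0 permutes_in_image[OF op] permutes_not_in[OF op] cpim in \<open>auto simp: cp_def v0_def\<close>)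
  let ?A = "{d\<in>D. c d = v0}" and ?B = "{\<rho>\<in>invar c D. one_orbit (\<rho> \<circ> opp) D}"
  let ?C = "{\<rho>\<in>invar cp Dp. one_orbit (\<rho> \<circ> opp) Dp}"
  let ?m = "\<lambda>(d, \<rho>). transpose l d \<circ> \<rho>"
  have bij: "bij_betw ?m (?A \<times> ?B) ?C"
    unfolding cp_def Dp_def using bij_betw_add_leg[OF fin l ne op] .
  have cA: "card ?A > 0" using fin d0 by (subst card_gt_0_iff) (auto simp: v0_def)
  have finB: "finite ?B" using finite_permutations[OF fin] by (auto simp: invar_def)
  have c1: "card ?C = card ?A * card ?B"
    using bij_betw_same_card[OF bij] by (simp add: card_cartesian_product)
  have cnt: "card (orbit (?m u) ` Dp) = card (orbit (snd u) ` D)"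
     "card (orbit (?m u) ` cls v) = card (orbit (snd u) ` {x\<in>D. c x = v})" if u: "u \<in> ?A \<times> ?B" for u v
  proof -
    obtain d \<rho> where u': "u = (d, \<rho>)" "d \<in> D" "c d = v0" "\<rho> permutes D" using u by (auto simp: invar_def)
    note ins = card_orbits_transpose_insert[OF fin u'(4) l u'(2)]
    show "card (orbit (?m u) ` Dp) = card (orbit (snd u) ` D)"
      using ins(2)[of D] u' by (simp add: Dp_def)
    show "card (orbit (?m u) ` cls v) = card (orbit (snd u) ` {x\<in>D. c x = v})"
    proof (cases "v = v0")
      case True
      then have "cls v = insert l {x\<in>D. c x = v}" using l cpD cpl by (auto simp: cls_def Dp_def)
      then show ?thesis using ins(2)[of "{x\<in>D. c x = v}"] u' True by simp
    next
      case False
      then have "cls v = {x\<in>D. c x = v}" using l cpD cpl by (auto simp: cls_def Dp_def)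
      then show ?thesis using ins(1)[of "{x\<in>D. c x = v}"] u' by simp
    qed
  qed
  let ?w = "\<lambda>\<rho>. \<Prod>v\<in>V. 2 * fact (card (orbit \<rho> ` cls v)) :: int"
  let ?w' = "\<lambda>\<rho>. \<Prod>v\<in>c ` D. 2 * fact (card (orbit \<rho> ` {x\<in>D. c x = v})) :: int"
  have V: "V = c ` D" using cpim by (simp add: V_def)
  have finC: "finite ?C" using finite_permutations[OF finDp] by (auto simp: invar_def)
  have "(\<Sum>\<rho>\<in>trees. ?w \<rho>) = (\<Sum>\<rho>\<in>?C. if card (orbit \<rho> ` Dp) = card D div 2 + 1 then ?w \<rho> else 0)"
    using finC by (simp add: trees_def sum.If_cases Int_def conj_ac)
  also have "\<dots> = (\<Sum>u\<in>?A \<times> ?B. if card (orbit (?m u) ` Dp) = card D div 2 + 1 then ?w (?m u) else 0)"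
    by (rule sum.reindex_bij_betw[OF bij, symmetric])
  also have "\<dots> = (\<Sum>u\<in>?A \<times> ?B. if card (orbit (snd u) ` D) = card D div 2 + 1 then ?w' (snd u) else 0)"
    by (intro sum.cong refl) (simp only: cnt V)
  also have "\<dots> = (\<Sum>d\<in>?A. \<Sum>\<rho>\<in>?B. if card (orbit \<rho> ` D) = card D div 2 + 1 then ?w' \<rho> else 0)"
    unfolding sum.cartesian_product by (intro sum.cong refl) (simp only: case_prod_unfold)
  also have "\<dots> = int (card ?A) * (\<Sum>\<rho>\<in>?B. if card (orbit \<rho> ` D) = card D div 2 + 1 then ?w' \<rho> else 0)"
    by simp
  also have "(\<Sum>\<rho>\<in>?B. if card (orbit \<rho> ` D) = card D div 2 + 1 then ?w' \<rho> else 0) = (\<Sum>\<rho>\<in>invar c D \<inter> tree_rotations D opp. ?w' \<rho>)"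
  proof -
    have "invar c D \<inter> tree_rotations D opp = {\<rho>\<in>?B. card (orbit \<rho> ` D) = card D div 2 + 1}"
      by (auto simp: tree_rotations_def invar_def)
    then show ?thesis using finB by (simp add: sum.If_cases Int_def)
  qed
  finally have "int (card ?A) * (2 ^ (card D div 2 + 1) * int (card ?B)) = int (card ?A) * (\<Sum>\<rho>\<in>invar c D \<inter> tree_rotations D opp. ?w' \<rho>)"
    using leg_identity c1 by (simp add: algebra_simps)
  then show ?thesis using cA by simp
qed

section \<open>Permutations with odd cycles\<close>

definition odd_perms :: "'a set \<Rightarrow> ('a \<Rightarrow> 'a) set" where
  "odd_perms S = {f. f permutes S \<and> (\<forall>x\<in>S. odd (card (orbit f x)))}"

lemma finite_odd_perms: "finite S \<Longrightarrow> finite (odd_perms S)"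
  unfolding odd_perms_def by (rule finite_subset[OF _ finite_permutations]) auto

text \<open>The number of C-permutations of \<open>S\<close>, with one binary sign per
  cycle.\<close>

definition odd_sum :: "'a set \<Rightarrow> nat" where
  "odd_sum S = (\<Sum>f\<in>odd_perms S. 2 ^ card (orbit f ` S))"

lemma odd_sum_alt:
  "finite S \<Longrightarrow> odd_sum S = (\<Sum>f\<in>{f. f permutes S}. if \<forall>x\<in>S. odd (card (orbit f x)) then 2 ^ card (orbit f ` S) else 0)"
  unfolding odd_sum_def odd_perms_def using finite_permutations[of S]
  by (simp add: sum.If_cases Int_def)

text \<open>Removing \<open>b\<close> from its cycle of even length leaves a permutation of
  \<open>S\<close> with odd cycles and as many cycles as before; conversely, \<open>b\<close> can be
  spliced before each of the \<open>card S\<close> points.\<close>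

lemma odd_sum_even_cycle:
  assumes fin: "finite S" and b: "b \<notin> S"
  shows "(\<Sum>f\<in>{f. f permutes insert b S}. if even (card (orbit f b)) \<and> (\<forall>x\<in>insert b S. b \<notin> orbit f x \<longrightarrow> odd (card (orbit f x)))
            then 2 ^ card (orbit f ` insert b S) else 0) = card S * odd_sum S"
    (is "(\<Sum>f\<in>_. ?F f) = _")
proof -
  have "(\<Sum>f\<in>{f. f permutes insert b S}. ?F f) = (\<Sum>d\<in>insert b S. \<Sum>q\<in>{q. q permutes S}. ?F (transpose b d \<circ> q))"
    by (rule sum_over_permutations_insert[OF fin b])
  also have "\<dots> = (\<Sum>q\<in>{q. q permutes S}. ?F (transpose b b \<circ> q)) + (\<Sum>d\<in>S. \<Sum>q\<in>{q. q permutes S}. ?F (transpose b d \<circ> q))"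
    using fin b by simp
  also have "(\<Sum>q\<in>{q. q permutes S}. ?F (transpose b b \<circ> q)) = 0"
  proof (rule sum.neutral, rule ballI)
    fix q assume "q \<in> {q. q permutes S}"
    then have "q b = b" using b by (simp add: permutes_not_in)
    then have "orbit q b = {b}" by (simp add: orbit_eq_singleton_iff)
    then show "?F (transpose b b \<circ> q) = 0" by simp
  qed
  also have "(\<Sum>d\<in>S. \<Sum>q\<in>{q. q permutes S}. ?F (transpose b d \<circ> q)) = (\<Sum>d\<in>S. odd_sum S)"
    unfolding odd_sum_alt[OF fin]
  proof (intro sum.cong refl)
    fix d q assume d: "d \<in> S" and "q \<in> {q. q permutes S}"
    then have q: "q permutes S" by simp
    let ?g = "transpose b d \<circ> q"
    note ins = transpose_insert_orbit[OF fin q b d]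
    note new = transpose_insert_orbit_new[OF fin q b d]
    have fo: "finite (orbit q x)" "b \<notin> orbit q x" if "x \<in> S" for x
      using orbit_sub[OF q that] fin b by (auto intro: finite_subset)
    have 1: "even (card (orbit ?g b)) \<longleftrightarrow> odd (card (orbit q d))"
      unfolding new using fo[OF d] by simp
    have bg: "b \<in> orbit ?g b" unfolding new by simp
    have 2: "(\<forall>x\<in>insert b S. b \<notin> orbit ?g x \<longrightarrow> odd (card (orbit ?g x))) \<longleftrightarrow> (\<forall>x\<in>S. d \<notin> orbit q x \<longrightarrow> odd (card (orbit q x)))"
      using bg ins fo(2) by auto
    have 3: "odd (card (orbit q d)) \<and> (\<forall>x\<in>S. d \<notin> orbit q x \<longrightarrow> odd (card (orbit q x))) \<longleftrightarrow> (\<forall>x\<in>S. odd (card (orbit q x)))"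
      using perm_orbit_eq[OF fin q] d by metis
    have 4: "card (orbit ?g ` insert b S) = card (orbit q ` S)"
      using card_orbits_transpose_insert(2)[OF fin q b d order_refl d] .
    show "?F ?g = (if \<forall>x\<in>S. odd (card (orbit q x)) then 2 ^ card (orbit q ` S) else 0)"
      unfolding 1 2 3 4 ..
  qed
  finally show ?thesis by simp
qed

text \<open>
  Either \<open>a\<close> is a fixed point, or removing \<open>a\<close> and its successor \<open>b\<close> leaves a permutation with odd cycles.
\<close>

lemma odd_sum_insert:
  assumes fin: "finite S" and a: "a \<notin> S"
  shows "odd_sum (insert a S) = 2 * odd_sum S + (\<Sum>b\<in>S. card (S - {b}) * odd_sum (S - {b}))"
proof -
  let ?F = "\<lambda>f. if \<forall>x\<in>insert a S. odd (card (orbit f x)) then 2 ^ card (orbit f ` insert a S) else 0 :: nat"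
  have "odd_sum (insert a S) = (\<Sum>f\<in>{f. f permutes insert a S}. ?F f)"
    using fin by (simp only: odd_sum_alt finite_insert)
  also have "\<dots> = (\<Sum>d\<in>insert a S. \<Sum>q\<in>{q. q permutes S}. ?F (transpose a d \<circ> q))"
    by (rule sum_over_permutations_insert[OF fin a])
  also have "\<dots> = (\<Sum>q\<in>{q. q permutes S}. ?F (transpose a a \<circ> q)) + (\<Sum>d\<in>S. \<Sum>q\<in>{q. q permutes S}. ?F (transpose a d \<circ> q))"
    using fin a by simp
  also have "(\<Sum>q\<in>{q. q permutes S}. ?F (transpose a a \<circ> q)) = 2 * odd_sum S"
    unfolding odd_sum_alt[OF fin] sum_distrib_left
  proof (rule sum.cong[OF refl])
    fix q assume "q \<in> {q. q permutes S}"
    then have q: "q permutes S" by simp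
    then have "q a = a" using a by (simp add: permutes_not_in)
    then have oa: "orbit q a = {a}" by (simp add: orbit_eq_singleton_iff)
    have "{a} \<notin> orbit q ` S" using orbit_sub[OF q] a by blast
    then have "card (orbit q ` insert a S) = Suc (card (orbit q ` S))" using oa fin by simp
    then show "?F (transpose a a \<circ> q) = 2 * (if \<forall>x\<in>S. odd (card (orbit q x)) then 2 ^ card (orbit q ` S) else 0)"
      using oa by simp
  qed
  also have "(\<Sum>d\<in>S. \<Sum>q\<in>{q. q permutes S}. ?F (transpose a d \<circ> q)) = (\<Sum>b\<in>S. card (S - {b}) * odd_sum (S - {b}))"
  proof (rule sum.cong[OF refl])
    fix b assume b: "b \<in> S"
    then have S: "S = insert b (S - {b})" by auto
    have "(\<Sum>q\<in>{q. q permutes S}. ?F (transpose a b \<circ> q))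
      = (\<Sum>f\<in>{f. f permutes S}. if even (card (orbit f b)) \<and> (\<forall>x\<in>S. b \<notin> orbit f x \<longrightarrow> odd (card (orbit f x)))
            then 2 ^ card (orbit f ` S) else 0)"
    proof (rule sum.cong[OF refl])
      fix q assume "q \<in> {q. q permutes S}"
      then have q: "q permutes S" by simp
      let ?g = "transpose a b \<circ> q"
      note ins = transpose_insert_orbit[OF fin q a b]
      note new = transpose_insert_orbit_new[OF fin q a b]
      have fo: "finite (orbit q x)" "a \<notin> orbit q x" if "x \<in> S" for x
        using orbit_sub[OF q that] fin a by (auto intro: finite_subset)
      have ca: "card (orbit ?g a) = Suc (card (orbit q b))" unfolding new using fo[OF b] by simp
      have cx: "card (orbit ?g x) = (if b \<in> orbit q x then Suc (card (orbit q b)) else card (orbit q x))" if "x \<in> S" for x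
        using ins[OF that] fo[OF that] perm_orbit_eq[OF fin q, of b x] by auto
      have "(\<forall>x\<in>insert a S. odd (card (orbit ?g x))) \<longleftrightarrow> even (card (orbit q b)) \<and> (\<forall>x\<in>S. b \<notin> orbit q x \<longrightarrow> odd (card (orbit q x)))"
        using ca cx by auto
      moreover have "card (orbit ?g ` insert a S) = card (orbit q ` S)"
        using card_orbits_transpose_insert(2)[OF fin q a b order_refl b] .
      ultimately show "?F ?g = (if even (card (orbit q b)) \<and> (\<forall>x\<in>S. b \<notin> orbit q x \<longrightarrow> odd (card (orbit q x)))
            then 2 ^ card (orbit q ` S) else 0)" by (simp only:)
    qed
    also have "\<dots> = card (S - {b}) * odd_sum (S - {b})"
      using odd_sum_even_cycle[of "S - {b}" b, unfolded insert_Diff[OF b]] fin by simp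
    finally show "(\<Sum>q\<in>{q. q permutes S}. ?F (transpose a b \<circ> q)) = card (S - {b}) * odd_sum (S - {b})" .
  qed
  finally show ?thesis .
qed

lemma odd_sum_eq:
  assumes "finite S"
  shows "odd_sum S = (if S = {} then 1 else 2 * fact (card S))"
  using assms
proof (induction "card S" arbitrary: S rule: less_induct)
  case less
  show ?case
  proof (cases "S = {}")
    case True
    have "odd_perms ({} :: 'a set) = {id}" by (auto simp: odd_perms_def)
    then show ?thesis using True by (simp add: odd_sum_def)
  next
    case False
    then obtain a where a: "a \<in> S" by auto
    define T where "T = S - {a}"
    have S: "S = insert a T" "a \<notin> T" "finite T" "card S = Suc (card T)"
      using a less.prems card_Suc_Diff1[OF less.prems a] by (auto simp: T_def)
    have T: "odd_sum T = (if T = {} then 1 else 2 * fact (card T))" using less.hyps[of T] S by simp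
    \<comment> \<open>If \<open>T\<close> is a singleton, the exceptional value 1 at the empty set
      is multiplied by 0.\<close>
    have "card (T - {b}) * odd_sum (T - {b}) = (card T - 1) * (2 * fact (card T - 1))" if b: "b \<in> T" for b
    proof (cases "T - {b} = {}")
      case True
      then have "card (T - {b}) = 0" by (metis card.empty)
      then show ?thesis using b S by simp
    next
      case False
      then have "odd_sum (T - {b}) = 2 * fact (card (T - {b}))"
        using less.hyps[of "T - {b}"] S b by (simp add: card_Diff1_le less_Suc_eq_le)
      then show ?thesis using b S by simp
    qed
    then have "odd_sum S = 2 * odd_sum T + card T * ((card T - 1) * (2 * fact (card T - 1)))"
      unfolding S(1) odd_sum_insert[OF S(3,2)] by (simp only: sum.cong[OF refl] sum_constant of_nat_id)
    \<comment> \<open>With \<open>k = card T > 0\<close> the recursion reads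
      \<open>4 * k! + 2 * (k - 1) * k! = 2 * (k + 1)!\<close>.\<close>
    also have "\<dots> = 2 * fact (card S)"
    proof (cases "card T")
      case 0
      then show ?thesis using T S by simp
    next
      case (Suc k)
      then have "T \<noteq> {}" by auto
      then have T': "odd_sum T = 2 * fact (card T)" using T by simp
      show ?thesis unfolding T' S(4) Suc by (simp add: algebra_simps)
    qed
    finally show ?thesis using False by simp
  qed
qed

section \<open>Sums over permutations with odd cycles by their number of cycles\<close>

lemma odd_perms_orbit_cong:
  assumes bij: "bij_betw h A B" and fin: "finite A"
  shows "(\<Sum>f\<in>odd_perms A. g (card (orbit f ` A))) = (\<Sum>f\<in>odd_perms B. g (card (orbit f ` B)) :: 'c::comm_monoid_add)"
proof -
  let ?m = "\<lambda>\<pi> x. if x \<in> B then h (\<pi> (inv_into A h x)) else x"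
  have b: "bij_betw ?m {\<pi>. \<pi> permutes A} {\<pi>. \<pi> permutes B}" by (rule bij_betw_permutations[OF bij])
  have orb: "orbit (?m f) (h a) = h ` orbit f a" if f: "f permutes A" and a: "a \<in> A" for f a
  proof (rule orbit_inverse[symmetric])
    show "a \<in> orbit f a" using perm_self_in_orbit[OF fin f] .
    fix x assume "x \<in> orbit f a"
    then have x: "x \<in> A" using orbit_sub[OF f a] by blast
    then have "inv_into A h (h x) = x" "h x \<in> B" using bij by (auto simp: bij_betw_def)
    then show "?m f (h x) = h (f x)" by simp
  qed
  have hinj: "inj_on h A" and hB: "B = h ` A" using bij by (auto simp: bij_betw_def)
  have c1: "card (orbit (?m f) (h a)) = card (orbit f a)" if f: "f permutes A" and a: "a \<in> A" for f a
    unfolding orb[OF that] using inj_on_subset[OF hinj orbit_sub[OF that]] by (rule card_image)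
  have c2: "card (orbit (?m f) ` B) = card (orbit f ` A)" if f: "f permutes A" for f
  proof -
    have "orbit (?m f) ` B = (image h) ` (orbit f ` A)"
      unfolding hB image_image using orb[OF f] by (simp add: hB)
    moreover have "inj_on (image h) (orbit f ` A)"
      by (rule inj_on_subset[OF inj_on_image_Pow[OF hinj]]) (use orbit_sub[OF f] in blast)
    ultimately show ?thesis by (simp add: card_image)
  qed
  have odd: "?m f \<in> odd_perms B \<longleftrightarrow> f \<in> odd_perms A" if f: "f permutes A" for f
  proof -
    have "?m f permutes B" using b f by (auto simp: bij_betw_def)
    then show ?thesis using f c1[OF f] hB by (auto simp: odd_perms_def)
  qed
  have "bij_betw ?m {\<pi>\<in>{\<pi>. \<pi> permutes A}. \<pi> \<in> odd_perms A} {\<pi>\<in>{\<pi>. \<pi> permutes B}. \<pi> \<in> odd_perms B}"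
    by (rule bij_betw_Collect[OF b]) (use odd in simp)
  moreover have "{\<pi>\<in>{\<pi>. \<pi> permutes S}. \<pi> \<in> odd_perms S} = odd_perms S" for S :: "'z set" by (auto simp: odd_perms_def)
  moreover have "{\<pi>\<in>{\<pi>. \<pi> permutes S}. \<pi> \<in> odd_perms S} = odd_perms S" for S :: "'y set" by (auto simp: odd_perms_def)
  ultimately have b': "bij_betw ?m (odd_perms A) (odd_perms B)" by (auto simp: odd_perms_def)
  have "(\<Sum>f\<in>odd_perms B. g (card (orbit f ` B))) = (\<Sum>f\<in>odd_perms A. g (card (orbit (?m f) ` B)))"
    by (rule sum.reindex_bij_betw[OF b', symmetric])
  also have "\<dots> = (\<Sum>f\<in>odd_perms A. g (card (orbit f ` A)))"
    by (intro sum.cong refl) (use c2 in \<open>auto simp: odd_perms_def\<close>)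
  finally show ?thesis by simp
qed

text \<open>With \<open>g j = 2 ^ j\<close> this counts all C-permutations of \<open>k\<close>
  elements; with \<open>g\<close> supported at a single \<open>j\<close> it counts those with
  \<open>j\<close> cycles, that is, of one genus.\<close>

definition osum :: "(nat \<Rightarrow> 'c::comm_semiring_1) \<Rightarrow> nat \<Rightarrow> 'c" where
  "osum g k = (\<Sum>f\<in>odd_perms {..<k}. g (card (orbit f ` {..<k})))"

lemma osum_set:
  assumes "finite S"
  shows "(\<Sum>f\<in>odd_perms S. g (card (orbit f ` S))) = osum g (card S)"
proof -
  obtain h where "bij_betw h S {..<card S}"
    using ex_bij_betw_finite_nat[OF assms] by (auto simp: atLeast0LessThan)
  then show ?thesis unfolding osum_def using assms by (rule odd_perms_orbit_cong)
qed

lemma osum_pow2: "k > 0 \<Longrightarrow> osum (\<lambda>j. 2 ^ j) k = (2 * fact k :: nat)"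
  using odd_sum_eq[of "{..<k}"] by (auto simp: osum_def odd_sum_def lessThan_empty_iff)

text \<open>The cycles of a colour-preserving \<kappa> stay inside the colour classes, so their
  parities and their number can be treated class by class.\<close>

lemma sum_invar_odd_perms:
  fixes g :: "'b \<Rightarrow> nat \<Rightarrow> 'c::comm_semiring_1"
  assumes "finite K" "finite V" "col ` K \<subseteq> V"
  shows "(\<Sum>\<kappa>\<in>invar col K \<inter> odd_perms K. \<Prod>v\<in>V. g v (card (orbit \<kappa> ` {x\<in>K. col x = v})))
    = (\<Prod>v\<in>V. osum (g v) (card {x\<in>K. col x = v}))"
proof -
  let ?K = "\<lambda>v. {x\<in>K. col x = v}"
  let ?G = "\<lambda>v f. if f \<in> odd_perms (?K v) then g v (card (orbit f ` ?K v)) else 0"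
  have finI: "finite (invar col K)" unfolding invar_def
    by (rule finite_subset[OF _ finite_permutations[OF assms(1)]]) blast
  have odd: "\<kappa> \<in> odd_perms K \<longleftrightarrow> (\<forall>v\<in>V. perm_restrict \<kappa> (?K v) \<in> odd_perms (?K v))" if k: "\<kappa> \<in> invar col K" for \<kappa>
  proof -
    have "perm_restrict \<kappa> (?K v) permutes ?K v" if "v \<in> V" for v
      using bij_betwE[OF bij_betw_invar[OF assms(1,3)]] k that by fastforce
    then have "(\<forall>v\<in>V. perm_restrict \<kappa> (?K v) \<in> odd_perms (?K v)) \<longleftrightarrow> (\<forall>v\<in>V. \<forall>x\<in>?K v. odd (card (orbit \<kappa> x)))"
      using orbit_perm_restrict[OF k] by (auto simp: odd_perms_def)
    also have "\<dots> \<longleftrightarrow> (\<forall>x\<in>K. odd (card (orbit \<kappa> x)))" using assms(3) by auto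
    finally show ?thesis using k by (simp add: odd_perms_def invar_def)
  qed
  have "(\<Sum>\<kappa>\<in>invar col K \<inter> odd_perms K. \<Prod>v\<in>V. g v (card (orbit \<kappa> ` ?K v)))
    = (\<Sum>\<kappa>\<in>invar col K. if \<kappa> \<in> odd_perms K then \<Prod>v\<in>V. g v (card (orbit \<kappa> ` ?K v)) else 0)"
    using finI by (simp add: sum.inter_restrict)
  also have "\<dots> = (\<Sum>\<kappa>\<in>invar col K. \<Prod>v\<in>V. ?G v (perm_restrict \<kappa> (?K v)))"
  proof (rule sum.cong[OF refl])
    fix \<kappa> assume k: "\<kappa> \<in> invar col K"
    have "orbit (perm_restrict \<kappa> (?K v)) ` ?K v = orbit \<kappa> ` ?K v" for v
      using orbit_perm_restrict[OF k] by (intro image_cong) auto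
    then show "(if \<kappa> \<in> odd_perms K then \<Prod>v\<in>V. g v (card (orbit \<kappa> ` ?K v)) else 0) = (\<Prod>v\<in>V. ?G v (perm_restrict \<kappa> (?K v)))"
      using odd[OF k] assms(2) by (auto intro!: prod_zero)
  qed
  also have "\<dots> = (\<Prod>v\<in>V. \<Sum>f\<in>{f. f permutes ?K v}. ?G v f)"
    by (rule sum_invar_prod[OF assms])
  also have "\<dots> = (\<Prod>v\<in>V. osum (g v) (card (?K v)))"
  proof (rule prod.cong[OF refl])
    fix v
    have "(\<Sum>f\<in>{f. f permutes ?K v}. ?G v f) = (\<Sum>f\<in>odd_perms (?K v). g v (card (orbit f ` ?K v)))"
      using finite_permutations[of "?K v"] assms(1)
      by (intro sum.mono_neutral_cong_right) (auto simp: odd_perms_def)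
    also have "\<dots> = osum (g v) (card (?K v))" using assms(1) by (intro osum_set) simp
    finally show "(\<Sum>f\<in>{f. f permutes ?K v}. ?G v f) = osum (g v) (card (?K v))" .
  qed
  finally show ?thesis .
qed

section \<open>Inversion over set partitions\<close>

definition const_on_blocks :: "('a \<Rightarrow> 'b) \<Rightarrow> 'a set set \<Rightarrow> bool" where
  "const_on_blocks c Pt \<longleftrightarrow> (\<forall>B\<in>Pt. \<forall>x\<in>B. \<forall>y\<in>B. c x = c y)"

lemma const_on_blocksD: "const_on_blocks c Pt \<Longrightarrow> B \<in> Pt \<Longrightarrow> x \<in> B \<Longrightarrow> y \<in> B \<Longrightarrow> c x = c y"
  unfolding const_on_blocks_def by blast

text \<open>If each point is coloured by its block of \<open>Pt\<close>, the partitions with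
  monochromatic blocks are exactly the refinements of \<open>Pt\<close>. The sums over all
  refinements agree, and the terms of the proper refinements agree by induction.\<close>

lemma partition_inversion:
  fixes u w :: "'a set set \<Rightarrow> nat"
  assumes fin: "finite D"
    and eq: "\<And>c :: 'a \<Rightarrow> 'a set. (\<Sum>Pt\<in>{Pt. partition_on D Pt \<and> const_on_blocks c Pt}. u Pt)
                = (\<Sum>Pt\<in>{Pt. partition_on D Pt \<and> const_on_blocks c Pt}. w Pt)"
    and "partition_on D Pt"
  shows "u Pt = w Pt"
  using assms(3)
proof (induction "card {Pt'. refines D Pt' Pt}" arbitrary: Pt rule: less_induct)
  case less
  note P = less.prems
  let ?R = "\<lambda>Pt. {Pt'. refines D Pt' Pt}"
  have finR: "finite (?R Pt)" for Pt
    by (rule finite_subset[OF _ finitely_many_partition_on[OF fin]]) (auto simp: refines_def)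
  define c where "c x = (THE B. B \<in> Pt \<and> x \<in> B)" for x
  have c: "c x = B" if "B \<in> Pt" "x \<in> B" for x B
    unfolding c_def using that partition_onD2[OF P] by (intro the_equality) (auto dest: disjointD)
  have "{Pt'. partition_on D Pt' \<and> const_on_blocks c Pt'} = ?R Pt"
  proof (intro Collect_cong iffI)
    fix Pt' assume a: "partition_on D Pt' \<and> const_on_blocks c Pt'"
    have "\<exists>Y\<in>Pt. X \<subseteq> Y" if X: "X \<in> Pt'" for X
    proof -
      obtain x where x: "x \<in> X" using a X partition_onD3[of D Pt'] by (metis all_not_in_conv)
      have D: "y \<in> D" if "y \<in> X" for y using a X that partition_onD1[of D Pt'] by blast
      have "y \<in> c x" if y: "y \<in> X" for y
      proof -
        obtain B where B: "B \<in> Pt" "y \<in> B" using D[OF y] partition_onD1[OF P] by blast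
        have "c x = c y" using const_on_blocksD[of c Pt' X x y] a X x y by simp
        then show ?thesis using c[OF B] B by simp
      qed
      moreover obtain B where "B \<in> Pt" "x \<in> B" using D[OF x] partition_onD1[OF P] by blast
      ultimately show ?thesis using c by blast
    qed
    then show "refines D Pt' Pt" using a P by (simp add: refines_def)
  next
    fix Pt' assume a: "refines D Pt' Pt"
    have "const_on_blocks c Pt'" unfolding const_on_blocks_def
    proof (intro ballI)
      fix X x y assume "X \<in> Pt'" "x \<in> X" "y \<in> X"
      moreover then obtain Y where "Y \<in> Pt" "X \<subseteq> Y" using a by (auto simp: refines_def)
      ultimately have "c x = Y" "c y = Y" using c by blast+
      then show "c x = c y" by simp
    qed
    then show "partition_on D Pt' \<and> const_on_blocks c Pt'" using a by (simp add: refines_def)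
  qed
  then have sums: "(\<Sum>Pt'\<in>?R Pt. u Pt') = (\<Sum>Pt'\<in>?R Pt. w Pt')" using eq[of c] by simp
  have self: "Pt \<in> ?R Pt" using P by (simp add: refines_refl)
  have "u Pt' = w Pt'" if "Pt' \<in> ?R Pt - {Pt}" for Pt'
  proof (rule less.hyps)
    have r: "refines D Pt' Pt" "Pt' \<noteq> Pt" using that by auto
    have "?R Pt' \<subseteq> ?R Pt" using refines_trans r(1) by blast
    moreover have "Pt \<notin> ?R Pt'" using refines_asym r by blast
    ultimately have "?R Pt' \<subset> ?R Pt" using self by blast
    then show "card (?R Pt') < card (?R Pt)" using finR by (rule psubset_card_mono[rotated])
    show "partition_on D Pt'" using r by (simp add: refines_def)
  qed
  then have "(\<Sum>Pt'\<in>?R Pt - {Pt}. u Pt') = (\<Sum>Pt'\<in>?R Pt - {Pt}. w Pt')" by simp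
  then show ?case using sums sum.remove[OF finR self, of u] sum.remove[OF finR self, of w] by simp
qed

lemma sum_fibres_Collect:
  fixes F :: "'p \<Rightarrow> nat"
  assumes "finite X" "finite Q" "\<And>x. x \<in> X \<Longrightarrow> q x \<in> Q"
  shows "(\<Sum>p\<in>{p\<in>Q. P p}. \<Sum>x\<in>{x\<in>X. q x = p}. F p) = (\<Sum>x\<in>{x\<in>X. P (q x)}. F (q x))"
proof -
  have "(\<Sum>x\<in>{x\<in>X. P (q x)}. F (q x)) = (\<Sum>p\<in>{p\<in>Q. P p}. \<Sum>x\<in>{x\<in>{x\<in>X. P (q x)}. q x = p}. F (q x))"
    using assms by (intro sum.group[symmetric]) auto
  also have "\<dots> = (\<Sum>p\<in>{p\<in>Q. P p}. \<Sum>x\<in>{x\<in>X. q x = p}. F p)"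
    by (intro sum.cong refl) auto
  finally show ?thesis by simp
qed

text \<open>The partition obtained by gluing the vertices in each cycle of a permutation \<open>\<kappa>\<close> of the vertex set \<open>K\<close>.\<close>

definition merge :: "('a set \<Rightarrow> 'a set) \<Rightarrow> 'a set set \<Rightarrow> 'a set set" where
  "merge \<kappa> K = Union ` orbit \<kappa> ` K"

text \<open>Distinct cycles have disjoint nonempty unions, so there are as many glued blocks as
  cycles.\<close>

lemma merge_partition:
  assumes fin: "finite D" and K: "partition_on D K" and k: "\<kappa> permutes K"
  shows "partition_on D (merge \<kappa> K)" "inj_on Union (orbit \<kappa> ` K)"
proof -
  have finK: "finite K" using finite_elements[OF fin K] .
  have disj: "A = B" if "A \<in> K" "B \<in> K" "x \<in> A" "x \<in> B" for A B x
    using partition_onD2[OF K] that by (auto dest: disjointD)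
  have key: "X = Y" if X: "X \<in> orbit \<kappa> ` K" and Y: "Y \<in> orbit \<kappa> ` K" and x: "x \<in> \<Union>X" "x \<in> \<Union>Y" for X Y x
  proof -
    obtain a b where ab: "a \<in> K" "X = orbit \<kappa> a" "b \<in> K" "Y = orbit \<kappa> b" using X Y by blast
    obtain A B where AB: "A \<in> X" "x \<in> A" "B \<in> Y" "x \<in> B" using x by blast
    have "A \<in> K" "B \<in> K" using AB ab orbit_sub[OF k] by blast+
    then have "A = B" using disj AB by blast
    then show ?thesis using AB ab perm_orbit_eq[OF finK k] by metis
  qed
  have ne: "\<exists>x. x \<in> \<Union>X" if X: "X \<in> orbit \<kappa> ` K" for X
  proof -
    obtain a where a: "a \<in> K" "X = orbit \<kappa> a" using X by blast
    then have "a \<in> X" using perm_self_in_orbit[OF finK k] by simp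
    moreover have "a \<noteq> {}" using partition_onD3[OF K] a by blast
    ultimately show ?thesis by blast
  qed
  show "inj_on Union (orbit \<kappa> ` K)"
  proof (rule inj_onI)
    fix X Y assume "X \<in> orbit \<kappa> ` K" "Y \<in> orbit \<kappa> ` K" "\<Union>X = \<Union>Y"
    then show "X = Y" using ne[of X] key[of X Y] by metis
  qed
  show "partition_on D (merge \<kappa> K)"
  proof (rule partition_onI)
    have "\<Union>(merge \<kappa> K) = \<Union>(\<Union>(orbit \<kappa> ` K))" by (auto simp: merge_def)
    also have "\<Union>(orbit \<kappa> ` K) = K" using orbit_sub[OF k] perm_self_in_orbit[OF finK k] by blast
    also have "\<Union>K = D" using partition_onD1[OF K] by simp
    finally show "\<Union>(merge \<kappa> K) = D" .
    show "disjnt p q" if pq: "p \<in> merge \<kappa> K" "q \<in> merge \<kappa> K" "p \<noteq> q" for p q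
    proof -
      obtain X Y where XY: "X \<in> orbit \<kappa> ` K" "Y \<in> orbit \<kappa> ` K" "p = \<Union>X" "q = \<Union>Y"
        using pq(1,2) unfolding merge_def by blast
      show ?thesis unfolding disjnt_iff using key[OF XY(1,2)] XY pq(3) by metis
    qed
    show "{} \<notin> merge \<kappa> K"
    proof
      assume "{} \<in> merge \<kappa> K"
      then obtain X where "X \<in> orbit \<kappa> ` K" "{} = \<Union>X" by (auto simp: merge_def)
      then show False using ne[of X] by auto
    qed
  qed
qed

text \<open>The colouring is constant on the glued blocks iff it is constant on the vertices of
  \<rho> and \<kappa> preserves the colours of vertices. The glued blocks of colour \<open>v\<close>
  are then the cycles of \<kappa> on the vertices of colour \<open>v\<close>.\<close>

lemma sum_merge:
  fixes g :: "'b \<Rightarrow> nat \<Rightarrow> nat" and c :: "'a \<Rightarrow> 'b"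
  assumes fin: "finite D" and p: "\<rho> permutes D"
  defines "K \<equiv> orbit \<rho> ` D"
  shows "(\<Sum>\<kappa>\<in>{\<kappa>\<in>odd_perms K. const_on_blocks c (merge \<kappa> K)}. \<Prod>v\<in>c ` D. g v (card {B\<in>merge \<kappa> K. c ` B = {v}}))
    = (if \<rho> \<in> invar c D then \<Prod>v\<in>c ` D. osum (g v) (card (orbit \<rho> ` {x\<in>D. c x = v})) else 0)"
proof -
  have K: "partition_on D K" unfolding K_def by (rule orbit_partition[OF fin p])
  have finK: "finite K" using fin by (simp add: K_def)
  have KD: "A \<subseteq> D" if "A \<in> K" for A using partition_onD1[OF K] that by blast
  have Kne: "A \<noteq> {}" if "A \<in> K" for A using partition_onD3[OF K] that by blast
  define col where "col A = c (SOME x. x \<in> A)" for A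
  have some: "(SOME x. x \<in> A) \<in> A" if "A \<in> K" for A using Kne[OF that] by (simp add: some_in_eq)
  show ?thesis
  proof (cases "\<rho> \<in> invar c D")
    case False
    have "\<not> const_on_blocks c (merge \<kappa> K)" if k: "\<kappa> \<in> odd_perms K" for \<kappa>
    proof
      assume cb: "const_on_blocks c (merge \<kappa> K)"
      have kp: "\<kappa> permutes K" using k by (simp add: odd_perms_def)
      have "\<rho> \<in> invar c D"
      proof (rule invar_iff_orbit[OF fin p, THEN iffD2], intro ballI)
        fix x y assume x: "x \<in> D" and y: "y \<in> orbit \<rho> x"
        have "orbit \<rho> x \<in> orbit \<kappa> (orbit \<rho> x)" by (rule perm_self_in_orbit[OF finK kp])
        then have "x \<in> \<Union>(orbit \<kappa> (orbit \<rho> x))" "y \<in> \<Union>(orbit \<kappa> (orbit \<rho> x))"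
          using perm_self_in_orbit[OF fin p, of x] y by blast+
        moreover have "\<Union>(orbit \<kappa> (orbit \<rho> x)) \<in> merge \<kappa> K" using x by (simp add: merge_def K_def)
        ultimately show "c y = c x" using cb unfolding const_on_blocks_def by blast
      qed
      then show False using False by simp
    qed
    then have "{\<kappa>\<in>odd_perms K. const_on_blocks c (merge \<kappa> K)} = {}" by blast
    then show ?thesis using False by (simp only: sum.empty if_False)
  next
    case True
    have colx: "c x = col A" if A: "A \<in> K" "x \<in> A" for A x
    proof -
      obtain z where z: "z \<in> D" "A = orbit \<rho> z" using A unfolding K_def by blast
      then have "c x = c z" "c (SOME x. x \<in> A) = c z"
        using invar_const_orbit[OF True z(1)] A some[OF A(1)] by auto
      then show ?thesis by (simp add: col_def)
    qed
    have colK: "col ` K \<subseteq> c ` D"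
    proof (rule image_subsetI)
      fix A assume A: "A \<in> K"
      then have "(SOME x. x \<in> A) \<in> D" using some[OF A] KD[OF A] by blast
      then show "col A \<in> c ` D" by (simp add: col_def)
    qed
    have Kv: "{A\<in>K. col A = v} = orbit \<rho> ` {x\<in>D. c x = v}" for v
    proof
      show "{A\<in>K. col A = v} \<subseteq> orbit \<rho> ` {x\<in>D. c x = v}"
      proof
        fix A assume A: "A \<in> {A\<in>K. col A = v}"
        then obtain z where z: "z \<in> D" "A = orbit \<rho> z" by (auto simp: K_def)
        then have "c z = v" using colx[of A z] A perm_self_in_orbit[OF fin p, of z] by simp
        then show "A \<in> orbit \<rho> ` {x\<in>D. c x = v}" using z by blast
      qed
      show "orbit \<rho> ` {x\<in>D. c x = v} \<subseteq> {A\<in>K. col A = v}"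
      proof (rule image_subsetI)
        fix x assume x: "x \<in> {x\<in>D. c x = v}"
        then have "orbit \<rho> x \<in> K" by (simp add: K_def)
        then show "orbit \<rho> x \<in> {A\<in>K. col A = v}"
          using colx[of "orbit \<rho> x" x] x perm_self_in_orbit[OF fin p, of x] by simp
      qed
    qed
    have cb: "const_on_blocks c (merge \<kappa> K) \<longleftrightarrow> \<kappa> \<in> invar col K" if kp: "\<kappa> permutes K" for \<kappa>
    proof
      assume cb: "const_on_blocks c (merge \<kappa> K)"
      show "\<kappa> \<in> invar col K"
      proof (rule invar_iff_orbit[OF finK kp, THEN iffD2], intro ballI)
        fix A B assume A: "A \<in> K" and B: "B \<in> orbit \<kappa> A"
        have BK: "B \<in> K" using orbit_sub[OF kp A] B by blast
        have "A \<in> orbit \<kappa> A" by (rule perm_self_in_orbit[OF finK kp])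
        then have "(SOME x. x \<in> A) \<in> \<Union>(orbit \<kappa> A)" "(SOME x. x \<in> B) \<in> \<Union>(orbit \<kappa> A)"
          using some[OF A] some[OF BK] B by blast+
        moreover have "\<Union>(orbit \<kappa> A) \<in> merge \<kappa> K" using A by (simp add: merge_def)
        ultimately show "col B = col A" using cb unfolding const_on_blocks_def col_def by blast
      qed
    next
      assume i: "\<kappa> \<in> invar col K"
      show "const_on_blocks c (merge \<kappa> K)" unfolding const_on_blocks_def
      proof (intro ballI)
        fix B x y assume "B \<in> merge \<kappa> K" "x \<in> B" "y \<in> B"
        then obtain A X Y where A: "A \<in> K" "X \<in> orbit \<kappa> A" "x \<in> X" "Y \<in> orbit \<kappa> A" "y \<in> Y"
          by (auto simp: merge_def)
        then have "X \<in> K" "Y \<in> K" using orbit_sub[OF kp A(1)] by blast+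
        then show "c x = c y" using colx A invar_const_orbit[OF i A(1)] by metis
      qed
    qed
    have cnt: "card {B\<in>merge \<kappa> K. c ` B = {v}} = card (orbit \<kappa> ` {A\<in>K. col A = v})"
      if i: "\<kappa> \<in> invar col K" for \<kappa> v
    proof -
      have kp: "\<kappa> permutes K" using i by (simp add: invar_def)
      have im: "c ` \<Union>(orbit \<kappa> A) = {col A}" if A: "A \<in> K" for A
      proof
        show "c ` \<Union>(orbit \<kappa> A) \<subseteq> {col A}"
        proof (rule image_subsetI)
          fix x assume "x \<in> \<Union>(orbit \<kappa> A)"
          then obtain X where X: "X \<in> orbit \<kappa> A" "x \<in> X" by blast
          then have "X \<in> K" using orbit_sub[OF kp A] by blast
          then show "c x \<in> {col A}" using colx X invar_const_orbit[OF i A] by simp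
        qed
        have "A \<in> orbit \<kappa> A" by (rule perm_self_in_orbit[OF finK kp])
        then have "(SOME x. x \<in> A) \<in> \<Union>(orbit \<kappa> A)" using some[OF A] by blast
        from imageI[OF this, of c] show "{col A} \<subseteq> c ` \<Union>(orbit \<kappa> A)" using colx[OF A some[OF A]] by simp
      qed
      have "{B\<in>merge \<kappa> K. c ` B = {v}} = Union ` orbit \<kappa> ` {A\<in>K. col A = v}"
        unfolding merge_def using im by auto
      moreover have "inj_on Union (orbit \<kappa> ` {A\<in>K. col A = v})"
        by (rule inj_on_subset[OF merge_partition(2)[OF fin K kp]]) blast
      ultimately show ?thesis by (simp add: card_image)
    qed
    have "{\<kappa>\<in>odd_perms K. const_on_blocks c (merge \<kappa> K)} = invar col K \<inter> odd_perms K"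
      using cb by (auto simp: odd_perms_def)
    then have "(\<Sum>\<kappa>\<in>{\<kappa>\<in>odd_perms K. const_on_blocks c (merge \<kappa> K)}. \<Prod>v\<in>c ` D. g v (card {B\<in>merge \<kappa> K. c ` B = {v}}))
      = (\<Sum>\<kappa>\<in>invar col K \<inter> odd_perms K. \<Prod>v\<in>c ` D. g v (card (orbit \<kappa> ` {A\<in>K. col A = v})))"
      by (simp add: cnt)
    also have "\<dots> = (\<Prod>v\<in>c ` D. osum (g v) (card {A\<in>K. col A = v}))"
      using fin finK colK by (intro sum_invar_odd_perms) auto
    finally show ?thesis using True Kv by simp
  qed
qed

lemma card_partition_colors:
  assumes fin: "finite D" and P: "partition_on D Pt" and cb: "const_on_blocks c Pt"
  shows "card Pt = (\<Sum>v\<in>c ` D. card {B\<in>Pt. c ` B = {v}})"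
proof -
  have finP: "finite Pt" using finite_elements[OF fin P] .
  have "Pt = (\<Union>v\<in>c ` D. {B\<in>Pt. c ` B = {v}})"
  proof
    show "Pt \<subseteq> (\<Union>v\<in>c ` D. {B\<in>Pt. c ` B = {v}})"
    proof
      fix B assume B: "B \<in> Pt"
      then obtain x where x: "x \<in> B" using partition_onD3[OF P] by (metis all_not_in_conv)
      have "c y = c x" if "y \<in> B" for y using const_on_blocksD[OF cb B that x] .
      then have "c ` B = {c x}" using x by blast
      moreover have "x \<in> D" using partition_onD1[OF P] B x by blast
      ultimately show "B \<in> (\<Union>v\<in>c ` D. {B\<in>Pt. c ` B = {v}})" using B by blast
    qed
  qed blast
  then have "card Pt = card (\<Union>v\<in>c ` D. {B\<in>Pt. c ` B = {v}})" by simp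
  also have "\<dots> = (\<Sum>v\<in>c ` D. card {B\<in>Pt. c ` B = {v}})"
    using fin finP by (intro card_UN_disjoint) auto
  finally show ?thesis .
qed

text \<open>
  Both sides become \<open>unicellular_tree_identity\<close> when summed over all partitions that refine a given
  one, because there are \<open>2 * k!\<close> C-permutations of \<open>k > 0\<close> elements; hence they agree for each partition
  of the darts into vertices.
\<close>

theorem unicellular_tree_refined:
  fixes c :: "'a \<Rightarrow> 'b" and m :: "'b \<Rightarrow> nat" and opp :: "'a \<Rightarrow> 'a"
  assumes fin: "finite D" and ne: "D \<noteq> {}" and l: "l \<notin> D" and op: "opp permutes D"
    and inv: "\<And>x. x \<in> D \<Longrightarrow> opp x \<noteq> x \<and> opp (opp x) = x"
  shows "2 ^ (card D div 2 + 1) * card {\<rho>\<in>invar c D. one_orbit (\<rho> \<circ> opp) D \<and> (\<forall>v\<in>c ` D. card (orbit \<rho> ` {x\<in>D. c x = v}) = m v)}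
    = (\<Sum>\<rho>\<in>invar c D \<inter> tree_rotations D opp.
         \<Prod>v\<in>c ` D. osum (\<lambda>j. if j = m v then 2 ^ j else 0) (card (orbit \<rho> ` {x\<in>D. c x = v})))"
proof -
  let ?N = "2 ^ (card D div 2 + 1) :: nat"
  let ?Q = "{Pt. partition_on D Pt}"
  let ?X = "{\<rho>. \<rho> permutes D \<and> one_orbit (\<rho> \<circ> opp) D}"
  let ?T = "tree_rotations D opp"
  let ?Y = "SIGMA \<rho>:?T. odd_perms (orbit \<rho> ` D)"
  let ?q1 = "\<lambda>\<rho>. orbit \<rho> ` D"
  let ?q2 = "\<lambda>(\<rho>, \<kappa>). merge \<kappa> (orbit \<rho> ` D)"
  have finQ: "finite ?Q" by (rule finitely_many_partition_on[OF fin])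
  have finX: "finite ?X" by (rule finite_subset[OF _ finite_permutations[OF fin]]) blast
  have Tp: "\<rho> permutes D" if "\<rho> \<in> ?T" for \<rho> using that by (simp add: tree_rotations_def)
  have finT: "finite ?T" by (rule finite_subset[OF _ finite_permutations[OF fin]]) (use Tp in blast)
  have finY: "finite ?Y" using finT finite_odd_perms fin by blast
  have q1: "?q1 \<rho> \<in> ?Q" if "\<rho> \<in> ?X" for \<rho> using orbit_partition[OF fin] that by blast
  have q2: "?q2 y \<in> ?Q" if yY: "y \<in> ?Y" for y
  proof -
    obtain \<rho> \<kappa> where y: "y = (\<rho>, \<kappa>)" "\<rho> permutes D" "\<kappa> permutes orbit \<rho> ` D"
      using yY Tp unfolding odd_perms_def by blast
    then show ?thesis using merge_partition(1)[OF fin orbit_partition[OF fin y(2)] y(3)] by simp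
  qed
  \<comment> \<open>Both sides as functions of the partition of the darts into vertices:
    \<open>u\<close> from the unicellular rotations, \<open>w\<close> from trees whose vertices are
    glued along cycles, with one sign per resulting block.\<close>
  define u where "u Pt = (\<Sum>\<rho>\<in>{\<rho>\<in>?X. ?q1 \<rho> = Pt}. ?N)" for Pt
  define w where "w Pt = (\<Sum>y\<in>{y\<in>?Y. ?q2 y = Pt}. 2 ^ card Pt :: nat)" for Pt
  have cb1: "const_on_blocks c (?q1 \<rho>) \<longleftrightarrow> \<rho> \<in> invar c D" if "\<rho> permutes D" for \<rho> and c :: "'a \<Rightarrow> 'z"
  proof
    assume "const_on_blocks c (?q1 \<rho>)"
    then have "c y = c x" if "x \<in> D" "y \<in> orbit \<rho> x" for x y
      using that perm_self_in_orbit[OF fin \<open>\<rho> permutes D\<close>, of x] unfolding const_on_blocks_def by blast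
    then show "\<rho> \<in> invar c D" using invar_iff_orbit[OF fin \<open>\<rho> permutes D\<close>] by blast
  next
    assume i: "\<rho> \<in> invar c D"
    show "const_on_blocks c (?q1 \<rho>)" unfolding const_on_blocks_def
    proof (intro ballI)
      fix B x y assume "B \<in> orbit \<rho> ` D" and xy: "x \<in> B" "y \<in> B"
      then obtain z where z: "z \<in> D" "B = orbit \<rho> z" by blast
      then show "c x = c y" using invar_const_orbit[OF i z(1)] xy by simp
    qed
  qed
  have usum: "(\<Sum>Pt\<in>{Pt\<in>?Q. R Pt}. u Pt) = ?N * card {\<rho>\<in>?X. R (?q1 \<rho>)}" for R
    unfolding u_def using sum_fibres_Collect[OF finX finQ q1, where F = "\<lambda>_. ?N"] by simp
  have wsum: "(\<Sum>Pt\<in>{Pt\<in>?Q. const_on_blocks c Pt \<and> R Pt}. w Pt)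
      = (\<Sum>\<rho>\<in>?T. \<Sum>\<kappa>\<in>{\<kappa>\<in>odd_perms (orbit \<rho> ` D). const_on_blocks c (merge \<kappa> (orbit \<rho> ` D))}.
           if R (merge \<kappa> (orbit \<rho> ` D)) then \<Prod>v\<in>c ` D. 2 ^ card {B\<in>merge \<kappa> (orbit \<rho> ` D). c ` B = {v}} else 0)"
    for c :: "'a \<Rightarrow> 'z" and R
  proof -
    let ?P = "\<lambda>Pt. const_on_blocks c Pt \<and> R Pt"
    have "(\<Sum>Pt\<in>{Pt\<in>?Q. ?P Pt}. w Pt) = (\<Sum>y\<in>{y\<in>?Y. ?P (?q2 y)}. 2 ^ card (?q2 y))"
      unfolding w_def using sum_fibres_Collect[OF finY finQ q2, where F = "\<lambda>Pt. 2 ^ card Pt" and P = ?P] by simp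
    also have "\<dots> = (\<Sum>y\<in>?Y. if ?P (?q2 y) then 2 ^ card (?q2 y) else 0)"
      using finY by (simp add: sum.inter_filter)
    also have "\<dots> = (\<Sum>\<rho>\<in>?T. \<Sum>\<kappa>\<in>odd_perms (orbit \<rho> ` D). if ?P (merge \<kappa> (orbit \<rho> ` D)) then 2 ^ card (merge \<kappa> (orbit \<rho> ` D)) else 0)"
      using finT finite_odd_perms fin by (subst sum.Sigma) (auto intro!: sum.cong)
    also have "\<dots> = (\<Sum>\<rho>\<in>?T. \<Sum>\<kappa>\<in>{\<kappa>\<in>odd_perms (orbit \<rho> ` D). const_on_blocks c (merge \<kappa> (orbit \<rho> ` D))}.
           if R (merge \<kappa> (orbit \<rho> ` D)) then \<Prod>v\<in>c ` D. 2 ^ card {B\<in>merge \<kappa> (orbit \<rho> ` D). c ` B = {v}} else 0)"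
    proof (rule sum.cong[OF refl])
      fix \<rho> assume r: "\<rho> \<in> ?T"
      let ?K = "orbit \<rho> ` D"
      have card: "2 ^ card (merge \<kappa> ?K) = (\<Prod>v\<in>c ` D. 2 ^ card {B\<in>merge \<kappa> ?K. c ` B = {v}} :: nat)"
        if "\<kappa> \<in> odd_perms ?K" "const_on_blocks c (merge \<kappa> ?K)" for \<kappa>
      proof -
        have "partition_on D (merge \<kappa> ?K)" using q2[of "(\<rho>, \<kappa>)"] r that by simp
        then show ?thesis using card_partition_colors[OF fin _ that(2)] by (simp add: power_sum)
      qed
      have "(\<Sum>\<kappa>\<in>odd_perms ?K. if ?P (merge \<kappa> ?K) then 2 ^ card (merge \<kappa> ?K) else 0)
        = (\<Sum>\<kappa>\<in>odd_perms ?K. if const_on_blocks c (merge \<kappa> ?K) then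
             (if R (merge \<kappa> ?K) then \<Prod>v\<in>c ` D. 2 ^ card {B\<in>merge \<kappa> ?K. c ` B = {v}} else 0) else 0 :: nat)"
        using card by (intro sum.cong refl) auto
      also have "\<dots> = (\<Sum>\<kappa>\<in>{\<kappa>\<in>odd_perms ?K. const_on_blocks c (merge \<kappa> ?K)}.
           if R (merge \<kappa> ?K) then \<Prod>v\<in>c ` D. 2 ^ card {B\<in>merge \<kappa> ?K. c ` B = {v}} else 0)"
        by (rule sum.inter_filter[symmetric]) (use fin finite_odd_perms in blast)
      finally show "(\<Sum>\<kappa>\<in>odd_perms ?K. if ?P (merge \<kappa> ?K) then 2 ^ card (merge \<kappa> ?K) else 0 :: nat)
        = (\<Sum>\<kappa>\<in>{\<kappa>\<in>odd_perms ?K. const_on_blocks c (merge \<kappa> ?K)}.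
           if R (merge \<kappa> ?K) then \<Prod>v\<in>c ` D. 2 ^ card {B\<in>merge \<kappa> ?K. c ` B = {v}} else 0)" .
    qed
    finally show ?thesis .
  qed
  have Tinv: "(\<Sum>\<rho>\<in>?T. if \<rho> \<in> invar c D then H \<rho> else 0) = (\<Sum>\<rho>\<in>invar c D \<inter> ?T. H \<rho>)"
    for c :: "'a \<Rightarrow> 'z" and H :: "('a \<Rightarrow> 'a) \<Rightarrow> nat"
    unfolding Int_commute[of "invar c D"] using finT by (rule sum.inter_restrict[symmetric])
  have uw: "u Pt = w Pt" if "partition_on D Pt" for Pt
  proof (rule partition_inversion[OF fin _ that])
    fix c :: "'a \<Rightarrow> 'a set"
    \<comment> \<open>The extra condition of \<open>wsum\<close> is taken to be \<open>True\<close>: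
      the numbers of cycles are left open, so every C-permutation counts and each colour contributes
      \<open>2 * fact\<close>.\<close>
    have "(\<Sum>Pt\<in>{Pt\<in>?Q. const_on_blocks c Pt \<and> True}. w Pt)
      = (\<Sum>\<rho>\<in>?T. if \<rho> \<in> invar c D then \<Prod>v\<in>c ` D. osum (\<lambda>j. 2 ^ j) (card (orbit \<rho> ` {x\<in>D. c x = v})) else 0)"
      unfolding wsum using sum_merge[OF fin Tp, where g = "\<lambda>v j. 2 ^ j" and c = c] by (intro sum.cong refl) simp
    also have "\<dots> = (\<Sum>\<rho>\<in>invar c D \<inter> ?T. \<Prod>v\<in>c ` D. 2 * fact (card (orbit \<rho> ` {x\<in>D. c x = v})))"
      unfolding Tinv
    proof (intro sum.cong refl prod.cong)
      fix \<rho> v assume v: "v \<in> c ` D"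
      have "card (orbit \<rho> ` {x\<in>D. c x = v}) > 0"
        using fin v by (subst card_gt_0_iff) auto
      then show "osum (\<lambda>j. 2 ^ j) (card (orbit \<rho> ` {x\<in>D. c x = v})) = (2 * fact (card (orbit \<rho> ` {x\<in>D. c x = v})) :: nat)"
        by (rule osum_pow2)
    qed
    finally have wc: "int (\<Sum>Pt\<in>{Pt\<in>?Q. const_on_blocks c Pt \<and> True}. w Pt)
      = (\<Sum>\<rho>\<in>invar c D \<inter> ?T. \<Prod>v\<in>c ` D. 2 * fact (card (orbit \<rho> ` {x\<in>D. c x = v})))" by simp
    have "{\<rho>\<in>?X. const_on_blocks c (?q1 \<rho>)} = {\<rho>\<in>invar c D. one_orbit (\<rho> \<circ> opp) D}"
      using cb1 by (auto simp: invar_def)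
    then have uc: "int (\<Sum>Pt\<in>{Pt\<in>?Q. const_on_blocks c Pt}. u Pt) = int ?N * int (card {\<rho>\<in>invar c D. one_orbit (\<rho> \<circ> opp) D})"
      unfolding usum by simp
    have "int (\<Sum>Pt\<in>{Pt\<in>?Q. const_on_blocks c Pt}. u Pt) = int (\<Sum>Pt\<in>{Pt\<in>?Q. const_on_blocks c Pt \<and> True}. w Pt)"
      unfolding uc wc using unicellular_tree_identity[OF fin ne l op inv, of c] by simp
    then show "(\<Sum>Pt\<in>{Pt. partition_on D Pt \<and> const_on_blocks c Pt}. u Pt) = (\<Sum>Pt\<in>{Pt. partition_on D Pt \<and> const_on_blocks c Pt}. w Pt)"
      by (simp only: of_nat_eq_iff simp_thms mem_Collect_eq)
  qed
  \<comment> \<open>The equality, known partition by partition, is now summed over the partitions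
    with the prescribed numbers \<open>m v\<close> of vertices of each colour.\<close>
  let ?R = "\<lambda>Pt. \<forall>v\<in>c ` D. card {B\<in>Pt. c ` B = {v}} = m v"
  have "{\<rho>\<in>invar c D. one_orbit (\<rho> \<circ> opp) D \<and> (\<forall>v\<in>c ` D. card (orbit \<rho> ` {x\<in>D. c x = v}) = m v)}
     = {\<rho>\<in>?X. const_on_blocks c (?q1 \<rho>) \<and> ?R (?q1 \<rho>)}"
  proof -
    have "{B\<in>orbit \<rho> ` D. c ` B = {v}} = orbit \<rho> ` {x\<in>D. c x = v}" if i: "\<rho> \<in> invar c D" for \<rho> v
    proof -
      have p: "\<rho> permutes D" using i by (simp add: invar_def)
      have cx: "c ` orbit \<rho> x = {c x}" if "x \<in> D" for x
      proof -
        have "c y = c x" if "y \<in> orbit \<rho> x" for y using invar_const_orbit[OF i \<open>x \<in> D\<close> that] .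
        then show ?thesis using perm_self_in_orbit[OF fin p, of x] by blast
      qed
      have "{B\<in>orbit \<rho> ` D. c ` B = {v}} = orbit \<rho> ` {x\<in>D. c ` orbit \<rho> x = {v}}" by blast
      also have "{x\<in>D. c ` orbit \<rho> x = {v}} = {x\<in>D. c x = v}" by (rule Collect_cong) (simp add: cx cong: conj_cong)
      finally show ?thesis .
    qed
    moreover have "\<rho> \<in> invar c D \<longleftrightarrow> \<rho> permutes D \<and> const_on_blocks c (?q1 \<rho>)" for \<rho>
      using cb1[of \<rho> c] by (auto simp: invar_def)
    ultimately show ?thesis by (auto cong: conj_cong)
  qed
  then have "?N * card {\<rho>\<in>invar c D. one_orbit (\<rho> \<circ> opp) D \<and> (\<forall>v\<in>c ` D. card (orbit \<rho> ` {x\<in>D. c x = v}) = m v)}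
    = (\<Sum>Pt\<in>{Pt\<in>?Q. const_on_blocks c Pt \<and> ?R Pt}. u Pt)"
    unfolding usum by simp
  also have "\<dots> = (\<Sum>Pt\<in>{Pt\<in>?Q. const_on_blocks c Pt \<and> ?R Pt}. w Pt)"
    using uw by (intro sum.cong) auto
  also have "\<dots> = (\<Sum>\<rho>\<in>?T. if \<rho> \<in> invar c D then \<Prod>v\<in>c ` D. osum (\<lambda>j. if j = m v then 2 ^ j else 0) (card (orbit \<rho> ` {x\<in>D. c x = v})) else 0)"
    unfolding wsum
  proof (rule sum.cong[OF refl])
    fix \<rho> assume r: "\<rho> \<in> ?T"
    have eqP: "(if ?R Pt then \<Prod>v\<in>c ` D. 2 ^ card {B\<in>Pt. c ` B = {v}} else 0)
      = (\<Prod>v\<in>c ` D. if card {B\<in>Pt. c ` B = {v}} = m v then 2 ^ card {B\<in>Pt. c ` B = {v}} else 0 :: nat)" for Pt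
      using fin by (auto intro!: prod_zero prod.cong)
    show "(\<Sum>\<kappa>\<in>{\<kappa>\<in>odd_perms (orbit \<rho> ` D). const_on_blocks c (merge \<kappa> (orbit \<rho> ` D))}.
           if ?R (merge \<kappa> (orbit \<rho> ` D)) then \<Prod>v\<in>c ` D. 2 ^ card {B\<in>merge \<kappa> (orbit \<rho> ` D). c ` B = {v}} else 0)
      = (if \<rho> \<in> invar c D then \<Prod>v\<in>c ` D. osum (\<lambda>j. if j = m v then 2 ^ j else 0 :: nat) (card (orbit \<rho> ` {x\<in>D. c x = v})) else 0)"
      unfolding eqP by (rule sum_merge[OF fin Tp[OF r], where g = "\<lambda>v j. if j = m v then 2 ^ j else 0" and c = c])
  qed
  finally show ?thesis unfolding Tinv .
qed

section \<open>Coefficients of the operator\<close>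

lemma prod_single:
  "finite A \<Longrightarrow> (\<Prod>x\<in>A. Poly_Mapping.single (t x) (a x)) = Poly_Mapping.single (\<Sum>x\<in>A. t x :: monomial) (\<Prod>x\<in>A. a x :: int)"
proof (induction A rule: finite_induct)
  case empty
  show ?case by simp
next
  case (insert x A)
  then show ?case by (simp add: mult_single)
qed

lemma sum_single_eq_iff:
  fixes e :: "'a \<Rightarrow> nat"
  assumes "finite A"
  shows "(\<Sum>x\<in>A. Poly_Mapping.single x (e x)) = m \<longleftrightarrow> Poly_Mapping.keys m \<subseteq> A \<and> (\<forall>x\<in>A. e x = Poly_Mapping.lookup m x)"
proof -
  have l: "Poly_Mapping.lookup (\<Sum>x\<in>A. Poly_Mapping.single x (e x)) y = (if y \<in> A then e y else 0)" for y
    using assms by (simp add: lookup_sum lookup_single when_def)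
  have "(\<Sum>x\<in>A. Poly_Mapping.single x (e x)) = m \<longleftrightarrow> (\<forall>y. (if y \<in> A then e y else 0) = Poly_Mapping.lookup m y)"
    unfolding poly_mapping_eq_iff fun_eq_iff l ..
  also have "\<dots> \<longleftrightarrow> Poly_Mapping.keys m \<subseteq> A \<and> (\<forall>x\<in>A. e x = Poly_Mapping.lookup m x)"
    by (metis in_keys_iff subset_iff)
  finally show ?thesis .
qed

text \<open>The coefficient of \<open>x ^ j\<close> in \<open>D_power x k\<close>.\<close>

definition D_coeff :: "nat \<Rightarrow> nat \<Rightarrow> nat" where
  "D_coeff k j = (\<Sum>g\<le>k div 2. if k - 2 * g = j then C_count g k else 0)"

lemma lookup_prod_D_power:
  assumes fin: "finite A"
  shows "Poly_Mapping.lookup (\<Prod>x\<in>A. D_power x (k x)) m =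
    (if Poly_Mapping.keys m \<subseteq> A then \<Prod>x\<in>A. int (D_coeff (k x) (Poly_Mapping.lookup m x)) else 0)"
proof -
  let ?G = "\<lambda>x. {..k x div 2}"
  let ?e = "\<lambda>x g. k x - 2 * g"
  have "(\<Prod>x\<in>A. D_power x (k x))
      = (\<Sum>h\<in>Pi\<^sub>E A ?G. \<Prod>x\<in>A. Poly_Mapping.single (Poly_Mapping.single x (?e x (h x))) (int (C_count (h x) (k x))))"
    unfolding D_power_def by (rule prod_sum_PiE[OF fin]) simp
  also have "\<dots> = (\<Sum>h\<in>Pi\<^sub>E A ?G. Poly_Mapping.single (\<Sum>x\<in>A. Poly_Mapping.single x (?e x (h x))) (\<Prod>x\<in>A. int (C_count (h x) (k x))))"
    by (simp add: prod_single[OF fin])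
  finally have "Poly_Mapping.lookup (\<Prod>x\<in>A. D_power x (k x)) m
      = (\<Sum>h\<in>Pi\<^sub>E A ?G. if Poly_Mapping.keys m \<subseteq> A \<and> (\<forall>x\<in>A. ?e x (h x) = Poly_Mapping.lookup m x) then \<Prod>x\<in>A. int (C_count (h x) (k x)) else 0)"
    by (simp add: lookup_sum lookup_single when_def sum_single_eq_iff[OF fin])
  also have "\<dots> = (if Poly_Mapping.keys m \<subseteq> A then
        (\<Sum>h\<in>Pi\<^sub>E A ?G. \<Prod>x\<in>A. if ?e x (h x) = Poly_Mapping.lookup m x then int (C_count (h x) (k x)) else 0) else 0)"
    using fin by (auto intro!: sum.cong prod.cong prod_zero[symmetric])
  also have "(\<Sum>h\<in>Pi\<^sub>E A ?G. \<Prod>x\<in>A. if ?e x (h x) = Poly_Mapping.lookup m x then int (C_count (h x) (k x)) else 0)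
     = (\<Prod>x\<in>A. \<Sum>g\<in>?G x. if ?e x g = Poly_Mapping.lookup m x then int (C_count g (k x)) else 0)"
    by (rule prod_sum_PiE[OF fin, symmetric]) simp
  also have "\<dots> = (\<Prod>x\<in>A. int (D_coeff (k x) (Poly_Mapping.lookup m x)))"
    unfolding D_coeff_def of_nat_sum by (intro prod.cong sum.cong refl) simp
  finally show ?thesis .
qed

lemma C_count_eq:
  "C_count g k = (\<Sum>\<pi>\<in>odd_perms {..<k}. if k = card (orbit \<pi> ` {..<k}) + 2 * g then 2 ^ card (orbit \<pi> ` {..<k}) else 0)"
proof -
  let ?O = "odd_perms {..<k}"
  have fin: "finite ?O" by (simp add: finite_odd_perms)
  have "{(\<pi>, s). (\<pi>, s) \<in> C_permutations k \<and> k = card (perm_cycles k \<pi>) + 2 * g}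
      = (SIGMA \<pi>:{\<pi>\<in>?O. k = card (orbit \<pi> ` {..<k}) + 2 * g}. (orbit \<pi> ` {..<k}) \<rightarrow>\<^sub>E (UNIV :: bool set))"
    by (auto simp: C_permutations_def odd_perms_def perm_cycles_def)
  then have "C_count g k = card (SIGMA \<pi>:{\<pi>\<in>?O. k = card (orbit \<pi> ` {..<k}) + 2 * g}. (orbit \<pi> ` {..<k}) \<rightarrow>\<^sub>E (UNIV :: bool set))"
    by (simp add: C_count_def)
  also have "\<dots> = (\<Sum>\<pi>\<in>{\<pi>\<in>?O. k = card (orbit \<pi> ` {..<k}) + 2 * g}. card ((orbit \<pi> ` {..<k}) \<rightarrow>\<^sub>E (UNIV :: bool set)))"
    using fin by (intro card_SigmaI) (auto intro!: finite_PiE)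
  also have "\<dots> = (\<Sum>\<pi>\<in>{\<pi>\<in>?O. k = card (orbit \<pi> ` {..<k}) + 2 * g}. 2 ^ card (orbit \<pi> ` {..<k}))"
    by (intro sum.cong refl) (simp add: card_PiE)
  also have "\<dots> = (\<Sum>\<pi>\<in>?O. if k = card (orbit \<pi> ` {..<k}) + 2 * g then 2 ^ card (orbit \<pi> ` {..<k}) else 0)"
    by (rule sum.inter_filter[OF fin])
  finally show ?thesis .
qed

text \<open>\<open>card S\<close> is a sum of odd cycle lengths and so has the parity of the number
  of cycles; the genus is therefore an integer.\<close>

lemma odd_perms_parity:
  assumes fin: "finite S" and f: "f \<in> odd_perms S"
  shows "card (orbit f ` S) \<le> card S" "even (card S - card (orbit f ` S))"
proof -
  have p: "f permutes S" using f by (simp add: odd_perms_def)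
  show le: "card (orbit f ` S) \<le> card S" using fin by (rule card_image_le)
  note P = orbit_partition[OF fin p]
  have "card S = card (\<Union>(orbit f ` S))" using partition_onD1[OF P] by simp
  also have "\<dots> = (\<Sum>B\<in>orbit f ` S. card B)"
  proof (rule card_Union_disjoint)
    show "pairwise disjnt (orbit f ` S)"
      using partition_onD2[OF P] by (simp add: disjoint_def pairwise_def disjnt_def)
    show "finite B" if "B \<in> orbit f ` S" for B
      using that orbit_sub[OF p] fin finite_subset by blast
  qed
  finally have cs: "card S = (\<Sum>B\<in>orbit f ` S. card B)" .
  have "{B\<in>orbit f ` S. odd (card B)} = orbit f ` S" using f by (auto simp: odd_perms_def)
  then have "even (card S) \<longleftrightarrow> even (card (orbit f ` S))"
    unfolding cs using fin by (simp add: even_sum_iff)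
  then show "even (card S - card (orbit f ` S))" using le by simp
qed

text \<open>For fixed \<open>k\<close>, genus and number of cycles determine each other, so the sum
  over \<open>g\<close> picks out the permutations with \<open>j\<close> cycles.\<close>

lemma D_coeff_osum: "D_coeff k j = osum (\<lambda>i. if i = j then 2 ^ i else 0) k"
proof -
  let ?O = "odd_perms {..<k}"
  let ?c = "\<lambda>\<pi>. card (orbit \<pi> ` {..<k})"
  have "D_coeff k j = (\<Sum>g\<le>k div 2. \<Sum>\<pi>\<in>?O. if k - 2 * g = j \<and> k = ?c \<pi> + 2 * g then 2 ^ ?c \<pi> else 0)"
    unfolding D_coeff_def C_count_eq by (intro sum.cong refl) auto
  also have "\<dots> = (\<Sum>\<pi>\<in>?O. \<Sum>g\<le>k div 2. if k - 2 * g = j \<and> k = ?c \<pi> + 2 * g then 2 ^ ?c \<pi> else 0)"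
    by (rule sum.swap)
  also have "\<dots> = (\<Sum>\<pi>\<in>?O. if ?c \<pi> = j then 2 ^ ?c \<pi> else 0)"
  proof (rule sum.cong[OF refl])
    fix \<pi> assume "\<pi> \<in> ?O"
    from odd_perms_parity[OF _ this] have le: "?c \<pi> \<le> k" and ev: "even (k - ?c \<pi>)" by simp_all
    define g0 where "g0 = (k - ?c \<pi>) div 2"
    have g0: "k = ?c \<pi> + 2 * g0" using le ev by (simp add: g0_def)
    have "(\<Sum>g\<le>k div 2. if k - 2 * g = j \<and> k = ?c \<pi> + 2 * g then 2 ^ ?c \<pi> else 0)
       = (\<Sum>g\<le>k div 2. if g = g0 then (if ?c \<pi> = j then 2 ^ ?c \<pi> else 0) else 0 :: nat)"
      using g0 by (intro sum.cong refl) auto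
    also have "\<dots> = (if ?c \<pi> = j then 2 ^ ?c \<pi> else 0)"
    proof -
      have "g0 \<le> k div 2" unfolding g0_def by (simp add: div_le_mono)
      then show ?thesis by simp
    qed
    finally show "(\<Sum>g\<le>k div 2. if k - 2 * g = j \<and> k = ?c \<pi> + 2 * g then 2 ^ ?c \<pi> else 0) = (if ?c \<pi> = j then 2 ^ ?c \<pi> else 0 :: nat)" .
  qed
  finally show ?thesis by (simp add: osum_def)
qed

text \<open>A permutation of a nonempty set has a cycle; therefore \<open>D_monomial\<close> never
  loses a variable.\<close>

lemma D_coeff_0: "k > 0 \<Longrightarrow> D_coeff k 0 = 0"
  unfolding D_coeff_osum osum_def by (intro sum.neutral) (auto simp: lessThan_empty_iff)

lemma lookup_D_monomial:
  "Poly_Mapping.lookup (D_monomial k) m = (if Poly_Mapping.keys m = Poly_Mapping.keys k then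
     \<Prod>x\<in>Poly_Mapping.keys m. int (D_coeff (Poly_Mapping.lookup k x) (Poly_Mapping.lookup m x)) else 0)"
proof -
  let ?K = "Poly_Mapping.keys k"
  have eq: "Poly_Mapping.lookup (D_monomial k) m = (if Poly_Mapping.keys m \<subseteq> ?K then
      \<Prod>x\<in>?K. int (D_coeff (Poly_Mapping.lookup k x) (Poly_Mapping.lookup m x)) else 0)"
    unfolding D_monomial_def by (rule lookup_prod_D_power) simp
  show ?thesis
  proof (cases "Poly_Mapping.keys m \<subset> ?K")
    case True
    then obtain x where x: "x \<in> ?K" "x \<notin> Poly_Mapping.keys m" by blast
    then have "D_coeff (Poly_Mapping.lookup k x) (Poly_Mapping.lookup m x) = 0"
      using D_coeff_0[of "Poly_Mapping.lookup k x"] by (simp add: in_keys_iff)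
    then have "(\<Prod>x\<in>?K. int (D_coeff (Poly_Mapping.lookup k x) (Poly_Mapping.lookup m x))) = 0"
      using x by (intro prod_zero) auto
    then show ?thesis using eq True by auto
  qed (use eq in auto)
qed

section \<open>Rooted maps up to isomorphism\<close>

definition relabel :: "nat \<Rightarrow> (nat \<Rightarrow> nat) \<Rightarrow> nat rmap \<Rightarrow> nat rmap" where
  "relabel n \<sigma> M = \<lparr>darts = {..<2 * n}, rot = \<sigma> \<circ> rot M \<circ> inv \<sigma>, opp = \<sigma> \<circ> opp M \<circ> inv \<sigma>, root_dart = \<sigma> (root_dart M)\<rparr>"

lemma labelledD:
  assumes "M \<in> labelled_maps n"
  shows "darts M = {..<2 * n}" "rot M permutes {..<2 * n}" "opp M permutes {..<2 * n}"
    "\<And>d. d \<in> {..<2 * n} \<Longrightarrow> opp M d \<noteq> d \<and> opp M (opp M d) = d" "connected_map M" "root_dart M \<in> {..<2 * n}"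
  using assms by (auto simp: labelled_maps_def rooted_map_def)

lemma connected_map_induct:
  assumes M: "M \<in> labelled_maps n" and r: "P (root_dart M)"
    and s: "\<And>x. x \<in> {..<2 * n} \<Longrightarrow> P x \<Longrightarrow> P (rot M x)" "\<And>x. x \<in> {..<2 * n} \<Longrightarrow> P x \<Longrightarrow> P (opp M x)"
    and d: "d \<in> {..<2 * n}"
  shows "P d"
proof -
  note L = labelledD[OF M]
  have "(root_dart M, d) \<in> {(x, y). x \<in> darts M \<and> (y = rot M x \<or> y = opp M x)}\<^sup>*"
    using L(1,5,6) d by (auto simp: connected_map_def)
  then show ?thesis
  proof induction
    case base show ?case by (rule r)
  next
    case (step y z)
    then show ?case using s L(1) by auto
  qed
qed

text \<open>Outside the darts, rotation and involution are the identity, so a labelled map is given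
  by finite data.\<close>

lemma finite_labelled_maps: "finite (labelled_maps n)"
proof (rule finite_subset)
  let ?f = "\<lambda>(r, a, d). \<lparr>darts = {..<2 * n}, rot = r, opp = a, root_dart = d\<rparr> :: nat rmap"
  let ?P = "{p. p permutes {..<2 * n}}"
  show "labelled_maps n \<subseteq> ?f ` (?P \<times> ?P \<times> {..<2 * n})"
  proof
    fix M assume "M \<in> labelled_maps n"
    note L = labelledD[OF this]
    have "M = ?f (rot M, opp M, root_dart M)" using L(1) by (cases M) simp
    then show "M \<in> ?f ` (?P \<times> ?P \<times> {..<2 * n})" using L by (intro image_eqI[of _ _ "(rot M, opp M, root_dart M)"]) auto
  qed
  show "finite (?f ` (?P \<times> ?P \<times> {..<2 * n}))" by (intro finite_imageI finite_cartesian_product finite_permutations) auto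
qed

lemma relabel_labelled:
  assumes M: "M \<in> labelled_maps n" and s: "\<sigma> permutes {..<2 * n}"
  shows "relabel n \<sigma> M \<in> labelled_maps n" "rmap_iso M (relabel n \<sigma> M)"
proof -
  note L = labelledD[OF M]
  let ?D = "{..<2 * n}"
  let ?N = "relabel n \<sigma> M"
  have invp: "inv \<sigma> permutes ?D" using s by (rule permutes_inv)
  have inv1: "inv \<sigma> (\<sigma> x) = x" "\<sigma> (inv \<sigma> x) = x" for x using permutes_inverses[OF s] by simp_all
  have N: "darts ?N = ?D" "rot ?N x = \<sigma> (rot M (inv \<sigma> x))" "opp ?N x = \<sigma> (opp M (inv \<sigma> x))" "root_dart ?N = \<sigma> (root_dart M)" for x
    by (simp_all add: relabel_def)
  have p: "rot ?N permutes ?D" "opp ?N permutes ?D"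
    using L(2,3) s invp by (simp_all add: relabel_def permutes_compose)
  have inD: "\<sigma> x \<in> ?D \<longleftrightarrow> x \<in> ?D" "inv \<sigma> x \<in> ?D \<longleftrightarrow> x \<in> ?D" for x
    using permutes_in_image[OF s] permutes_in_image[OF invp] by blast+
  have o: "opp ?N d \<noteq> d \<and> opp ?N (opp ?N d) = d" if d: "d \<in> ?D" for d
  proof -
    have "opp M (inv \<sigma> d) \<noteq> inv \<sigma> d \<and> opp M (opp M (inv \<sigma> d)) = inv \<sigma> d" using L(4)[of "inv \<sigma> d"] inD(2)[of d] d by blast
    then show ?thesis unfolding N inv1 using inv1 by metis
  qed
  have con: "connected_map ?N" unfolding connected_map_def N(1)
  proof (intro ballI)
    fix d d' assume d: "d \<in> ?D" "d' \<in> ?D"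
    let ?R = "{(x, y). x \<in> ?D \<and> (y = rot ?N x \<or> y = opp ?N x)}"
    have "(inv \<sigma> d, inv \<sigma> d') \<in> {(x, y). x \<in> darts M \<and> (y = rot M x \<or> y = opp M x)}\<^sup>*"
      using L(1,5) d inD(2) unfolding connected_map_def by blast
    then have "(\<sigma> (inv \<sigma> d), \<sigma> (inv \<sigma> d')) \<in> ?R\<^sup>*"
    proof induction
      case (step y z)
      have "(\<sigma> y, \<sigma> z) \<in> ?R" using step.hyps(2) L(1) inD(1) inv1 by (auto simp: N)
      with step.IH show ?case by (rule rtrancl_into_rtrancl)
    qed (rule rtrancl_refl)
    then show "(d, d') \<in> ?R\<^sup>*" by (simp add: inv1)
  qed
  show "?N \<in> labelled_maps n"
    unfolding labelled_maps_def rooted_map_def using p o con N(1,4) L(6) inD(1) by auto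
  show "rmap_iso M ?N" unfolding rmap_iso_def N L(1)
    using permutes_imp_bij[OF s] inv1 by (intro exI[of _ \<sigma>]) auto
qed

lemma iso_imp_relabel:
  assumes M: "M \<in> labelled_maps n" and N: "N \<in> labelled_maps n" and iso: "rmap_iso M N"
  shows "\<exists>\<sigma>. \<sigma> permutes {..<2 * n} \<and> N = relabel n \<sigma> M"
proof -
  let ?D = "{..<2 * n}"
  note L = labelledD[OF M] and K = labelledD[OF N]
  obtain f where f: "bij_betw f ?D ?D" "\<And>d. d \<in> ?D \<Longrightarrow> f (rot M d) = rot N (f d) \<and> f (opp M d) = opp N (f d)"
    "f (root_dart M) = root_dart N"
    using iso L(1) K(1) by (auto simp: rmap_iso_def)
  \<comment> \<open>An isomorphism is meaningful only on the darts. Extended by the identity it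
    becomes a permutation, and the two records agree everywhere because rotations and involutions
    also fix all other points.\<close>
  define \<sigma> where "\<sigma> x = (if x \<in> ?D then f x else x)" for x
  have sf: "\<sigma> x = f x" if "x \<in> ?D" for x using that by (simp add: \<sigma>_def)
  have "bij_betw \<sigma> ?D ?D" using f(1) bij_betw_cong[of ?D \<sigma> f ?D] sf by blast
  then have s: "\<sigma> permutes ?D" by (rule bij_imp_permutes) (auto simp: \<sigma>_def)
  have invp: "inv \<sigma> permutes ?D" using s by (rule permutes_inv)
  have inv2: "\<sigma> (inv \<sigma> x) = x" for x using permutes_inverses[OF s] by simp
  have out: "inv \<sigma> x = x" "\<sigma> x = x" if "x \<notin> ?D" for x using permutes_not_in[OF invp that] permutes_not_in[OF s that] .
  have r: "rot N x = \<sigma> (rot M (inv \<sigma> x)) \<and> opp N x = \<sigma> (opp M (inv \<sigma> x))" for x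
  proof (cases "x \<in> ?D")
    case True
    then have y: "inv \<sigma> x \<in> ?D" using permutes_in_image[OF invp] by blast
    then have "rot M (inv \<sigma> x) \<in> ?D" "opp M (inv \<sigma> x) \<in> ?D" using permutes_in_image[OF L(2)] permutes_in_image[OF L(3)] by blast+
    moreover have "f (inv \<sigma> x) = x" using sf[OF y] inv2[of x] by simp
    ultimately show ?thesis using f(2)[OF y] sf by metis
  next
    case False
    then show ?thesis using out permutes_not_in[OF L(2) False] permutes_not_in[OF L(3) False]
        permutes_not_in[OF K(2) False] permutes_not_in[OF K(3) False] by simp
  qed
  have "N = relabel n \<sigma> M"
    using K(1) r f(3) sf[OF L(6)] by (cases N) (simp add: relabel_def fun_eq_iff)
  then show ?thesis using s by blast
qed

text \<open>A relabelling is determined by what it does to the root: agreement propagates along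
  rotation and involution, and the map is connected.\<close>

lemma relabel_rigid:
  assumes M: "M \<in> labelled_maps n" and s: "\<sigma> permutes {..<2 * n}" and t: "\<tau> permutes {..<2 * n}"
    and e: "relabel n \<sigma> M = relabel n \<tau> M"
  shows "\<sigma> = \<tau>"
proof
  fix d
  have "rot (relabel n \<sigma> M) = rot (relabel n \<tau> M)" "opp (relabel n \<sigma> M) = opp (relabel n \<tau> M)"
    "root_dart (relabel n \<sigma> M) = root_dart (relabel n \<tau> M)" using e by simp_all
  then have e1: "\<sigma> (rot M (inv \<sigma> x)) = \<tau> (rot M (inv \<tau> x))" and e2: "\<sigma> (opp M (inv \<sigma> x)) = \<tau> (opp M (inv \<tau> x))"
    and e3: "\<sigma> (root_dart M) = \<tau> (root_dart M)" for x
    by (simp_all add: relabel_def fun_eq_iff)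
  have inv1: "inv \<sigma> (\<sigma> x) = x" "inv \<tau> (\<tau> x) = x" for x using permutes_inverses[OF s] permutes_inverses[OF t] by simp_all
  show "\<sigma> d = \<tau> d"
  proof (cases "d \<in> {..<2 * n}")
    case True
    show ?thesis
    proof (rule connected_map_induct[OF M, where P = "\<lambda>d. \<sigma> d = \<tau> d"])
      show "\<sigma> (root_dart M) = \<tau> (root_dart M)" by (rule e3)
      show "\<sigma> (rot M x) = \<tau> (rot M x)" if "\<sigma> x = \<tau> x" for x
        using e1[of "\<sigma> x"] that inv1 by metis
      show "\<sigma> (opp M x) = \<tau> (opp M x)" if "\<sigma> x = \<tau> x" for x
        using e2[of "\<sigma> x"] that inv1 by metis
    qed (rule True)
  next
    case False then show ?thesis using permutes_not_in[OF s] permutes_not_in[OF t] by simp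
  qed
qed

lemma equiv_iso_rel: "equiv (labelled_maps n) (iso_rel n)"
proof (rule equivI)
  show "iso_rel n \<subseteq> labelled_maps n \<times> labelled_maps n" by (auto simp: iso_rel_def)
  show "refl_on (labelled_maps n) (iso_rel n)"
    by (rule refl_onI) (auto simp: iso_rel_def rmap_iso_def intro!: exI[of _ id])
  show "sym (iso_rel n)"
  proof (rule symI)
    fix M N assume "(M, N) \<in> iso_rel n"
    then have MN: "M \<in> labelled_maps n" "N \<in> labelled_maps n" "rmap_iso M N" by (auto simp: iso_rel_def)
    note L = labelledD[OF MN(1)] and K = labelledD[OF MN(2)]
    let ?D = "{..<2 * n}"
    obtain f where f: "bij_betw f ?D ?D" "\<And>d. d \<in> ?D \<Longrightarrow> f (rot M d) = rot N (f d) \<and> f (opp M d) = opp N (f d)"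
      "f (root_dart M) = root_dart N"
      using MN(3) L(1) K(1) by (auto simp: rmap_iso_def)
    let ?g = "inv_into ?D f"
    have g: "bij_betw ?g ?D ?D" using f(1) by (rule bij_betw_inv_into)
    have gf: "?g (f x) = x" if "x \<in> ?D" for x using f(1) that by (rule bij_betw_inv_into_left)
    have fg: "f (?g x) = x" "?g x \<in> ?D" if "x \<in> ?D" for x
      using bij_betw_inv_into_right[OF f(1) that] bij_betwE[OF g] that by auto
    have "?g (rot N d) = rot M (?g d) \<and> ?g (opp N d) = opp M (?g d)" if d: "d \<in> ?D" for d
    proof -
      have "rot M (?g d) \<in> ?D" "opp M (?g d) \<in> ?D" using fg(2)[OF d] permutes_in_image[OF L(2)] permutes_in_image[OF L(3)] by blast+
      then show ?thesis using f(2)[OF fg(2)[OF d]] fg(1)[OF d] gf by metis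
    qed
    then have "rmap_iso N M" unfolding rmap_iso_def L(1) K(1)
      using g gf[OF L(6)] f(3) by (intro exI[of _ ?g]) auto
    then show "(N, M) \<in> iso_rel n" using MN by (simp add: iso_rel_def)
  qed
  show "trans (iso_rel n)"
  proof (rule transI)
    fix M N R assume "(M, N) \<in> iso_rel n" "(N, R) \<in> iso_rel n"
    then have MN: "M \<in> labelled_maps n" "N \<in> labelled_maps n" "R \<in> labelled_maps n" "rmap_iso M N" "rmap_iso N R"
      by (auto simp: iso_rel_def)
    obtain f where f: "bij_betw f (darts M) (darts N)" "\<And>d. d \<in> darts M \<Longrightarrow> f (rot M d) = rot N (f d) \<and> f (opp M d) = opp N (f d)"
      "f (root_dart M) = root_dart N" using MN(4) by (auto simp: rmap_iso_def)
    obtain g where g: "bij_betw g (darts N) (darts R)" "\<And>d. d \<in> darts N \<Longrightarrow> g (rot N d) = rot R (g d) \<and> g (opp N d) = opp R (g d)"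
      "g (root_dart N) = root_dart R" using MN(5) by (auto simp: rmap_iso_def)
    have "rmap_iso M R" unfolding rmap_iso_def
      using bij_betw_trans[OF f(1) g(1)] f(2,3) g(2,3) bij_betwE[OF f(1)] by (intro exI[of _ "g \<circ> f"]) auto
    then show "(M, R) \<in> iso_rel n" using MN by (simp add: iso_rel_def)
  qed
qed

lemma rooted_maps_reps:
  shows "rooted_maps n \<subseteq> labelled_maps n"
    and "N \<in> labelled_maps n \<Longrightarrow> \<exists>M\<in>rooted_maps n. (M, N) \<in> iso_rel n"
    and "M \<in> rooted_maps n \<Longrightarrow> M' \<in> rooted_maps n \<Longrightarrow> (M, M') \<in> iso_rel n \<Longrightarrow> M = M'"
proof -
  let ?Q = "labelled_maps n // iso_rel n"
  have s: "(SOME M. M \<in> C) \<in> C" if "C \<in> ?Q" for C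
    using in_quotient_imp_non_empty[OF equiv_iso_rel that] by (simp add: some_in_eq)
  show "rooted_maps n \<subseteq> labelled_maps n"
    unfolding rooted_maps_def using s in_quotient_imp_subset[OF equiv_iso_rel] by blast
  show "\<exists>M\<in>rooted_maps n. (M, N) \<in> iso_rel n" if N: "N \<in> labelled_maps n"
  proof -
    let ?C = "iso_rel n `` {N}"
    have C: "?C \<in> ?Q" using N by (rule quotientI)
    have "(N, SOME M. M \<in> ?C) \<in> iso_rel n" using s[OF C] by simp
    then have "((SOME M. M \<in> ?C), N) \<in> iso_rel n" using equiv_iso_rel[of n] by (meson equivE symD)
    then show ?thesis using C unfolding rooted_maps_def by blast
  qed
  show "M = M'" if M: "M \<in> rooted_maps n" "M' \<in> rooted_maps n" "(M, M') \<in> iso_rel n"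
  proof -
    obtain C C' where C: "C \<in> ?Q" "M = (SOME M. M \<in> C)" "C' \<in> ?Q" "M' = (SOME M. M \<in> C')"
      using M(1,2) by (auto simp: rooted_maps_def)
    have "C = C'" using quotient_eqI[OF equiv_iso_rel C(1,3), of M M'] s C M(3) by simp
    then show ?thesis using C by simp
  qed
qed

text \<open>Rooted maps have no automorphisms, so each isomorphism class has \<open>(2 * n)!\<close> labelled members.\<close>

theorem sum_rooted_maps:
  fixes w :: "nat rmap \<Rightarrow> nat"
  assumes w: "\<And>M \<sigma>. M \<in> labelled_maps n \<Longrightarrow> \<sigma> permutes {..<2 * n} \<Longrightarrow> w (relabel n \<sigma> M) = w M"
  shows "fact (2 * n) * (\<Sum>M\<in>rooted_maps n. w M) = (\<Sum>M\<in>labelled_maps n. w M)"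
proof -
  let ?P = "{\<sigma>. \<sigma> permutes {..<2 * n}}"
  let ?f = "\<lambda>(\<sigma>, M). relabel n \<sigma> M"
  note R = rooted_maps_reps(1)[of n]
  have "bij_betw ?f (?P \<times> rooted_maps n) (labelled_maps n)"
    unfolding bij_betw_def
  proof
    show "inj_on ?f (?P \<times> rooted_maps n)"
    proof (rule inj_onI)
      fix u u' assume "u \<in> ?P \<times> rooted_maps n" "u' \<in> ?P \<times> rooted_maps n" and e: "?f u = ?f u'"
      then obtain \<sigma> M \<sigma>' M' where u: "u = (\<sigma>, M)" "u' = (\<sigma>', M')" and s: "\<sigma> permutes {..<2 * n}" "\<sigma>' permutes {..<2 * n}"
        and M: "M \<in> rooted_maps n" "M' \<in> rooted_maps n" by auto
      have L: "M \<in> labelled_maps n" "M' \<in> labelled_maps n" using M R by auto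
      have e': "relabel n \<sigma> M = relabel n \<sigma>' M'" using e u by simp
      have "(M, relabel n \<sigma> M) \<in> iso_rel n" "(M', relabel n \<sigma>' M') \<in> iso_rel n"
        using relabel_labelled[OF L(1) s(1)] relabel_labelled[OF L(2) s(2)] L by (auto simp: iso_rel_def)
      then have "(M, M') \<in> iso_rel n" using equiv_iso_rel[of n] e' by (metis equivE symD transD)
      then have "M = M'" using rooted_maps_reps(3) M by blast
      then show "u = u'" using relabel_rigid[OF L(1) s] e' u by simp
    qed
    show "?f ` (?P \<times> rooted_maps n) = labelled_maps n"
    proof
      show "?f ` (?P \<times> rooted_maps n) \<subseteq> labelled_maps n" using relabel_labelled(1) R by auto
      show "labelled_maps n \<subseteq> ?f ` (?P \<times> rooted_maps n)"
      proof
        fix N assume "N \<in> labelled_maps n"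
        then obtain M where M: "M \<in> rooted_maps n" "(M, N) \<in> iso_rel n" using rooted_maps_reps(2) by blast
        then obtain \<sigma> where "\<sigma> permutes {..<2 * n}" "N = relabel n \<sigma> M"
          using iso_imp_relabel[of M n N] by (auto simp: iso_rel_def)
        then show "N \<in> ?f ` (?P \<times> rooted_maps n)" using M by (intro image_eqI[of _ _ "(\<sigma>, M)"]) auto
      qed
    qed
  qed
  from sum.reindex_bij_betw[OF this, of w]
  have "(\<Sum>M\<in>labelled_maps n. w M) = (\<Sum>u\<in>?P \<times> rooted_maps n. w (?f u))" by simp
  also have "\<dots> = (\<Sum>\<sigma>\<in>?P. \<Sum>M\<in>rooted_maps n. w (relabel n \<sigma> M))"
    unfolding sum.cartesian_product by (intro sum.cong refl) (simp only: case_prod_unfold)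
  also have "\<dots> = (\<Sum>\<sigma>\<in>?P. \<Sum>M\<in>rooted_maps n. w M)"
    using w R by (intro sum.cong refl) auto
  also have "\<dots> = fact (2 * n) * (\<Sum>M\<in>rooted_maps n. w M)"
    using card_permutations[of "{..<2 * n}" "2 * n"] by simp
  finally show ?thesis by simp
qed

section \<open>Order labellings as colourings of darts\<close>

fun is_Q :: "var \<Rightarrow> bool" where
  "is_Q (Qvar i) = True"
| "is_Q (Pvar i) = False"

fun var_index :: "var \<Rightarrow> nat" where
  "var_index (Qvar i) = i"
| "var_index (Pvar i) = i"

lemma var_eq: "(if is_Q x then Qvar else Pvar) (var_index x) = x"
  by (cases x) auto

lemma var_sel [simp]: "is_Q ((if b then Qvar else Pvar) i) = b" "var_index ((if b then Qvar else Pvar) i) = i"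
  by auto

text \<open>\<open>Qvar\<close> marks black and \<open>Pvar\<close> white darts, and the index is
  the value of the labelling. The black root, the proper two-colouring, positive labels and the
  order condition become conditions on the root dart and on single edges, in which the rotation does
  not occur.\<close>

definition good_coloring :: "nat \<Rightarrow> (nat \<Rightarrow> nat) \<Rightarrow> nat \<Rightarrow> (nat \<Rightarrow> var) \<Rightarrow> bool" where
  "good_coloring n \<alpha> d0 c \<longleftrightarrow> is_Q (c d0) \<and>
    (\<forall>d\<in>{..<2 * n}. 1 \<le> var_index (c d) \<and> (is_Q (c (\<alpha> d)) \<longleftrightarrow> \<not> is_Q (c d)) \<and>
       (is_Q (c d) \<longrightarrow> var_index (c (\<alpha> d)) \<le> var_index (c d)))"

text \<open>The orbit counts are the exponents of the weight, as each vertex contributes its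
  variable once.\<close>

definition dart_colorings :: "nat \<Rightarrow> (nat \<Rightarrow> nat) \<Rightarrow> (nat \<Rightarrow> nat) \<Rightarrow> nat \<Rightarrow> monomial \<Rightarrow> (nat \<Rightarrow> var) set" where
  "dart_colorings n \<rho> \<alpha> d0 m = {c \<in> {..<2 * n} \<rightarrow>\<^sub>E UNIV. \<rho> \<in> invar c {..<2 * n} \<and> good_coloring n \<alpha> d0 c \<and>
      (\<forall>v. card (orbit \<rho> ` {x\<in>{..<2 * n}. c x = v}) = Poly_Mapping.lookup m v)}"

lemma count_pos_iff:
  "finite D \<Longrightarrow> card (orbit \<rho> ` {x\<in>D. c x = v}) > 0 \<longleftrightarrow> v \<in> c ` D"
  by (subst card_gt_0_iff) auto

text \<open>A colour in use is carried by at least one vertex, so the colours in use are the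
  variables of \<open>m\<close>.\<close>

lemma counts_iff:
  fixes c :: "nat \<Rightarrow> var"
  assumes "finite D"
  shows "(\<forall>v. card (orbit \<rho> ` {x\<in>D. c x = v}) = Poly_Mapping.lookup m v) \<longleftrightarrow>
     c ` D = Poly_Mapping.keys m \<and> (\<forall>v\<in>c ` D. card (orbit \<rho> ` {x\<in>D. c x = v}) = Poly_Mapping.lookup m v)"
proof
  assume a: "\<forall>v. card (orbit \<rho> ` {x\<in>D. c x = v}) = Poly_Mapping.lookup m v"
  have "v \<in> c ` D \<longleftrightarrow> v \<in> Poly_Mapping.keys m" for v
    using count_pos_iff[OF assms, of \<rho> c v] a by (simp add: in_keys_iff)
  then show "c ` D = Poly_Mapping.keys m \<and> (\<forall>v\<in>c ` D. card (orbit \<rho> ` {x\<in>D. c x = v}) = Poly_Mapping.lookup m v)"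
    using a by blast
next
  assume a: "c ` D = Poly_Mapping.keys m \<and> (\<forall>v\<in>c ` D. card (orbit \<rho> ` {x\<in>D. c x = v}) = Poly_Mapping.lookup m v)"
  show "\<forall>v. card (orbit \<rho> ` {x\<in>D. c x = v}) = Poly_Mapping.lookup m v"
  proof
    fix v
    show "card (orbit \<rho> ` {x\<in>D. c x = v}) = Poly_Mapping.lookup m v"
    proof (cases "v \<in> c ` D")
      case True then show ?thesis using a by blast
    next
      case False
      then have "Poly_Mapping.lookup m v = 0" using a by (simp add: in_keys_iff)
      moreover have "card (orbit \<rho> ` {x\<in>D. c x = v}) = 0" using count_pos_iff[OF assms, of \<rho> c v] False by simp
      ultimately show ?thesis by simp
    qed
  qed
qed

lemma finite_dart_colorings: "finite (dart_colorings n \<rho> \<alpha> d0 m)"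
proof (rule finite_subset)
  show "dart_colorings n \<rho> \<alpha> d0 m \<subseteq> {..<2 * n} \<rightarrow>\<^sub>E Poly_Mapping.keys m"
  proof
    fix c assume c: "c \<in> dart_colorings n \<rho> \<alpha> d0 m"
    then have "c ` {..<2 * n} = Poly_Mapping.keys m"
      using counts_iff[of "{..<2 * n}" \<rho> c m] by (simp add: dart_colorings_def)
    then show "c \<in> {..<2 * n} \<rightarrow>\<^sub>E Poly_Mapping.keys m" using c by (auto simp: dart_colorings_def PiE_def)
  qed
qed (simp add: finite_PiE)

locale labelled_map =
  fixes n :: nat and M :: "nat rmap"
  assumes M: "M \<in> labelled_maps n"
begin

abbreviation "D \<equiv> {..<2 * n}"
abbreviation "r \<equiv> rot M"
abbreviation "a \<equiv> opp M"
abbreviation "vx \<equiv> vertex_of M"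

lemmas L = labelledD[OF M]

section \<open>Vertices, colour classes and labellings of a labelled map\<close>

lemma vx_orbit: "vx d = orbit r d" by (simp add: vertex_of_def)
lemma verts: "vertices M = orbit r ` D" by (simp add: vertices_def vertex_of_def L(1) image_def)
lemma vx_self: "d \<in> vx d" unfolding vx_orbit by (rule perm_self_in_orbit[OF finite_lessThan L(2)])
lemma vx_eq: "x \<in> vx d \<Longrightarrow> vx x = vx d" unfolding vx_orbit by (rule perm_orbit_eq[OF finite_lessThan L(2)])
lemma vx_rot: "vx (r d) = vx d" unfolding vx_orbit by (rule perm_orbit_step[OF finite_lessThan L(2)])
lemma vx_sub: "d \<in> D \<Longrightarrow> vx d \<subseteq> D" unfolding vx_orbit by (rule orbit_sub[OF L(2)])
lemma a_in: "d \<in> D \<Longrightarrow> a d \<in> D" using permutes_in_image[OF L(3)] by blast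
lemma vx_verts: "d \<in> D \<Longrightarrow> vx d \<in> vertices M" by (simp add: verts vx_orbit)

text \<open>From the root vertex the colour is kept by the rotation and reversed by the involution,
  and every dart is reached in this way.\<close>

lemma color_class_unique:
  assumes "color_class M B" "color_class M B'" "vx (root_dart M) \<in> B" "vx (root_dart M) \<in> B'"
  shows "B = B'"
proof -
  have "vx d \<in> B \<longleftrightarrow> vx d \<in> B'" if "d \<in> D" for d
  proof (rule connected_map_induct[OF M, where P = "\<lambda>d. vx d \<in> B \<longleftrightarrow> vx d \<in> B'"])
    show "(vx (r x) \<in> B) = (vx (r x) \<in> B')" if "(vx x \<in> B) = (vx x \<in> B')" for x using that vx_rot by simp
    show "(vx (a x) \<in> B) = (vx (a x) \<in> B')" if "x \<in> D" "(vx x \<in> B) = (vx x \<in> B')" for x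
      using that assms(1,2) L(1) by (auto simp: color_class_def)
  qed (use assms that in auto)
  moreover have "B \<subseteq> vx ` D" "B' \<subseteq> vx ` D" using assms(1,2) L(1) by (auto simp: color_class_def vertices_def)
  ultimately show ?thesis by blast
qed

lemma black_eq:
  assumes "color_class M B" "vx (root_dart M) \<in> B"
  shows "black_vertices M = B"
  unfolding black_vertices_def using assms color_class_unique by (intro the_equality) auto

lemma black_color_class:
  assumes "bipartite M"
  shows "color_class M (black_vertices M) \<and> vx (root_dart M) \<in> black_vertices M"
proof -
  obtain B where B: "color_class M B" using assms by (auto simp: bipartite_def)
  have "\<exists>B. color_class M B \<and> vx (root_dart M) \<in> B"
  proof (cases "vx (root_dart M) \<in> B")
    case False
    have "color_class M (vertices M - B)"
      using B vx_verts a_in L(1) by (auto simp: color_class_def)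
    then show ?thesis using False vx_verts[OF L(6)] by blast
  qed (use B in blast)
  then obtain B' where "color_class M B'" "vx (root_dart M) \<in> B'" by blast
  then show ?thesis using black_eq[of B'] by simp
qed

lemma order_condition_iff:
  assumes "bipartite M"
  shows "order_condition M \<phi> \<longleftrightarrow> (\<forall>d\<in>D. vx d \<in> black_vertices M \<longrightarrow> \<phi> (vx (a d)) \<le> \<phi> (vx d))"
proof -
  let ?B = "black_vertices M"
  have B: "?B \<subseteq> vertices M" "\<And>d. d \<in> D \<Longrightarrow> vx d \<in> ?B \<longleftrightarrow> vx (a d) \<notin> ?B"
    using black_color_class[OF assms] L(1) by (auto simp: color_class_def)
  have W: "white_vertices M = vertices M - ?B" by (simp add: white_vertices_def)
  have hit: "v = vx x" if "v \<in> vertices M" "x \<in> v" for v x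
    using that vx_eq by (auto simp: verts simp flip: vx_orbit)
  have ends: "black_end M {d, a d} = vx d" "white_end M {d, a d} = vx (a d)" if d: "d \<in> D" "vx d \<in> ?B" for d
  proof -
    have wad: "vx (a d) \<notin> ?B" "vx (a d) \<in> vertices M" using B(2) d a_in vx_verts by auto
    show "black_end M {d, a d} = vx d" unfolding black_end_def
    proof (rule the_equality)
      show "vx d \<in> ?B \<and> vx d \<inter> {d, a d} \<noteq> {}" using d vx_self by blast
      fix v assume v: "v \<in> ?B \<and> v \<inter> {d, a d} \<noteq> {}"
      then have "v = vx d \<or> v = vx (a d)" using hit B(1) by blast
      then show "v = vx d" using v wad by auto
    qed
    show "white_end M {d, a d} = vx (a d)" unfolding white_end_def W
    proof (rule the_equality)
      show "vx (a d) \<in> vertices M - ?B \<and> vx (a d) \<inter> {d, a d} \<noteq> {}" using wad vx_self by blast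
      fix v assume v: "v \<in> vertices M - ?B \<and> v \<inter> {d, a d} \<noteq> {}"
      then have "v = vx d \<or> v = vx (a d)" using hit by blast
      then show "v = vx (a d)" using v d by auto
    qed
  qed
  show ?thesis
  proof
    assume o: "order_condition M \<phi>"
    show "\<forall>d\<in>D. vx d \<in> ?B \<longrightarrow> \<phi> (vx (a d)) \<le> \<phi> (vx d)"
    proof (intro ballI impI)
      fix d assume d: "d \<in> D" "vx d \<in> ?B"
      then have "{d, a d} \<in> edges M" using L(1) by (auto simp: edges_def)
      then show "\<phi> (vx (a d)) \<le> \<phi> (vx d)" using o ends[OF d] by (auto simp: order_condition_def)
    qed
  next
    assume o: "\<forall>d\<in>D. vx d \<in> ?B \<longrightarrow> \<phi> (vx (a d)) \<le> \<phi> (vx d)"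
    show "order_condition M \<phi>" unfolding order_condition_def
    proof
      fix e assume "e \<in> edges M"
      then obtain d where d: "d \<in> D" "e = {d, a d}" using L(1) by (auto simp: edges_def)
      show "\<phi> (white_end M e) \<le> \<phi> (black_end M e)"
      proof (cases "vx d \<in> ?B")
        case True then show ?thesis using ends[of d] d o by simp
      next
        case False
        then have "vx (a d) \<in> ?B" using B(2) d by simp
        moreover have "e = {a d, a (a d)}" using d L(4)[of d] by auto
        ultimately show ?thesis using ends[of "a d"] d a_in[of d] o by simp
      qed
    qed
  qed
qed

definition "colored \<phi> = (\<lambda>d\<in>D. (if vx d \<in> black_vertices M then Qvar else Pvar) (\<phi> (vx d)))"

lemma lookup_wt:
  assumes "bipartite M"
  shows "Poly_Mapping.lookup (wt M \<phi>) x = card (orbit r ` {d\<in>D. colored \<phi> d = x})"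
proof -
  let ?B = "black_vertices M"
  have B: "?B \<subseteq> vertices M" using black_color_class[OF assms] by (simp add: color_class_def)
  have fv: "finite (vertices M)" by (simp add: verts)
  have fB: "finite ?B" "finite (white_vertices M)" using fv B by (auto simp: white_vertices_def intro: finite_subset)
  have lk: "Poly_Mapping.lookup (\<Sum>v\<in>S. Poly_Mapping.single (f v) (1::nat)) x = card {v\<in>S. f v = x}" if "finite S" for S :: "nat set set" and f
    using that by (simp add: lookup_sum lookup_single when_def sum.If_cases Int_def)
  have "Poly_Mapping.lookup (wt M \<phi>) x = card {v\<in>white_vertices M. Pvar (\<phi> v) = x} + card {v\<in>?B. Qvar (\<phi> v) = x}"
    unfolding wt_def lookup_add by (simp only: lk fB)
  also have "\<dots> = card ({v\<in>white_vertices M. Pvar (\<phi> v) = x} \<union> {v\<in>?B. Qvar (\<phi> v) = x})"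
    using fB by (intro card_Un_disjoint[symmetric]) (auto simp: white_vertices_def)
  also have "{v\<in>white_vertices M. Pvar (\<phi> v) = x} \<union> {v\<in>?B. Qvar (\<phi> v) = x}
      = {v\<in>vertices M. (if v \<in> ?B then Qvar else Pvar) (\<phi> v) = x}"
    using B by (auto simp: white_vertices_def)
  also have "\<dots> = orbit r ` {d\<in>D. colored \<phi> d = x}"
    unfolding verts by (auto simp: colored_def simp flip: vx_orbit)
  finally show ?thesis .
qed

text \<open>A dart colouring brings its own proper two-colouring with black root, which by
  uniqueness is the one of the map. In particular a map that is not bipartite has no dart
  colouring.\<close>

lemma coloring_black:
  assumes c: "c \<in> dart_colorings n r a (root_dart M) m"
  shows "bipartite M" "d \<in> D \<Longrightarrow> vx d \<in> black_vertices M \<longleftrightarrow> is_Q (c d)"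
proof -
  have inv: "r \<in> invar c D" and g: "good_coloring n a (root_dart M) c" using c by (auto simp: dart_colorings_def)
  have cc: "c x = c d" if "d \<in> D" "x \<in> vx d" for x d using invar_const_orbit[OF inv that(1)] that(2) by (simp add: vx_orbit)
  define B where "B = vx ` {d\<in>D. is_Q (c d)}"
  have mem: "vx d \<in> B \<longleftrightarrow> is_Q (c d)" if d: "d \<in> D" for d
  proof
    assume "vx d \<in> B"
    then obtain e where e: "e \<in> D" "is_Q (c e)" "vx d = vx e" by (auto simp: B_def)
    then have "c d = c e" using cc[OF e(1), of d] vx_self[of d] by simp
    then show "is_Q (c d)" using e by simp
  qed (use d in \<open>auto simp: B_def\<close>)
  have "color_class M B" unfolding color_class_def L(1)
  proof
    show "B \<subseteq> vertices M" using vx_verts by (auto simp: B_def)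
    show "\<forall>d\<in>D. (vx d \<in> B) = (vx (a d) \<notin> B)"
      using mem a_in g by (simp add: good_coloring_def)
  qed
  moreover have "vx (root_dart M) \<in> B" using mem[OF L(6)] g by (simp add: good_coloring_def)
  ultimately have "black_vertices M = B" "bipartite M" using black_eq by (auto simp: bipartite_def)
  then show "bipartite M" "d \<in> D \<Longrightarrow> vx d \<in> black_vertices M \<longleftrightarrow> is_Q (c d)" using mem by auto
qed

text \<open>The variable at a vertex records its colour and its label; the colour is already
  determined by the map, so the variables carry the same information as the labels.\<close>

lemma colored_bij:
  assumes bip: "bipartite M"
  shows "bij_betw colored {\<phi>\<in>order_labellings M. wt M \<phi> = m} (dart_colorings n r a (root_dart M) m)"
proof -
  let ?B = "black_vertices M"
  have B: "\<And>d. d \<in> D \<Longrightarrow> vx d \<in> ?B \<longleftrightarrow> vx (a d) \<notin> ?B" "vx (root_dart M) \<in> ?B"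
    using black_color_class[OF bip] L(1) by (auto simp: color_class_def)
  have col: "colored \<phi> d = (if vx d \<in> ?B then Qvar else Pvar) (\<phi> (vx d))" if "d \<in> D" for d \<phi>
    using that by (simp add: colored_def)
  have inj: "inj_on colored {\<phi>\<in>order_labellings M. wt M \<phi> = m}"
  proof (rule inj_onI)
    fix \<phi> \<phi>' assume p: "\<phi> \<in> {\<phi>\<in>order_labellings M. wt M \<phi> = m}" "\<phi>' \<in> {\<phi>\<in>order_labellings M. wt M \<phi> = m}"
      and e: "colored \<phi> = colored \<phi>'"
    have E: "\<phi> \<in> vertices M \<rightarrow>\<^sub>E {1..}" "\<phi>' \<in> vertices M \<rightarrow>\<^sub>E {1..}" using p by (auto simp: order_labellings_def)
    show "\<phi> = \<phi>'"
    proof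
      fix v show "\<phi> v = \<phi>' v"
      proof (cases "v \<in> vertices M")
        case True
        then obtain d where d: "d \<in> D" "v = vx d" by (auto simp: verts vx_orbit)
        have "var_index (colored \<phi> d) = var_index (colored \<phi>' d)" using e by simp
        then show ?thesis unfolding col[OF d(1)] d(2) by simp
      next
        case False then show ?thesis using PiE_arb[OF E(1)] PiE_arb[OF E(2)] by simp
      qed
    qed
  qed
  have sub: "colored \<phi> \<in> dart_colorings n r a (root_dart M) m" if p: "\<phi> \<in> order_labellings M" "wt M \<phi> = m" for \<phi>
  proof -
    have E: "\<phi> \<in> vertices M \<rightarrow>\<^sub>E {1..}" and o: "order_condition M \<phi>" using p by (auto simp: order_labellings_def)
    have "colored \<phi> \<in> D \<rightarrow>\<^sub>E UNIV" by (simp add: colored_def)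
    moreover have "r \<in> invar (colored \<phi>) D"
      using L(2) permutes_in_image[OF L(2)] vx_rot by (auto simp: invar_def colored_def)
    moreover have "good_coloring n a (root_dart M) (colored \<phi>)"
      unfolding good_coloring_def
    proof (intro conjI ballI impI)
      show "is_Q (colored \<phi> (root_dart M))" using col[OF L(6)] B(2) by simp
      fix d assume d: "d \<in> D"
      note ad = a_in[OF d]
      have "\<phi> (vx d) \<in> {1..}" using PiE_mem[OF E vx_verts[OF d]] .
      then show "1 \<le> var_index (colored \<phi> d)" unfolding col[OF d] by simp
      show "is_Q (colored \<phi> (a d)) \<longleftrightarrow> \<not> is_Q (colored \<phi> d)" unfolding col[OF d] col[OF ad] using B(1)[OF d] by simp
      assume "is_Q (colored \<phi> d)"
      then have "vx d \<in> ?B" unfolding col[OF d] by simp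
      then show "var_index (colored \<phi> (a d)) \<le> var_index (colored \<phi> d)"
        unfolding col[OF d] col[OF ad] using o order_condition_iff[OF bip] d by simp
    qed
    moreover have "card (orbit r ` {x\<in>D. colored \<phi> x = v}) = Poly_Mapping.lookup m v" for v
      using lookup_wt[OF bip, of \<phi> v] p(2) by simp
    ultimately show ?thesis by (simp add: dart_colorings_def)
  qed
  have sup: "c \<in> colored ` {\<phi>\<in>order_labellings M. wt M \<phi> = m}" if c: "c \<in> dart_colorings n r a (root_dart M) m" for c
  proof -
    have inv: "r \<in> invar c D" and g: "good_coloring n a (root_dart M) c" and cE: "c \<in> D \<rightarrow>\<^sub>E UNIV"
      and cnt: "\<And>v. card (orbit r ` {x\<in>D. c x = v}) = Poly_Mapping.lookup m v"
      using c by (auto simp: dart_colorings_def)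
    have bl: "vx d \<in> ?B \<longleftrightarrow> is_Q (c d)" if "d \<in> D" for d using coloring_black(2)[OF c that] .
    \<comment> \<open>Any dart of the vertex serves, because the colouring is constant on
      orbits.\<close>
    define \<phi> where "\<phi> = (\<lambda>v\<in>vertices M. var_index (c (SOME x. x \<in> v)))"
    have ph: "\<phi> (vx d) = var_index (c d)" if d: "d \<in> D" for d
    proof -
      have "(SOME x. x \<in> vx d) \<in> vx d" using vx_self by (rule someI)
      then have "c (SOME x. x \<in> vx d) = c d" using invar_const_orbit[OF inv d] by (simp add: vx_orbit)
      then show ?thesis using vx_verts[OF d] by (simp add: \<phi>_def)
    qed
    have cphi: "colored \<phi> = c"
    proof
      fix d show "colored \<phi> d = c d"
      proof (cases "d \<in> D")
        case True
        then show ?thesis unfolding col[OF True] ph[OF True] using bl[OF True] var_eq[of "c d"] by simp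
      next
        case False then show ?thesis using PiE_arb[OF cE False] by (auto simp: colored_def)
      qed
    qed
    have "\<phi> \<in> vertices M \<rightarrow>\<^sub>E {1..}"
    proof (rule PiE_I)
      fix v assume "v \<in> vertices M"
      then obtain d where d: "d \<in> D" "v = vx d" by (auto simp: verts vx_orbit)
      then show "\<phi> v \<in> {1..}" using ph[OF d(1)] g by (simp add: good_coloring_def)
    qed (simp add: \<phi>_def)
    moreover have "order_condition M \<phi>" unfolding order_condition_iff[OF bip]
      using bl ph a_in g by (simp add: good_coloring_def)
    moreover have "wt M \<phi> = m"
    proof (rule poly_mapping_eqI)
      fix v show "Poly_Mapping.lookup (wt M \<phi>) v = Poly_Mapping.lookup m v"
        unfolding lookup_wt[OF bip] cphi by (rule cnt)
    qed
    ultimately show ?thesis using cphi by (intro image_eqI[of _ _ \<phi>]) (auto simp: order_labellings_def)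
  qed
  show ?thesis unfolding bij_betw_def using inj sub sup by blast
qed

lemma card_labellings:
  "finite {\<phi>\<in>order_labellings M. wt M \<phi> = m} \<or> \<not> bipartite M"
  "(if bipartite M then card {\<phi>\<in>order_labellings M. wt M \<phi> = m} else 0) = card (dart_colorings n r a (root_dart M) m)"
proof -
  show "finite {\<phi>\<in>order_labellings M. wt M \<phi> = m} \<or> \<not> bipartite M"
    using bij_betw_finite[OF colored_bij] finite_dart_colorings by blast
  have "dart_colorings n r a (root_dart M) m = {}" if "\<not> bipartite M" using coloring_black(1) that by blast
  then show "(if bipartite M then card {\<phi>\<in>order_labellings M. wt M \<phi> = m} else 0) = card (dart_colorings n r a (root_dart M) m)"
    using bij_betw_same_card[OF colored_bij] by auto
qed

section \<open>Euler's relation and the bipartiteness of plane trees\<close>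

lemma card_edges: "card (edges M) = n"
proof -
  have aa: "a (a d) = d" "a d \<noteq> d" if "d \<in> D" for d using L(4)[of d] that by auto
  have "D = \<Union>(edges M)" using a_in L(1) by (auto simp: edges_def)
  then have "2 * n = card (\<Union>(edges M))" by (metis card_lessThan)
  also have "\<dots> = (\<Sum>e\<in>edges M. card e)"
  proof (rule card_Union_disjoint)
    show "pairwise disjnt (edges M)"
      unfolding pairwise_def disjnt_def edges_def L(1) using aa by (auto; metis)
    show "finite e" if "e \<in> edges M" for e using that by (auto simp: edges_def)
  qed
  also have "\<dots> = (\<Sum>e\<in>edges M. 2)"
  proof (rule sum.cong[OF refl])
    fix e assume "e \<in> edges M"
    then obtain d where "d \<in> D" "e = {d, a d}" using L(1) by (auto simp: edges_def)
    then show "card e = 2" using aa(2)[of d] by (metis card_2_iff)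
  qed
  finally show ?thesis by simp
qed

lemma unicellular_iff: "unicellular M \<longleftrightarrow> one_orbit (r \<circ> a) D" if n: "n \<ge> 1"
proof -
  have p: "r \<circ> a permutes D" using L(3,2) by (rule permutes_compose)
  have f: "faces M = orbit (r \<circ> a) ` D" by (simp add: faces_def L(1))
  show ?thesis unfolding unicellular_def f
  proof
    assume "card (orbit (r \<circ> a) ` D) = 1"
    then obtain X where X: "orbit (r \<circ> a) ` D = {X}" by (auto simp: card_1_singleton_iff)
    show "one_orbit (r \<circ> a) D" unfolding one_orbit_def
    proof
      fix x assume x: "x \<in> D"
      have "orbit (r \<circ> a) y = X" if "y \<in> D" for y using X that by blast
      then have "y \<in> orbit (r \<circ> a) x" if "y \<in> D" for y
        using perm_self_in_orbit[OF finite_lessThan p, of y] that x by simp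
      then show "orbit (r \<circ> a) x = D" using orbit_sub[OF p x] by blast
    qed
  next
    assume "one_orbit (r \<circ> a) D"
    then have "orbit (r \<circ> a) ` D = {D}" using n by (force simp: one_orbit_def)
    then show "card (orbit (r \<circ> a) ` D) = 1" by simp
  qed
qed

lemma plane_tree_iff: "unicellular M \<and> has_genus M 0 \<longleftrightarrow> r \<in> tree_rotations D a" if n: "n \<ge> 1"
proof -
  have "has_genus M 0 \<longleftrightarrow> card (orbit r ` D) = n + 1" if "unicellular M"
    using that card_edges by (auto simp: has_genus_def unicellular_def verts)
  then show ?thesis using unicellular_iff[OF n] L(2) by (auto simp: tree_rotations_def)
qed

text \<open>\<open>plane_trees\<close> does not ask for bipartiteness, whereas
  \<open>black_vertices\<close> is meaningful only under it. The two colours are the parities of the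
  depth in the parent function supplied by \<open>tree_blocks\<close>.\<close>

lemma tree_bipartite:
  assumes n: "n \<ge> 1" and tr: "r \<in> tree_rotations D a"
  shows "bipartite M"
proof -
  let ?l = "2 * n"
  \<comment> \<open>\<open>tree_blocks\<close> speaks of maps with a leg. One will be spliced in
    before the root dart, and all darts receive the same colour.\<close>
  interpret leg_map D a ?l "\<lambda>_. ()"
  proof
    show "D \<noteq> {}" using n by (auto simp: lessThan_empty_iff)
    then show "() \<in> (\<lambda>_. ()) ` D" by blast
    show "a x \<in> D \<and> a (a x) = x \<and> a x \<noteq> x" if "x \<in> D" for x using L(4)[OF that] a_in[OF that] by simp
    show "a x = x" if "x \<notin> D" for x using permutes_not_in[OF L(3) that] .
  qed auto
  have l: "?l \<notin> D" by simp
  have d: "root_dart M \<in> D" by (rule L(6))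
  let ?g = "transpose ?l (root_dart M) \<circ> r"
  have gp: "?g permutes Dp" unfolding Dp_def
    using L(2) d by (intro permutes_compose permutes_imp_permutes_insert permutes_swap_id) auto
  have "one_orbit (?g \<circ> a) Dp"
    using one_orbit_transpose_insert[OF finD permutes_compose[OF L(3,2)] l d] tr
    by (simp add: tree_rotations_def Dp_def o_assoc)
  moreover have "card (orbit ?g ` Dp) = card D div 2 + 1"
    using card_orbits_transpose_insert(2)[OF finD L(2) l d order_refl d] tr by (simp add: tree_rotations_def Dp_def)
  ultimately have "?g \<in> trees" using gp by (simp add: trees_def invar_def)
  then obtain H f where H: "H \<in> halves" "f \<in> flow_trees H local.t (\<lambda>_. ()) ?l id" "blocks ?g H f" using tree_blocks by blast
  let ?rep = "rep H f"
  define b where "b x = even (funpow_dist f (?rep x) ?l)" for x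
  have rb: "b y = b x" if "x \<in> D" "y \<in> vx x" for x y
  proof -
    have xy: "x \<in> Dp" "y \<in> Dp" using that vx_sub by (auto simp: Dp_def)
    have "y \<in> orbit ?g x" using transpose_insert_orbit[OF finD L(2) l d that(1)] that(2) by (auto simp: vx_orbit)
    then have "?rep y = ?rep x" using H(3) xy by (simp add: blocks_def)
    then show ?thesis by (simp add: b_def)
  qed
  have step: "b (f q) \<longleftrightarrow> \<not> b q" if q: "q \<in> H - {?l}" for q
  proof -
    have fq: "f q \<in> H" using pfD(1)[OF H(2) q] by simp
    have "funpow_dist f q ?l = Suc (funpow_dist f (f q) ?l)"
      using pfD(2)[OF H(2), of q] q by (intro reach_dist) auto
    then show ?thesis using fq q by (simp add: b_def rep_def)
  qed
  have reprep: "b (?rep x) = b x" if "x \<in> Dp" for x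
    using rep_mem[OF H(1,2) that] by (simp add: b_def rep_def)
  have alt: "b (a x) \<longleftrightarrow> \<not> b x" if x: "x \<in> D" for x
  proof (cases "x \<in> H")
    case True
    then have q: "x \<in> H - {?l}" using x by simp
    have "?rep (a x) = f x" using halvesD(6)[OF H(1) q] by (simp add: rep_def opp_opp)
    then show ?thesis using step[OF q] reprep[of "a x"] a_in[OF x] by (simp add: Dp_def)
  next
    case False
    have xd: "x \<in> Dp" using x by (simp add: Dp_def)
    have q: "a x \<in> H - {?l}" using halvesD(7)[OF H(1) xd False] .
    have "?rep x = f (a x)" using False by (simp add: rep_def)
    then show ?thesis using step[OF q] reprep[OF xd] by metis
  qed
  have mem: "vx d \<in> vx ` {d\<in>D. b d} \<longleftrightarrow> b d" if d: "d \<in> D" for d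
  proof
    assume "vx d \<in> vx ` {d\<in>D. b d}"
    then obtain e where e: "e \<in> D" "b e" "vx d = vx e" by auto
    then show "b d" using rb[OF e(1), of d] vx_self[of d] by simp
  qed (use d in auto)
  have "color_class M (vx ` {d\<in>D. b d})" unfolding color_class_def L(1)
    using mem alt a_in vx_verts by auto
  then show ?thesis by (auto simp: bipartite_def)
qed

end

section \<open>Summation over labelled maps\<close>

lemma sum_Sigma_flat:
  "finite A \<Longrightarrow> (\<And>x. x \<in> A \<Longrightarrow> finite (B x)) \<Longrightarrow> (\<Sum>u\<in>Sigma A B. h u) = (\<Sum>x\<in>A. \<Sum>y\<in>B x. h (x, y))"
  by (simp add: sum.Sigma)

section \<open>Conjugation by a relabelling\<close>

lemma orbit_conj:
  assumes "finite D" "f permutes D" "\<sigma> permutes D"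
  shows "orbit (\<sigma> \<circ> f \<circ> inv \<sigma>) (\<sigma> x) = \<sigma> ` orbit f x"
  using perm_self_in_orbit[OF assms(1,2)] permutes_inverses[OF assms(3)]
  by (intro orbit_inverse[symmetric]) auto

lemma card_orbits_conj:
  assumes "finite D" "f permutes D" "\<sigma> permutes D"
  shows "card (orbit (\<sigma> \<circ> f \<circ> inv \<sigma>) ` \<sigma> ` S) = card (orbit f ` S)"
proof -
  have "orbit (\<sigma> \<circ> f \<circ> inv \<sigma>) ` \<sigma> ` S = image \<sigma> ` orbit f ` S"
    by (simp add: image_image orbit_conj[OF assms])
  moreover have "inj (image \<sigma>)" by (rule injI) (simp add: inj_image_eq_iff[OF permutes_inj[OF assms(3)]])
  ultimately show ?thesis by (simp add: card_image inj_on_subset[OF _ subset_UNIV])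
qed

lemma one_orbit_conj:
  assumes "finite D" "f permutes D" "\<sigma> permutes D"
  shows "one_orbit (\<sigma> \<circ> f \<circ> inv \<sigma>) D \<longleftrightarrow> one_orbit f D"
proof -
  have im: "\<sigma> ` D = D" using assms(3) by (rule permutes_image)
  have "one_orbit (\<sigma> \<circ> f \<circ> inv \<sigma>) D \<longleftrightarrow> (\<forall>x\<in>\<sigma> ` D. orbit (\<sigma> \<circ> f \<circ> inv \<sigma>) x = \<sigma> ` D)"
    unfolding one_orbit_def im ..
  also have "\<dots> \<longleftrightarrow> (\<forall>x\<in>D. \<sigma> ` orbit f x = \<sigma> ` D)" by (simp add: orbit_conj[OF assms])
  also have "\<dots> \<longleftrightarrow> one_orbit f D"
    unfolding one_orbit_def using inj_image_eq_iff[OF permutes_inj[OF assms(3)]] by simp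
  finally show ?thesis .
qed

lemma card_dart_colorings_relabel:
  assumes M: "M \<in> labelled_maps n" and s: "\<sigma> permutes {..<2 * n}"
  shows "card (dart_colorings n (rot (relabel n \<sigma> M)) (opp (relabel n \<sigma> M)) (root_dart (relabel n \<sigma> M)) m)
    = card (dart_colorings n (rot M) (opp M) (root_dart M) m)"
proof -
  let ?D = "{..<2 * n}"
  note L = labelledD[OF M]
  let ?N = "relabel n \<sigma> M"
  let ?S = "dart_colorings n (rot M) (opp M) (root_dart M) m"
  let ?S' = "dart_colorings n (rot ?N) (opp ?N) (root_dart ?N) m"
  have invp: "inv \<sigma> permutes ?D" using s by (rule permutes_inv)
  have i1: "inv \<sigma> (\<sigma> x) = x" "\<sigma> (inv \<sigma> x) = x" for x using permutes_inverses[OF s] by simp_all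
  have inD: "\<sigma> x \<in> ?D \<longleftrightarrow> x \<in> ?D" "inv \<sigma> x \<in> ?D \<longleftrightarrow> x \<in> ?D" for x
    using permutes_in_image[OF s] permutes_in_image[OF invp] by blast+
  have N: "rot ?N = \<sigma> \<circ> rot M \<circ> inv \<sigma>" "opp ?N = \<sigma> \<circ> opp M \<circ> inv \<sigma>" "root_dart ?N = \<sigma> (root_dart M)"
    by (simp_all add: relabel_def)
  have Np: "rot ?N permutes ?D" using labelledD(2)[OF relabel_labelled(1)[OF M s]] .
  have key: "c \<circ> inv \<sigma> \<in> ?S' \<longleftrightarrow> c \<in> ?S" for c
  proof -
    have ex: "c \<circ> inv \<sigma> \<in> ?D \<rightarrow>\<^sub>E UNIV \<longleftrightarrow> c \<in> ?D \<rightarrow>\<^sub>E UNIV"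
      unfolding PiE_def extensional_def using inD i1 by (simp add: Pi_def) (metis i1)
    have all: "(\<forall>x\<in>?D. P x) \<longleftrightarrow> (\<forall>x\<in>?D. P (\<sigma> x))" for P
    proof -
      have "(\<forall>x\<in>?D. P x) \<longleftrightarrow> (\<forall>x\<in>\<sigma> ` ?D. P x)" unfolding permutes_image[OF s] ..
      then show ?thesis by blast
    qed
    have iv: "rot ?N \<in> invar (c \<circ> inv \<sigma>) ?D \<longleftrightarrow> rot M \<in> invar c ?D"
      using Np L(2) all[of "\<lambda>x. (c \<circ> inv \<sigma>) (rot ?N x) = (c \<circ> inv \<sigma>) x"]
      by (simp add: invar_def N i1)
    have gd: "good_coloring n (opp ?N) (root_dart ?N) (c \<circ> inv \<sigma>) \<longleftrightarrow> good_coloring n (opp M) (root_dart M) c"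
      unfolding good_coloring_def
      by (subst all) (simp add: N i1)
    have "{x\<in>?D. (c \<circ> inv \<sigma>) x = v} = \<sigma> ` {x\<in>?D. c x = v}" for v
    proof
      show "{x\<in>?D. (c \<circ> inv \<sigma>) x = v} \<subseteq> \<sigma> ` {x\<in>?D. c x = v}"
      proof
        fix x assume "x \<in> {x\<in>?D. (c \<circ> inv \<sigma>) x = v}"
        then have "inv \<sigma> x \<in> {x\<in>?D. c x = v}" using inD(2)[of x] by simp
        then have "\<sigma> (inv \<sigma> x) \<in> \<sigma> ` {x\<in>?D. c x = v}" by (rule imageI)
        then show "x \<in> \<sigma> ` {x\<in>?D. c x = v}" by (simp add: i1)
      qed
      show "\<sigma> ` {x\<in>?D. c x = v} \<subseteq> {x\<in>?D. (c \<circ> inv \<sigma>) x = v}"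
      proof (rule image_subsetI)
        fix x assume "x \<in> {x\<in>?D. c x = v}"
        then show "\<sigma> x \<in> {x\<in>?D. (c \<circ> inv \<sigma>) x = v}" using inD(1)[of x] i1(1)[of x] by simp
      qed
    qed
    then have ct: "card (orbit (rot ?N) ` {x\<in>?D. (c \<circ> inv \<sigma>) x = v}) = card (orbit (rot M) ` {x\<in>?D. c x = v})" for v
      unfolding N using card_orbits_conj[OF finite_lessThan L(2) s] by simp
    show ?thesis unfolding dart_colorings_def mem_Collect_eq ex iv gd ct ..
  qed
  have "bij_betw (\<lambda>c. c \<circ> inv \<sigma>) ?S ?S'"
  proof (rule bij_betw_byWitness[where f' = "\<lambda>c. c \<circ> \<sigma>"])
    show "(\<lambda>c. c \<circ> inv \<sigma>) ` ?S \<subseteq> ?S'" using key by blast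
    show "(\<lambda>c. c \<circ> \<sigma>) ` ?S' \<subseteq> ?S"
    proof (rule image_subsetI)
      fix c assume "c \<in> ?S'"
      moreover have "(c \<circ> \<sigma>) \<circ> inv \<sigma> = c" by (simp add: fun_eq_iff i1)
      ultimately show "c \<circ> \<sigma> \<in> ?S" using key[of "c \<circ> \<sigma>"] by simp
    qed
  qed (simp_all add: fun_eq_iff i1)
  then show ?thesis by (metis bij_betw_same_card)
qed

section \<open>Maps as triples of involution, root dart and rotation\<close>

definition involutions :: "nat \<Rightarrow> (nat \<Rightarrow> nat) set" where
  "involutions n = {\<alpha>. \<alpha> permutes {..<2 * n} \<and> (\<forall>x\<in>{..<2 * n}. \<alpha> x \<noteq> x \<and> \<alpha> (\<alpha> x) = x)}"

lemma finite_involutions: "finite (involutions n)"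
  by (rule finite_subset[OF _ finite_permutations[of "{..<2 * n}"]]) (auto simp: involutions_def)

definition unicellular_rotations :: "nat \<Rightarrow> (nat \<Rightarrow> nat) \<Rightarrow> (nat \<Rightarrow> nat) set" where
  "unicellular_rotations n \<alpha> = {\<rho>. \<rho> permutes {..<2 * n} \<and> one_orbit (\<rho> \<circ> \<alpha>) {..<2 * n}}"

lemma finite_unicellular_rotations: "finite (unicellular_rotations n \<alpha>)"
  by (rule finite_subset[OF _ finite_permutations[of "{..<2 * n}"]]) (auto simp: unicellular_rotations_def)

text \<open>A single face passes through all darts, and each of its steps is a step of the
  involution followed by one of the rotation; connectedness is automatic.\<close>

lemma labelled_of_rotation:
  assumes "\<alpha> \<in> involutions n" "d0 \<in> {..<2 * n}" "\<rho> \<in> unicellular_rotations n \<alpha>"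
  shows "\<lparr>darts = {..<2 * n}, rot = \<rho>, opp = \<alpha>, root_dart = d0\<rparr> \<in> labelled_maps n"
proof -
  let ?M = "\<lparr>darts = {..<2 * n}, rot = \<rho>, opp = \<alpha>, root_dart = d0\<rparr>"
  let ?R = "{(x, y). x \<in> {..<2 * n} \<and> (y = \<rho> x \<or> y = \<alpha> x)}"
  have ap: "\<alpha> permutes {..<2 * n}" using assms by (simp add: involutions_def)
  have rp: "\<rho> permutes {..<2 * n}" and o: "one_orbit (\<rho> \<circ> \<alpha>) {..<2 * n}"
    using assms by (simp_all add: unicellular_rotations_def)
  have st: "(d, (\<rho> \<circ> \<alpha>) d) \<in> ?R\<^sup>*" if d: "d \<in> {..<2 * n}" for d
  proof -
    have "(d, \<alpha> d) \<in> ?R" using d by simp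
    moreover have "(\<alpha> d, \<rho> (\<alpha> d)) \<in> ?R" using permutes_in_image[OF ap] d by simp
    ultimately have "(d, \<rho> (\<alpha> d)) \<in> ?R\<^sup>*" by (rule rtrancl_trans[OF r_into_rtrancl r_into_rtrancl])
    then show ?thesis by (simp only: comp_apply)
  qed
  have "(d, d') \<in> ?R\<^sup>*" if d: "d \<in> {..<2 * n}" and d': "d' \<in> {..<2 * n}" for d d'
  proof -
    have "d' \<in> orbit (\<rho> \<circ> \<alpha>) d" using o d d' by (simp add: one_orbit_def)
    then show ?thesis
    proof induction
      case base show ?case using st[OF d] .
    next
      case (step y)
      have "y \<in> {..<2 * n}" using step.hyps orbit_sub[OF permutes_compose[OF ap rp] d] by blast
      then show ?case using step.IH st by (meson rtrancl_trans)
    qed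
  qed
  then have "connected_map ?M" by (simp add: connected_map_def)
  then show ?thesis using assms ap rp by (simp add: labelled_maps_def rooted_map_def involutions_def)
qed

text \<open>Grouping by involution and root dart makes the rotation the innermost variable. Only
  unicellular rotations contribute, and each of them gives a connected map.\<close>

lemma sum_labelled_maps:
  fixes G :: "(nat \<Rightarrow> nat) \<Rightarrow> (nat \<Rightarrow> nat) \<Rightarrow> nat \<Rightarrow> nat"
  assumes "\<And>\<rho> \<alpha> d0. \<rho> \<notin> unicellular_rotations n \<alpha> \<Longrightarrow> G \<rho> \<alpha> d0 = 0"
  shows "(\<Sum>M\<in>labelled_maps n. G (rot M) (opp M) (root_dart M))
    = (\<Sum>\<alpha>\<in>involutions n. \<Sum>d0\<in>{..<2 * n}. \<Sum>\<rho>\<in>unicellular_rotations n \<alpha>. G \<rho> \<alpha> d0)"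
proof -
  let ?D = "{..<2 * n}"
  let ?U = "{M\<in>labelled_maps n. rot M \<in> unicellular_rotations n (opp M)}"
  let ?T = "SIGMA \<alpha>:involutions n. SIGMA d0:?D. unicellular_rotations n \<alpha>"
  let ?f = "\<lambda>(\<alpha>, d0, \<rho>). \<lparr>darts = ?D, rot = \<rho>, opp = \<alpha>, root_dart = d0\<rparr> :: nat rmap"
  have bij: "bij_betw ?f ?T ?U"
  proof (rule bij_betw_byWitness[where f' = "\<lambda>M. (opp M, root_dart M, rot M)"])
    show "\<forall>u\<in>?T. (opp (?f u), root_dart (?f u), rot (?f u)) = u" by auto
    show "\<forall>M\<in>?U. ?f (opp M, root_dart M, rot M) = M"
      using labelledD(1) by fastforce
    show "?f ` ?T \<subseteq> ?U" using labelled_of_rotation by auto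
    show "(\<lambda>M. (opp M, root_dart M, rot M)) ` ?U \<subseteq> ?T"
    proof (rule image_subsetI)
      fix M assume M: "M \<in> ?U"
      then have "M \<in> labelled_maps n" by simp
      note L = labelledD[OF this]
      show "(opp M, root_dart M, rot M) \<in> ?T" using L(3,4,6) M by (auto simp: involutions_def)
    qed
  qed
  have "(\<Sum>M\<in>labelled_maps n. G (rot M) (opp M) (root_dart M)) = (\<Sum>M\<in>?U. G (rot M) (opp M) (root_dart M))"
    using finite_labelled_maps assms by (intro sum.mono_neutral_right) auto
  also have "\<dots> = (\<Sum>u\<in>?T. G (rot (?f u)) (opp (?f u)) (root_dart (?f u)))"
    by (rule sum.reindex_bij_betw[OF bij, symmetric])
  also have "\<dots> = (\<Sum>\<alpha>\<in>involutions n. \<Sum>d0\<in>?D. \<Sum>\<rho>\<in>unicellular_rotations n \<alpha>. G \<rho> \<alpha> d0)"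
    using finite_involutions finite_unicellular_rotations by (simp add: sum_Sigma_flat)
  finally show ?thesis .
qed

text \<open>The conditions on a dart colouring that do not involve the rotation; they allow the
  colouring to be fixed before the rotations are counted.\<close>

definition root_colorings :: "nat \<Rightarrow> (nat \<Rightarrow> nat) \<Rightarrow> nat \<Rightarrow> var set \<Rightarrow> (nat \<Rightarrow> var) set" where
  "root_colorings n \<alpha> d0 K = {c \<in> {..<2 * n} \<rightarrow>\<^sub>E UNIV. good_coloring n \<alpha> d0 c \<and> c ` {..<2 * n} = K}"

lemma finite_root_colorings: "finite K \<Longrightarrow> finite (root_colorings n \<alpha> d0 K)"
  by (rule finite_subset[OF _ finite_PiE[of "{..<2 * n}" "\<lambda>_. K"]]) (auto simp: root_colorings_def PiE_def)

definition orbit_count :: "nat \<Rightarrow> (nat \<Rightarrow> nat) \<Rightarrow> (nat \<Rightarrow> var) \<Rightarrow> var \<Rightarrow> nat" where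
  "orbit_count n \<rho> c v = card (orbit \<rho> ` {x\<in>{..<2 * n}. c x = v})"

lemma sum_card_dart_colorings:
  assumes X: "finite X"
  shows "(\<Sum>\<rho>\<in>X. card (dart_colorings n \<rho> \<alpha> d0 m))
    = (\<Sum>c\<in>root_colorings n \<alpha> d0 (Poly_Mapping.keys m).
         card {\<rho>\<in>invar c {..<2 * n} \<inter> X. \<forall>v\<in>c ` {..<2 * n}. orbit_count n \<rho> c v = Poly_Mapping.lookup m v})"
proof -
  let ?C = "root_colorings n \<alpha> d0 (Poly_Mapping.keys m)"
  let ?Q = "\<lambda>\<rho> c. \<rho> \<in> invar c {..<2 * n} \<and> (\<forall>v\<in>c ` {..<2 * n}. orbit_count n \<rho> c v = Poly_Mapping.lookup m v)"
  have fC: "finite ?C" by (simp add: finite_root_colorings)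
  have "dart_colorings n \<rho> \<alpha> d0 m = {c\<in>?C. ?Q \<rho> c}" for \<rho>
    unfolding dart_colorings_def root_colorings_def counts_iff[OF finite_lessThan] orbit_count_def by blast
  then have "(\<Sum>\<rho>\<in>X. card (dart_colorings n \<rho> \<alpha> d0 m)) = (\<Sum>\<rho>\<in>X. \<Sum>c\<in>?C. if ?Q \<rho> c then 1 else 0)"
    using fC by (simp add: sum.If_cases Int_def)
  also have "\<dots> = (\<Sum>c\<in>?C. \<Sum>\<rho>\<in>X. if ?Q \<rho> c then 1 else 0)" by (rule sum.swap)
  also have "\<dots> = (\<Sum>c\<in>?C. card {\<rho>\<in>X. ?Q \<rho> c})"
    using X by (simp add: sum.If_cases Int_def)
  also have "\<dots> = (\<Sum>c\<in>?C. card {\<rho>\<in>invar c {..<2 * n} \<inter> X. \<forall>v\<in>c ` {..<2 * n}. orbit_count n \<rho> c v = Poly_Mapping.lookup m v})"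
    by (intro sum.cong refl arg_cong[where f = card]) blast
  finally show ?thesis .
qed

lemma tree_rotations_sub: "tree_rotations {..<2 * n} \<alpha> \<subseteq> unicellular_rotations n \<alpha>"
  by (auto simp: tree_rotations_def unicellular_rotations_def)

lemma weight_series_eq:
  assumes "S \<subseteq> labelled_maps n" "\<And>M. M \<in> S \<Longrightarrow> bipartite M"
  shows "weight_series S m = int (\<Sum>M\<in>S. card (dart_colorings n (rot M) (opp M) (root_dart M) m))"
proof -
  have fin: "finite S" using assms(1) finite_labelled_maps by (rule finite_subset)
  have M: "finite {\<phi>\<in>order_labellings M. wt M \<phi> = m}"
    "card {\<phi>\<in>order_labellings M. wt M \<phi> = m} = card (dart_colorings n (rot M) (opp M) (root_dart M) m)" if "M \<in> S" for M
  proof -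
    interpret labelled_map n M by unfold_locales (use assms that in blast)
    show "finite {\<phi>\<in>order_labellings M. wt M \<phi> = m}"
      "card {\<phi>\<in>order_labellings M. wt M \<phi> = m} = card (dart_colorings n (rot M) (opp M) (root_dart M) m)"
      using card_labellings[of m] assms(2)[OF that] by simp_all
  qed
  have "{(M, \<phi>). M \<in> S \<and> \<phi> \<in> order_labellings M \<and> wt M \<phi> = m} = (SIGMA M:S. {\<phi>\<in>order_labellings M. wt M \<phi> = m})" by auto
  then have "weight_series S m = int (card (SIGMA M:S. {\<phi>\<in>order_labellings M. wt M \<phi> = m}))"
    by (simp add: weight_series_def)
  also have "card (SIGMA M:S. {\<phi>\<in>order_labellings M. wt M \<phi> = m}) = (\<Sum>M\<in>S. card {\<phi>\<in>order_labellings M. wt M \<phi> = m})"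
    using fin M(1) by (intro card_SigmaI) auto
  also have "\<dots> = (\<Sum>M\<in>S. card (dart_colorings n (rot M) (opp M) (root_dart M) m))"
    using M(2) by (intro sum.cong) auto
  finally show ?thesis .
qed

text \<open>Multiplication by the number of labellings gives a sum over an involution, a root dart
  and a colouring, for each of which rotations are counted in the form of
  \<open>unicellular_tree_refined\<close>.\<close>

lemma series_labelled:
  fixes T :: "(nat \<Rightarrow> nat) \<Rightarrow> (nat \<Rightarrow> nat) set"
  assumes T: "\<And>\<alpha>. T \<alpha> \<subseteq> unicellular_rotations n \<alpha>"
    and inv: "\<And>M \<sigma>. M \<in> labelled_maps n \<Longrightarrow> \<sigma> permutes {..<2 * n} \<Longrightarrow>
        rot (relabel n \<sigma> M) \<in> T (opp (relabel n \<sigma> M)) \<longleftrightarrow> rot M \<in> T (opp M)"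
  shows "fact (2 * n) * (\<Sum>M\<in>{M\<in>rooted_maps n. rot M \<in> T (opp M)}. card (dart_colorings n (rot M) (opp M) (root_dart M) m))
    = (\<Sum>\<alpha>\<in>involutions n. \<Sum>d0<2 * n. \<Sum>c\<in>root_colorings n \<alpha> d0 (Poly_Mapping.keys m).
         card {\<rho>\<in>invar c {..<2 * n} \<inter> T \<alpha>. \<forall>v\<in>c ` {..<2 * n}. orbit_count n \<rho> c v = Poly_Mapping.lookup m v})"
proof -
  define G where "G \<rho> \<alpha> d0 = (if \<rho> \<in> T \<alpha> then card (dart_colorings n \<rho> \<alpha> d0 m) else 0)" for \<rho> \<alpha> d0
  have finT: "finite (T \<alpha>)" for \<alpha> using T finite_unicellular_rotations by (rule finite_subset)
  have finR: "finite (rooted_maps n)" using rooted_maps_reps(1) finite_labelled_maps by (rule finite_subset)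
  have "(\<Sum>M\<in>{M\<in>rooted_maps n. rot M \<in> T (opp M)}. card (dart_colorings n (rot M) (opp M) (root_dart M) m))
     = (\<Sum>M\<in>rooted_maps n. G (rot M) (opp M) (root_dart M))"
    unfolding G_def by (rule sum.inter_filter[OF finR])
  also have "fact (2 * n) * \<dots> = (\<Sum>M\<in>labelled_maps n. G (rot M) (opp M) (root_dart M))"
  proof (rule sum_rooted_maps)
    fix M \<sigma> assume a: "M \<in> labelled_maps n" "\<sigma> permutes {..<2 * n}"
    show "G (rot (relabel n \<sigma> M)) (opp (relabel n \<sigma> M)) (root_dart (relabel n \<sigma> M)) = G (rot M) (opp M) (root_dart M)"
      unfolding G_def inv[OF a] card_dart_colorings_relabel[OF a] ..
  qed
  also have "\<dots> = (\<Sum>\<alpha>\<in>involutions n. \<Sum>d0\<in>{..<2 * n}. \<Sum>\<rho>\<in>unicellular_rotations n \<alpha>. G \<rho> \<alpha> d0)"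
    by (rule sum_labelled_maps) (use T in \<open>auto simp: G_def\<close>)
  also have "\<dots> = (\<Sum>\<alpha>\<in>involutions n. \<Sum>d0\<in>{..<2 * n}. \<Sum>\<rho>\<in>T \<alpha>. card (dart_colorings n \<rho> \<alpha> d0 m))"
    unfolding G_def using T finite_unicellular_rotations
    by (intro sum.cong refl sum.mono_neutral_cong_right) auto
  finally show ?thesis by (simp only: sum_card_dart_colorings[OF finT])
qed

lemma relabel_unicellular:
  assumes M: "M \<in> labelled_maps n" and s: "\<sigma> permutes {..<2 * n}"
  shows "rot (relabel n \<sigma> M) \<in> unicellular_rotations n (opp (relabel n \<sigma> M)) \<longleftrightarrow> rot M \<in> unicellular_rotations n (opp M)"
    and "rot (relabel n \<sigma> M) \<in> tree_rotations {..<2 * n} (opp (relabel n \<sigma> M)) \<longleftrightarrow> rot M \<in> tree_rotations {..<2 * n} (opp M)"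
proof -
  let ?D = "{..<2 * n}"
  let ?N = "relabel n \<sigma> M"
  note L = labelledD[OF M] and K = labelledD[OF relabel_labelled(1)[OF M s]]
  have "rot ?N \<circ> opp ?N = \<sigma> \<circ> (rot M \<circ> opp M) \<circ> inv \<sigma>"
    using permutes_inverses[OF s] by (simp add: relabel_def fun_eq_iff)
  then have 1: "one_orbit (rot ?N \<circ> opp ?N) ?D \<longleftrightarrow> one_orbit (rot M \<circ> opp M) ?D"
    using one_orbit_conj[OF finite_lessThan permutes_compose[OF L(3,2)] s] by simp
  have "card (orbit (\<sigma> \<circ> rot M \<circ> inv \<sigma>) ` \<sigma> ` ?D) = card (orbit (rot M) ` ?D)"
    by (rule card_orbits_conj[OF finite_lessThan L(2) s])
  then have 2: "card (orbit (rot ?N) ` ?D) = card (orbit (rot M) ` ?D)"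
    using permutes_image[OF s] by (simp add: relabel_def)
  show "rot ?N \<in> unicellular_rotations n (opp ?N) \<longleftrightarrow> rot M \<in> unicellular_rotations n (opp M)"
    and "rot ?N \<in> tree_rotations ?D (opp ?N) \<longleftrightarrow> rot M \<in> tree_rotations ?D (opp M)"
    using L(2) K(2) 1 2 by (simp_all add: unicellular_rotations_def tree_rotations_def)
qed

lemma F_series_labelled:
  assumes n: "n \<ge> 1"
  shows "fact (2 * n) * F_series n m = int (\<Sum>\<alpha>\<in>involutions n. \<Sum>d0<2 * n. \<Sum>c\<in>root_colorings n \<alpha> d0 (Poly_Mapping.keys m).
         card {\<rho>\<in>invar c {..<2 * n} \<inter> unicellular_rotations n \<alpha>. \<forall>v\<in>c ` {..<2 * n}. orbit_count n \<rho> c v = Poly_Mapping.lookup m v})"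
proof -
  let ?S = "{M \<in> rooted_maps n. unicellular M \<and> bipartite M}"
  let ?U = "{M\<in>rooted_maps n. rot M \<in> unicellular_rotations n (opp M)}"
  let ?w = "\<lambda>M. card (dart_colorings n (rot M) (opp M) (root_dart M) m)"
  note R = rooted_maps_reps(1)[of n]
  have finU: "finite ?U" using finite_subset[OF R finite_labelled_maps] by simp
  have U: "unicellular M \<longleftrightarrow> rot M \<in> unicellular_rotations n (opp M)" "\<not> bipartite M \<Longrightarrow> ?w M = 0" if "M \<in> rooted_maps n" for M
  proof -
    interpret labelled_map n M by unfold_locales (use R that in blast)
    show "unicellular M \<longleftrightarrow> rot M \<in> unicellular_rotations n (opp M)"
      using unicellular_iff[OF n] L(2) by (simp add: unicellular_rotations_def)
    show "?w M = 0" if "\<not> bipartite M" using card_labellings(2)[of m] that by simp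
  qed
  have "F_series n m = int (\<Sum>M\<in>?S. ?w M)"
    unfolding F_series_def by (rule weight_series_eq) (use R in auto)
  \<comment> \<open>Maps that are not bipartite have no dart colourings and add 0.\<close>
  also have "(\<Sum>M\<in>?S. ?w M) = (\<Sum>M\<in>?U. ?w M)"
    using finU U by (intro sum.mono_neutral_left) auto
  finally have "fact (2 * n) * F_series n m = int (fact (2 * n) * (\<Sum>M\<in>?U. ?w M))" by simp
  moreover have "fact (2 * n) * (\<Sum>M\<in>?U. ?w M) = (\<Sum>\<alpha>\<in>involutions n. \<Sum>d0<2 * n. \<Sum>c\<in>root_colorings n \<alpha> d0 (Poly_Mapping.keys m).
         card {\<rho>\<in>invar c {..<2 * n} \<inter> unicellular_rotations n \<alpha>. \<forall>v\<in>c ` {..<2 * n}. orbit_count n \<rho> c v = Poly_Mapping.lookup m v})"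
    by (rule series_labelled[OF order_refl relabel_unicellular(1)])
  ultimately show ?thesis by (simp only:)
qed

lemma R_series_labelled:
  assumes n: "n \<ge> 1"
  shows "fact (2 * n) * R_series (n + 1) m = int (\<Sum>\<alpha>\<in>involutions n. \<Sum>d0<2 * n. \<Sum>c\<in>root_colorings n \<alpha> d0 (Poly_Mapping.keys m).
         card {\<rho>\<in>invar c {..<2 * n} \<inter> tree_rotations {..<2 * n} \<alpha>. \<forall>v\<in>c ` {..<2 * n}. orbit_count n \<rho> c v = Poly_Mapping.lookup m v})"
proof -
  let ?U = "{M\<in>rooted_maps n. rot M \<in> tree_rotations {..<2 * n} (opp M)}"
  let ?w = "\<lambda>M. card (dart_colorings n (rot M) (opp M) (root_dart M) m)"
  note R = rooted_maps_reps(1)[of n]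
  have U: "unicellular M \<and> has_genus M 0 \<longleftrightarrow> rot M \<in> tree_rotations {..<2 * n} (opp M)"
    "rot M \<in> tree_rotations {..<2 * n} (opp M) \<Longrightarrow> bipartite M" if "M \<in> rooted_maps n" for M
  proof -
    interpret labelled_map n M by unfold_locales (use R that in blast)
    show "unicellular M \<and> has_genus M 0 \<longleftrightarrow> rot M \<in> tree_rotations {..<2 * n} (opp M)"
      using plane_tree_iff[OF n] .
    show "rot M \<in> tree_rotations {..<2 * n} (opp M) \<Longrightarrow> bipartite M" using tree_bipartite[OF n] .
  qed
  have "plane_trees n = ?U" unfolding plane_trees_def using U(1) by blast
  then have "R_series (n + 1) m = weight_series ?U m" by (simp add: R_series_def)
  also have "\<dots> = int (\<Sum>M\<in>?U. ?w M)" by (rule weight_series_eq) (use R U(2) in auto)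
  finally have "fact (2 * n) * R_series (n + 1) m = int (fact (2 * n) * (\<Sum>M\<in>?U. ?w M))" by simp
  moreover have "fact (2 * n) * (\<Sum>M\<in>?U. ?w M) = (\<Sum>\<alpha>\<in>involutions n. \<Sum>d0<2 * n. \<Sum>c\<in>root_colorings n \<alpha> d0 (Poly_Mapping.keys m).
         card {\<rho>\<in>invar c {..<2 * n} \<inter> tree_rotations {..<2 * n} \<alpha>. \<forall>v\<in>c ` {..<2 * n}. orbit_count n \<rho> c v = Poly_Mapping.lookup m v})"
    by (rule series_labelled[OF tree_rotations_sub relabel_unicellular(2)])
  ultimately show ?thesis by (simp only:)
qed

theorem theorem4p2:
  fixes n :: nat
  assumes "n \<ge> 1"
  shows "(\<lambda>m. 2 ^ (n + 1) * F_series n m) = D_op (R_series (n + 1))"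
proof
  fix m :: monomial
  let ?D = "{..<2 * n}"
  let ?K = "Poly_Mapping.keys m"
  let ?T = "\<lambda>\<alpha>. tree_rotations ?D \<alpha>"
  let ?d = "\<lambda>\<rho> c. \<Prod>v\<in>?K. D_coeff (orbit_count n \<rho> c v) (Poly_Mapping.lookup m v)"
  \<comment> \<open>All data of a labelled plane tree coloured with exactly the variables
    \<open>?K\<close>; by \<open>lookup_D_monomial\<close> no other set of variables can contribute
    to the coefficient of \<open>m\<close>.\<close>
  let ?X = "SIGMA \<alpha>:involutions n. SIGMA d0:?D. SIGMA c:root_colorings n \<alpha> d0 ?K. invar c ?D \<inter> ?T \<alpha>"
  let ?mon = "\<lambda>(\<alpha>, d0, c, \<rho>). \<Sum>v\<in>?K. Poly_Mapping.single v (orbit_count n \<rho> c v)"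
  have cK: "c ` ?D = ?K" if "c \<in> root_colorings n \<alpha> d0 ?K" for c \<alpha> d0 using that by (simp add: root_colorings_def)
  have finT: "finite (?T \<alpha>)" for \<alpha> using tree_rotations_sub finite_unicellular_rotations by (rule finite_subset)
  have finC: "finite (root_colorings n \<alpha> d0 ?K)" for \<alpha> d0 by (simp add: finite_root_colorings)
  have finX: "finite ?X" using finite_involutions finC finT by (intro finite_SigmaI finite_Int) auto
  have sumX: "(\<Sum>\<alpha>\<in>involutions n. \<Sum>d0<2 * n. \<Sum>c\<in>root_colorings n \<alpha> d0 ?K. \<Sum>\<rho>\<in>invar c ?D \<inter> ?T \<alpha>. H \<alpha> d0 c \<rho>)
     = (\<Sum>(\<alpha>, d0, c, \<rho>)\<in>?X. H \<alpha> d0 c \<rho>)" for H :: "(nat \<Rightarrow> nat) \<Rightarrow> nat \<Rightarrow> (nat \<Rightarrow> var) \<Rightarrow> (nat \<Rightarrow> nat) \<Rightarrow> nat"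
    using finite_involutions finC finT by (simp add: sum_Sigma_flat)
  \<comment> \<open>The identity for one colouring: the spare point for the leg is
    \<open>2 * n\<close>, and \<open>osum\<close> restricted to one number of cycles is
    \<open>D_coeff\<close>.\<close>
  have main: "2 ^ (n + 1) * card {\<rho>\<in>invar c ?D \<inter> unicellular_rotations n \<alpha>. \<forall>v\<in>c ` ?D. orbit_count n \<rho> c v = Poly_Mapping.lookup m v}
     = (\<Sum>\<rho>\<in>invar c ?D \<inter> ?T \<alpha>. ?d \<rho> c)" if a: "\<alpha> \<in> involutions n" and c: "c \<in> root_colorings n \<alpha> d0 ?K" for \<alpha> d0 c
  proof -
    have "{\<rho>\<in>invar c ?D \<inter> unicellular_rotations n \<alpha>. \<forall>v\<in>c ` ?D. orbit_count n \<rho> c v = Poly_Mapping.lookup m v}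
      = {\<rho>\<in>invar c ?D. one_orbit (\<rho> \<circ> \<alpha>) ?D \<and> (\<forall>v\<in>c ` ?D. card (orbit \<rho> ` {x\<in>?D. c x = v}) = Poly_Mapping.lookup m v)}"
      by (auto simp: unicellular_rotations_def invar_def orbit_count_def)
    moreover have "2 ^ (card ?D div 2 + 1) * card \<dots> = (\<Sum>\<rho>\<in>invar c ?D \<inter> ?T \<alpha>.
        \<Prod>v\<in>c ` ?D. osum (\<lambda>j. if j = Poly_Mapping.lookup m v then 2 ^ j else 0) (card (orbit \<rho> ` {x\<in>?D. c x = v})))"
      using assms a by (intro unicellular_tree_refined[where l = "2 * n"]) (auto simp: involutions_def lessThan_empty_iff)
    ultimately show ?thesis unfolding cK[OF c] by (simp add: D_coeff_osum orbit_count_def)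
  qed
  have F: "fact (2 * n) * (2 ^ (n + 1) * F_series n m) = int (\<Sum>(\<alpha>, d0, c, \<rho>)\<in>?X. ?d \<rho> c)"
  proof -
    have "fact (2 * n) * (2 ^ (n + 1) * F_series n m) = 2 ^ (n + 1) * (fact (2 * n) * F_series n m)" by simp
    also have "\<dots> = int (\<Sum>\<alpha>\<in>involutions n. \<Sum>d0<2 * n. \<Sum>c\<in>root_colorings n \<alpha> d0 ?K. 2 ^ (n + 1) *
         card {\<rho>\<in>invar c ?D \<inter> unicellular_rotations n \<alpha>. \<forall>v\<in>c ` ?D. orbit_count n \<rho> c v = Poly_Mapping.lookup m v})"
      unfolding F_series_labelled[OF assms] by (simp add: sum_distrib_left)
    also have "\<dots> = int (\<Sum>\<alpha>\<in>involutions n. \<Sum>d0<2 * n. \<Sum>c\<in>root_colorings n \<alpha> d0 ?K. \<Sum>\<rho>\<in>invar c ?D \<inter> ?T \<alpha>. ?d \<rho> c)"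
      by (intro arg_cong[where f = int] sum.cong refl main)
    finally show ?thesis unfolding sumX .
  qed
  have keys_mon: "Poly_Mapping.keys (?mon x) = ?K" "\<And>v. v \<in> ?K \<Longrightarrow> Poly_Mapping.lookup (?mon x) v = orbit_count n (snd (snd (snd x))) (fst (snd (snd x))) v"
    if x: "x \<in> ?X" for x
  proof -
    obtain \<alpha> d0 c \<rho> where u: "x = (\<alpha>, d0, c, \<rho>)" "c \<in> root_colorings n \<alpha> d0 ?K" using x by auto
    have lk: "Poly_Mapping.lookup (?mon x) v = (if v \<in> ?K then orbit_count n \<rho> c v else 0)" for v
      using u by (simp add: lookup_sum lookup_single when_def)
    have pos: "orbit_count n \<rho> c v > 0 \<longleftrightarrow> v \<in> ?K" for v
      unfolding orbit_count_def cK[OF u(2), symmetric] by (rule count_pos_iff[OF finite_lessThan])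
    have gen: "(0 < q) = b \<Longrightarrow> ((if b then q else 0) \<noteq> 0) = b" for q :: nat and b by auto
    show "Poly_Mapping.keys (?mon x) = ?K"
    proof (rule set_eqI)
      fix v show "v \<in> Poly_Mapping.keys (?mon x) \<longleftrightarrow> v \<in> ?K"
        unfolding in_keys_iff[of v "?mon x"] lk by (rule gen[OF pos])
    qed
    show "Poly_Mapping.lookup (?mon x) v = orbit_count n (snd (snd (snd x))) (fst (snd (snd x))) v" if "v \<in> ?K" for v
      using lk that u by simp
  qed
  have R: "fact (2 * n) * R_series (n + 1) m' = int (card {x\<in>?X. ?mon x = m'})" if m': "Poly_Mapping.keys m' = ?K" for m'
  proof -
    have "fact (2 * n) * R_series (n + 1) m' = int (\<Sum>\<alpha>\<in>involutions n. \<Sum>d0<2 * n. \<Sum>c\<in>root_colorings n \<alpha> d0 ?K.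
        \<Sum>\<rho>\<in>invar c ?D \<inter> ?T \<alpha>. if ?mon (\<alpha>, d0, c, \<rho>) = m' then 1 else 0)"
      unfolding R_series_labelled[OF assms] m'
    proof (intro arg_cong[where f = int] sum.cong refl)
      fix \<alpha> d0 c assume c: "c \<in> root_colorings n \<alpha> d0 ?K"
      have "(\<forall>v\<in>c ` ?D. orbit_count n \<rho> c v = Poly_Mapping.lookup m' v) \<longleftrightarrow> ?mon (\<alpha>, d0, c, \<rho>) = m'" for \<rho>
        unfolding cK[OF c] using sum_single_eq_iff[of ?K "orbit_count n \<rho> c" m'] m' by simp
      then show "card {\<rho>\<in>invar c ?D \<inter> ?T \<alpha>. \<forall>v\<in>c ` ?D. orbit_count n \<rho> c v = Poly_Mapping.lookup m' v}
        = (\<Sum>\<rho>\<in>invar c ?D \<inter> ?T \<alpha>. if ?mon (\<alpha>, d0, c, \<rho>) = m' then 1 else 0)"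
        using finT by (simp add: sum.If_cases Int_def)
    qed
    also have "\<dots> = int (\<Sum>x\<in>?X. if ?mon x = m' then 1 else 0)" unfolding sumX by (simp add: case_prod_beta)
    also have "\<dots> = int (card {x\<in>?X. ?mon x = m'})" using finX by (simp add: sum.If_cases Int_def)
    finally show ?thesis .
  qed
  let ?c = "\<lambda>m'. Poly_Mapping.lookup (D_monomial m') m"
  \<comment> \<open>Only the finitely many monomials of the trees in \<open>?X\<close> contribute,
    so \<open>Sum_any\<close> is a genuine finite sum and not its default value 0.\<close>
  have supp: "{m'. R_series (n + 1) m' * ?c m' \<noteq> 0} \<subseteq> ?mon ` ?X"
  proof
    fix m' assume "m' \<in> {m'. R_series (n + 1) m' * ?c m' \<noteq> 0}"
    then have r: "R_series (n + 1) m' \<noteq> 0" and "?c m' \<noteq> 0" by auto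
    then have k: "Poly_Mapping.keys m' = ?K" by (auto simp: lookup_D_monomial split: if_splits)
    have "card {x\<in>?X. ?mon x = m'} \<noteq> 0"
    proof
      assume "card {x\<in>?X. ?mon x = m'} = 0"
      then have "fact (2 * n) * R_series (n + 1) m' = 0" unfolding R[OF k] by simp
      then show False using r by simp
    qed
    then have "{x\<in>?X. ?mon x = m'} \<noteq> {}" by (metis card.empty)
    then show "m' \<in> ?mon ` ?X" by blast
  qed
  have "fact (2 * n) * D_op (R_series (n + 1)) m = fact (2 * n) * (\<Sum>m'\<in>?mon ` ?X. R_series (n + 1) m' * ?c m')"
    unfolding D_op_def using finX supp by (subst Sum_any.expand_superset[of "?mon ` ?X"]) auto
  also have "\<dots> = (\<Sum>m'\<in>?mon ` ?X. (fact (2 * n) * R_series (n + 1) m') * ?c m')"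
    by (simp add: sum_distrib_left mult.assoc)
  \<comment> \<open>Multiplied by \<open>fact (2 * n)\<close>, the coefficient of a monomial is the
    number of elements of \<open>?X\<close> lying over it; the sum over monomials becomes one over
    coloured trees.\<close>
  also have "\<dots> = (\<Sum>m'\<in>?mon ` ?X. \<Sum>x\<in>{x\<in>?X. ?mon x = m'}. ?c (?mon x))"
  proof (rule sum.cong[OF refl])
    fix m' assume "m' \<in> ?mon ` ?X"
    then have "Poly_Mapping.keys m' = ?K" using keys_mon(1) by blast
    then have "(fact (2 * n) * R_series (n + 1) m') * ?c m' = int (card {x\<in>?X. ?mon x = m'}) * ?c m'" by (simp only: R)
    also have "\<dots> = (\<Sum>x\<in>{x\<in>?X. ?mon x = m'}. ?c m')" by simp
    also have "\<dots> = (\<Sum>x\<in>{x\<in>?X. ?mon x = m'}. ?c (?mon x))" by (rule sum.cong) auto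
    finally show "(fact (2 * n) * R_series (n + 1) m') * ?c m' = (\<Sum>x\<in>{x\<in>?X. ?mon x = m'}. ?c (?mon x))" .
  qed
  also have "\<dots> = (\<Sum>x\<in>?X. ?c (?mon x))"
    using finX by (rule sum.image_gen[symmetric])
  also have "\<dots> = (\<Sum>x\<in>?X. int (?d (snd (snd (snd x))) (fst (snd (snd x)))))"
  proof (rule sum.cong[OF refl])
    fix x assume x: "x \<in> ?X"
    show "?c (?mon x) = int (?d (snd (snd (snd x))) (fst (snd (snd x))))"
      unfolding lookup_D_monomial keys_mon(1)[OF x] using keys_mon(2)[OF x] by simp
  qed
  also have "\<dots> = int (\<Sum>(\<alpha>, d0, c, \<rho>)\<in>?X. ?d \<rho> c)"
    by (simp add: case_prod_beta)
  finally have "fact (2 * n) * (2 ^ (n + 1) * F_series n m) = fact (2 * n) * D_op (R_series (n + 1)) m"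
    using F by simp
  then show "2 ^ (n + 1) * F_series n m = D_op (R_series (n + 1)) m" by simp
qed

end
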